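(* An infinite hereditarily minimal locally compact hypercentral group $G$ is isomorphic (as a topological group) to $\mathbb{Z}_p$ for some prime $p$.
   Context: All topological groups are Hausdorff. A Hausdorff topological group $(G,\tau)$ is minimal if there is no Hausdorff group topology on $G$ strictly coarser than $\tau$. A topological group is hereditarily minimal if every subgroup of it (not necessarily closed), with the subspace topology, is minimal. The upper central series of a group $G$ is defined by $Z_0(G)=\{e\}$, $Z_{\alpha+1}(G)=\pi_\alpha^{-1}(Z(G/Z_\alpha(G)))$ where $\pi_\alpha:G\to G/Z_\alpha(G)$ is the canonical projection, and $Z_\lambda(G)=\bigcup_{\alpha<\lambda}Z_\alpha(G)$ for limit ordinals $\lambda$; $G$ is hypercentral if $G=Z_\alpha(G)$ for some ordinal $\alpha$. $\mathbb{Z}_p$ is the additive group of $p$-adic integers with the $p$-adic topology. *)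

theory Defs
  imports
    "HOL-Algebra.Coset"
    "HOL-Computational_Algebra.Primes"
    "HOL-Analysis.Analysis"
begin

section \<open>Minimality of topological groups\<close>

text \<open>Topological groups are Hausdorff by convention.\<close>

definition topological_group :: "('a, 'm) monoid_scheme \<Rightarrow> 'a topology \<Rightarrow> bool" where
  "topological_group G T \<longleftrightarrow>
     group G \<and> topspace T = carrier G \<and> Hausdorff_space T \<and>
     continuous_map (prod_topology T T) T (\<lambda>(x, y). x \<otimes>\<^bsub>G\<^esub> y) \<and>
     continuous_map T T (\<lambda>x. inv\<^bsub>G\<^esub> x)"

definition strictly_coarser :: "'a topology \<Rightarrow> 'a topology \<Rightarrow> bool" where
  "strictly_coarser T' T \<longleftrightarrow> (\<forall>U. openin T' U \<longrightarrow> openin T U) \<and> T' \<noteq> T"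

definition minimal_topological_group :: "('a, 'm) monoid_scheme \<Rightarrow> 'a topology \<Rightarrow> bool" where
  "minimal_topological_group G T \<longleftrightarrow>
     topological_group G T \<and> \<not> (\<exists>T'. topological_group G T' \<and> strictly_coarser T' T)"

definition hereditarily_minimal :: "('a, 'm) monoid_scheme \<Rightarrow> 'a topology \<Rightarrow> bool" where
  "hereditarily_minimal G T \<longleftrightarrow>
     topological_group G T \<and>
     (\<forall>H. subgroup H G \<longrightarrow>
        minimal_topological_group (G\<lparr>carrier := H\<rparr>) (subtopology T H))"

definition topological_group_isomorphic ::
  "('a, 'm) monoid_scheme \<Rightarrow> 'a topology \<Rightarrow> ('b, 'n) monoid_scheme \<Rightarrow> 'b topology \<Rightarrow> bool" where
  "topological_group_isomorphic G T H S \<longleftrightarrow>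
     (\<exists>f. f \<in> iso G H \<and> homeomorphic_map T S f)"

section \<open>Hypercentral groups\<close>

definition group_center :: "('a, 'm) monoid_scheme \<Rightarrow> 'a set" where
  "group_center G = {z \<in> carrier G. \<forall>x \<in> carrier G. x \<otimes>\<^bsub>G\<^esub> z = z \<otimes>\<^bsub>G\<^esub> x}"

definition center_modulo :: "('a, 'm) monoid_scheme \<Rightarrow> 'a set \<Rightarrow> 'a set" where
  "center_modulo G N = {x \<in> carrier G. N #>\<^bsub>G\<^esub> x \<in> group_center (G Mod N)}"

text \<open>
  Ordinals are represented by the elements of a well-order \<open>r\<close>: an element \<open>\<alpha>\<close> of its field
  stands for the order type of \<open>underS r \<alpha>\<close>. Thus \<open>\<alpha>\<close> is zero if \<open>underS r \<alpha>\<close> is empty, and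
  is the successor of \<open>\<beta>\<close> if \<open>underS r \<alpha> = under r \<beta>\<close>. The three lemmas following the definition
  are the defining clauses of the upper central series.
\<close>

definition upper_central_series :: "('a, 'm) monoid_scheme \<Rightarrow> 'o rel \<Rightarrow> 'o \<Rightarrow> 'a set" where
  "upper_central_series G r = wo_rel.worec r (\<lambda>Z \<alpha>.
     if underS r \<alpha> = {} then {\<one>\<^bsub>G\<^esub>}
     else if \<exists>\<beta> \<in> underS r \<alpha>. underS r \<alpha> = under r \<beta>
     then center_modulo G (Z (THE \<beta>. \<beta> \<in> underS r \<alpha> \<and> underS r \<alpha> = under r \<beta>))
     else \<Union>\<beta> \<in> underS r \<alpha>. Z \<beta>)"

lemma immediate_pred_unique:
  assumes "Well_order r" "\<beta> \<in> underS r \<alpha>" "underS r \<alpha> = under r \<beta>"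
  shows "(THE \<beta>. \<beta> \<in> underS r \<alpha> \<and> underS r \<alpha> = under r \<beta>) = \<beta>"
proof (rule the_equality)
  fix \<gamma> assume "\<gamma> \<in> underS r \<alpha> \<and> underS r \<alpha> = under r \<gamma>"
  then show "\<gamma> = \<beta>"
    using assms wo_rel.ANTISYM[of r] unfolding wo_rel_def under_def antisym_def by blast
qed (use assms in simp)

lemma upper_central_series_unfold:
  fixes G :: "('a, 'm) monoid_scheme" and r :: "'o rel"
  assumes "Well_order r"
  shows "upper_central_series G r \<alpha> =
    (if underS r \<alpha> = {} then {\<one>\<^bsub>G\<^esub>}
     else if \<exists>\<beta> \<in> underS r \<alpha>. underS r \<alpha> = under r \<beta>
     then center_modulo G (upper_central_series G r
            (THE \<beta>. \<beta> \<in> underS r \<alpha> \<and> underS r \<alpha> = under r \<beta>))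
     else \<Union>\<beta> \<in> underS r \<alpha>. upper_central_series G r \<beta>)"
proof -
  interpret wo: wo_rel r using assms by (simp add: wo_rel_def)
  let ?H = "\<lambda>Z \<alpha>.
     if underS r \<alpha> = {} then {\<one>\<^bsub>G\<^esub>}
     else if \<exists>\<beta> \<in> underS r \<alpha>. underS r \<alpha> = under r \<beta>
     then center_modulo G (Z (THE \<beta>. \<beta> \<in> underS r \<alpha> \<and> underS r \<alpha> = under r \<beta>))
     else \<Union>\<beta> \<in> underS r \<alpha>. Z \<beta>"
  have "wo.adm_wo ?H"
    unfolding wo.adm_wo_def
  proof (intro allI impI)
    fix f g :: "'o \<Rightarrow> 'a set" and x
    assume eq: "\<forall>y \<in> underS r x. f y = g y"
    show "?H f x = ?H g x"
    proof (cases "\<exists>\<beta> \<in> underS r x. underS r x = under r \<beta>")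
      case True
      then obtain \<beta> where "\<beta> \<in> underS r x" "underS r x = under r \<beta>" by blast
      then show ?thesis using eq immediate_pred_unique[OF assms] by simp
    next
      case False
      then show ?thesis using eq by simp
    qed
  qed
  from wo.worec_fixpoint[OF this] show ?thesis
    unfolding upper_central_series_def by meson
qed

lemma upper_central_series_zero:
  assumes "Well_order r" "underS r \<alpha> = {}"
  shows "upper_central_series G r \<alpha> = {\<one>\<^bsub>G\<^esub>}"
  by (subst upper_central_series_unfold[OF assms(1)]) (simp add: assms(2))

lemma upper_central_series_succ:
  assumes "Well_order r" "\<beta> \<in> underS r \<alpha>" "underS r \<alpha> = under r \<beta>"
  shows "upper_central_series G r \<alpha> = center_modulo G (upper_central_series G r \<beta>)"
proof -
  have "underS r \<alpha> \<noteq> {}" "\<exists>\<beta> \<in> underS r \<alpha>. underS r \<alpha> = under r \<beta>"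
    using assms by blast+
  then show ?thesis
    by (subst upper_central_series_unfold[OF assms(1)])
      (simp only: if_True if_False immediate_pred_unique[OF assms])
qed

lemma upper_central_series_limit:
  assumes "Well_order r" "underS r \<alpha> \<noteq> {}"
    and "\<And>\<beta>. \<beta> \<in> underS r \<alpha> \<Longrightarrow> underS r \<alpha> \<noteq> under r \<beta>"
  shows "upper_central_series G r \<alpha> = (\<Union>\<beta> \<in> underS r \<alpha>. upper_central_series G r \<beta>)"
proof -
  have "\<not> (\<exists>\<beta> \<in> underS r \<alpha>. underS r \<alpha> = under r \<beta>)"
    using assms(3) by blast
  with assms(2) show ?thesis
    by (subst upper_central_series_unfold[OF assms(1)]) (simp only: if_False)
qed

text \<open>
  A definition cannot quantify over all ordinals, so the well-order is required to live on
  \<open>'a set\<close>. This is no restriction: by lemma \<open>hypercentralI\<close> below, the series reaching \<open>G\<close>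
  along a well-order on any type whatsoever suffices.
\<close>

definition hypercentral :: "('a, 'm) monoid_scheme \<Rightarrow> bool" where
  "hypercentral G \<longleftrightarrow>
     (\<exists>(r :: 'a set rel) \<alpha>. Well_order r \<and> \<alpha> \<in> Field r \<and>
        upper_central_series G r \<alpha> = carrier G)"

lemma normal_center_modulo:
  fixes G (structure)
  assumes "N \<lhd> G"
  shows "center_modulo G N \<lhd> G" and "N \<subseteq> center_modulo G N"
proof -
  interpret normal N G by fact
  have Q: "carrier (G Mod N) = (\<lambda>x. N #>\<^bsub>G\<^esub> x) ` carrier G"
    by (auto simp: FactGroup_def RCOSETS_def)
  have mem: "x \<in> center_modulo G N \<longleftrightarrow>
      x \<in> carrier G \<and> (\<forall>y \<in> carrier G. N #> (y \<otimes> x) = N #> (x \<otimes> y))" for x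
    unfolding center_modulo_def group_center_def Q
    by (auto simp: rcos_sum FactGroup_def)
  have memD: "x \<in> carrier G" if "x \<in> center_modulo G N" for x
    using that by (simp add: mem)
  have comm: "N #> (y \<otimes> x) = N #> (x \<otimes> y)"
    if "x \<in> center_modulo G N" "y \<in> carrier G" for x y
    using that by (simp add: mem)
  show sub: "N \<subseteq> center_modulo G N"
  proof
    fix x assume x: "x \<in> N"
    then have xc: "x \<in> carrier G" and "N #> x = N #> \<one>"
      using coset_join2[OF _ subgroup_axioms] subset by (auto simp: coset_mult_one)
    then have "N #> (y \<otimes> x) = N #> (x \<otimes> y)" if "y \<in> carrier G" for y
      using that rcos_sum[of y x] rcos_sum[of x y] rcos_sum[of y \<one>] rcos_sum[of \<one> y] by simp
    with xc show "x \<in> center_modulo G N" by (simp add: mem)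
  qed
  have conj: "N #> (y \<otimes> x \<otimes> inv y) = N #> x"
    if "x \<in> center_modulo G N" "y \<in> carrier G" for x y
  proof -
    have x: "x \<in> carrier G" using that memD by blast
    have "N #> (y \<otimes> x \<otimes> inv y) = (N #> (y \<otimes> x)) <#> (N #> inv y)"
      using that x by (simp add: rcos_sum)
    also have "\<dots> = (N #> (x \<otimes> y)) <#> (N #> inv y)" using comm[OF that] by simp
    also have "\<dots> = N #> (x \<otimes> y \<otimes> inv y)" using that x by (simp add: rcos_sum)
    finally show ?thesis using that x by (simp add: m_assoc)
  qed
  have "subgroup (center_modulo G N) G"
  proof (rule subgroupI)
    show "center_modulo G N \<subseteq> carrier G" by (auto simp: center_modulo_def)
    show "center_modulo G N \<noteq> {}" using sub subgroup.one_closed[OF subgroup_axioms] by blast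
  next
    fix x assume x: "x \<in> center_modulo G N"
    then have xc: "x \<in> carrier G" by (rule memD)
    have "N #> (y \<otimes> inv x) = N #> (inv x \<otimes> y)" if y: "y \<in> carrier G" for y
    proof -
      have "N #> (inv x \<otimes> y) = (N #> inv x) <#> (N #> (y \<otimes> x \<otimes> inv x))"
        using xc y by (simp add: rcos_sum m_assoc)
      also have "\<dots> = (N #> inv x) <#> ((N #> (y \<otimes> x)) <#> (N #> inv x))"
        using xc y by (simp add: rcos_sum)
      also have "\<dots> = (N #> inv x) <#> ((N #> (x \<otimes> y)) <#> (N #> inv x))"
        using comm[OF x y] by simp
      also have "\<dots> = N #> (inv x \<otimes> (x \<otimes> y \<otimes> inv x))" using xc y by (simp add: rcos_sum)
      also have "inv x \<otimes> (x \<otimes> y \<otimes> inv x) = y \<otimes> inv x"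
        using xc y by (simp flip: m_assoc)
      finally show ?thesis by simp
    qed
    with xc show "inv x \<in> center_modulo G N" by (simp add: mem)
  next
    fix x z assume x: "x \<in> center_modulo G N" and z: "z \<in> center_modulo G N"
    then have c: "x \<in> carrier G" "z \<in> carrier G" by (simp_all add: memD)
    have "N #> (y \<otimes> (x \<otimes> z)) = N #> (x \<otimes> z \<otimes> y)" if y: "y \<in> carrier G" for y
    proof -
      have "N #> (y \<otimes> (x \<otimes> z)) = (N #> (y \<otimes> x)) <#> (N #> z)"
        using c y by (simp add: rcos_sum m_assoc)
      also have "\<dots> = (N #> (x \<otimes> y)) <#> (N #> z)" using comm[OF x y] by simp
      also have "\<dots> = (N #> x) <#> (N #> (y \<otimes> z))"
        using c y by (simp add: rcos_sum m_assoc)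
      also have "\<dots> = (N #> x) <#> (N #> (z \<otimes> y))" using comm[OF z y] by simp
      also have "\<dots> = N #> (x \<otimes> z \<otimes> y)" using c y by (simp add: rcos_sum m_assoc)
      finally show ?thesis .
    qed
    with c show "x \<otimes> z \<in> center_modulo G N" by (simp add: mem)
  qed
  moreover have "y \<otimes> x \<otimes> inv y \<in> center_modulo G N"
    if "y \<in> carrier G" "x \<in> center_modulo G N" for x y
    using that conj[OF that(2,1)] by (auto simp: center_modulo_def)
  ultimately show "center_modulo G N \<lhd> G"
    using normal_inv_iff by blast
qed

lemma upper_central_series_normal_mono:
  fixes G (structure)
  assumes "group G" "Well_order r" "\<alpha> \<in> Field r"
  shows "upper_central_series G r \<alpha> \<lhd> G \<and>
    (\<forall>\<beta>. (\<beta>, \<alpha>) \<in> r \<longrightarrow> upper_central_series G r \<beta> \<subseteq> upper_central_series G r \<alpha>)"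
  using assms(3)
proof (induction \<alpha> rule: wo_rel.well_order_induct[of r])
  case 1
  show ?case using assms by (simp add: wo_rel_def)
next
  case (2 \<alpha>)
  interpret group G by fact
  interpret wo: wo_rel r using assms by (simp add: wo_rel_def)
  let ?Z = "upper_central_series G r"
  have below: "\<beta> \<in> Field r \<and> ?Z \<beta> \<lhd> G" "(\<gamma>, \<beta>) \<in> r \<Longrightarrow> ?Z \<gamma> \<subseteq> ?Z \<beta>"
    if "\<beta> \<in> underS r \<alpha>" for \<beta> \<gamma>
    using that 2 by (auto simp: underS_def Field_def)
  have cases: "\<beta> = \<alpha> \<or> \<beta> \<in> underS r \<alpha>" if "(\<beta>, \<alpha>) \<in> r" for \<beta>
    using that by (auto simp: underS_def)
  consider "underS r \<alpha> = {}"
    | \<beta> where "\<beta> \<in> underS r \<alpha>" "underS r \<alpha> = under r \<beta>"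
    | "underS r \<alpha> \<noteq> {}" "\<And>\<beta>. \<beta> \<in> underS r \<alpha> \<Longrightarrow> underS r \<alpha> \<noteq> under r \<beta>"
    by blast
  then show ?case
  proof cases
    case 1
    then show ?thesis
      using upper_central_series_zero[OF assms(2) 1, of G] cases one_is_normal by auto
  next
    case (2 \<beta>)
    note eq = upper_central_series_succ[OF assms(2) 2, of G]
    have "?Z \<beta> \<lhd> G" using below 2 by blast
    note * = normal_center_modulo[OF this]
    have "?Z \<gamma> \<subseteq> ?Z \<alpha>" if "(\<gamma>, \<alpha>) \<in> r" for \<gamma>
    proof (cases "\<gamma> = \<alpha>")
      case False
      then have "(\<gamma>, \<beta>) \<in> r" using cases[OF that] 2 by (auto simp: under_def)
      then show ?thesis using below(2)[OF 2(1)] * eq by blast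
    qed simp
    then show ?thesis using * eq by auto
  next
    case 3
    have eq: "?Z \<alpha> = (\<Union>\<beta> \<in> underS r \<alpha>. ?Z \<beta>)"
      using 3 by (rule upper_central_series_limit[OF assms(2)])
    have memI: "x \<in> ?Z \<alpha>" if "\<beta> \<in> underS r \<alpha>" "x \<in> ?Z \<beta>" for x \<beta>
      unfolding eq using that by (rule UN_I)
    have memE: "\<exists>\<beta>. \<beta> \<in> underS r \<alpha> \<and> x \<in> ?Z \<beta>" if "x \<in> ?Z \<alpha>" for x
      using that unfolding eq by (elim UN_E) (intro exI conjI)
    have norm: "?Z \<beta> \<lhd> G" if "\<beta> \<in> underS r \<alpha>" for \<beta> using below that by blast
    have sg: "subgroup (?Z \<beta>) G" if "\<beta> \<in> underS r \<alpha>" for \<beta>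
      using norm[OF that] by (simp add: normal_def)
    have "subgroup (?Z \<alpha>) G"
    proof (rule subgroupI)
      show "?Z \<alpha> \<subseteq> carrier G" unfolding eq by (intro UN_least subgroup.subset sg)
      show "?Z \<alpha> \<noteq> {}" using memI subgroup.one_closed[OF sg] 3(1) by blast
      show "inv x \<in> ?Z \<alpha>" if x: "x \<in> ?Z \<alpha>" for x
      proof -
        obtain \<delta> where d: "\<delta> \<in> underS r \<alpha>" "x \<in> ?Z \<delta>" using memE[OF x] by blast
        have "inv x \<in> ?Z \<delta>" by (rule subgroup.m_inv_closed[OF sg[OF d(1)] d(2)])
        then show ?thesis by (rule memI[OF d(1)])
      qed
      show "x \<otimes> y \<in> ?Z \<alpha>" if xy: "x \<in> ?Z \<alpha>" "y \<in> ?Z \<alpha>" for x y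
      proof -
        obtain \<beta> \<gamma> where b: "\<beta> \<in> underS r \<alpha>" "x \<in> ?Z \<beta>" and c: "\<gamma> \<in> underS r \<alpha>" "y \<in> ?Z \<gamma>"
          using memE[OF xy(1)] memE[OF xy(2)] by blast
        have "\<beta> \<in> Field r" "\<gamma> \<in> Field r"
          using below(1)[OF b(1)] below(1)[OF c(1)] by simp_all
        then have "(\<beta>, \<gamma>) \<in> r \<or> (\<gamma>, \<beta>) \<in> r" using wo.TOTALS by blast
        then have "\<exists>\<delta> \<in> underS r \<alpha>. x \<in> ?Z \<delta> \<and> y \<in> ?Z \<delta>"
        proof
          assume "(\<beta>, \<gamma>) \<in> r"
          then have "x \<in> ?Z \<gamma>" using below(2)[OF c(1)] b(2) by (meson subsetD)
          then show ?thesis using c by (intro bexI[of _ \<gamma>] conjI)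
        next
          assume "(\<gamma>, \<beta>) \<in> r"
          then have "y \<in> ?Z \<beta>" using below(2)[OF b(1)] c(2) by (meson subsetD)
          then show ?thesis using b by (intro bexI[of _ \<beta>] conjI)
        qed
        then obtain \<delta> where d: "\<delta> \<in> underS r \<alpha>" "x \<in> ?Z \<delta>" "y \<in> ?Z \<delta>"
          by blast
        have "x \<otimes> y \<in> ?Z \<delta>" by (rule subgroup.m_closed[OF sg[OF d(1)] d(2,3)])
        then show ?thesis by (rule memI[OF d(1)])
      qed
    qed
    moreover have "x \<otimes> h \<otimes> inv x \<in> ?Z \<alpha>" if x: "x \<in> carrier G" and h: "h \<in> ?Z \<alpha>" for x h
    proof -
      obtain \<delta> where d: "\<delta> \<in> underS r \<alpha>" "h \<in> ?Z \<delta>" using memE[OF h] by blast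
      have "x \<otimes> h \<otimes> inv x \<in> ?Z \<delta>"
        by (rule normal.inv_op_closed2[OF norm[OF d(1)] x d(2)])
      then show ?thesis by (rule memI[OF d(1)])
    qed
    ultimately have "?Z \<alpha> \<lhd> G" using normal_inv_iff by blast
    moreover have "?Z \<gamma> \<subseteq> ?Z \<alpha>" if "(\<gamma>, \<alpha>) \<in> r" for \<gamma>
      using cases[OF that]
    proof
      assume "\<gamma> \<in> underS r \<alpha>"
      then show ?thesis unfolding eq by (rule UN_upper)
    qed simp
    ultimately show ?thesis by blast
  qed
qed

lemma upper_central_series_stationary:
  assumes "group G" "Well_order r" "(\<beta>, \<gamma>) \<in> r" "\<beta> \<noteq> \<gamma>"
    and "upper_central_series G r \<beta> = upper_central_series G r \<gamma>"
  shows "(\<beta>, \<delta>) \<in> r \<Longrightarrow> upper_central_series G r \<delta> = upper_central_series G r \<beta>"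
proof (induction \<delta> rule: wo_rel.well_order_induct[of r])
  case 1
  show ?case using assms by (simp add: wo_rel_def)
next
  case (2 \<delta>)
  interpret wo: wo_rel r using assms by (simp add: wo_rel_def)
  let ?Z = "upper_central_series G r"
  have mono: "(x, y) \<in> r \<Longrightarrow> ?Z x \<subseteq> ?Z y" for x y
    using upper_central_series_normal_mono[OF assms(1,2), of y] by (auto simp: Field_def)
  have IH: "?Z y = ?Z \<beta>" if "y \<in> underS r \<delta>" "(\<beta>, y) \<in> r" for y
    using that 2 by (auto simp: underS_def)
  show ?case
  proof (cases "\<delta> = \<beta>")
    case False
    then have b: "\<beta> \<in> underS r \<delta>" using 2 by (auto simp: underS_def)
    have tot: "(\<beta>, y) \<in> r \<or> (y, \<beta>) \<in> r" if "y \<in> underS r \<delta>" for y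
      using that b wo.TOTALS by (auto simp: underS_def Field_def)
    consider \<epsilon> where "\<epsilon> \<in> underS r \<delta>" "underS r \<delta> = under r \<epsilon>"
      | "\<And>\<epsilon>. \<epsilon> \<in> underS r \<delta> \<Longrightarrow> underS r \<delta> \<noteq> under r \<epsilon>"
      by blast
    then show ?thesis
    proof cases
      case (1 \<epsilon>)
      then have be: "(\<beta>, \<epsilon>) \<in> r" using b by (auto simp: under_def)
      show ?thesis
      proof (cases "\<epsilon> = \<beta>")
        case True
        have "(\<delta>, \<gamma>) \<in> r"
        proof (rule ccontr)
          assume "(\<delta>, \<gamma>) \<notin> r"
          then have "(\<gamma>, \<delta>) \<in> r" "\<gamma> \<noteq> \<delta>"
            using wo.TOTALS 2(2) assms(3) by (auto simp: Field_def)
          then have "(\<gamma>, \<beta>) \<in> r" using 1 True by (auto simp: underS_def under_def)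
          then show False using assms(3,4) wo.ANTISYM by (auto simp: antisym_def)
        qed
        then show ?thesis using mono[of \<delta> \<gamma>] mono[OF 2(2)] assms(5) by blast
      next
        case False
        have sb: "\<exists>\<sigma>. \<beta> \<in> underS r \<sigma> \<and> underS r \<sigma> = under r \<beta> \<and> (\<sigma>, \<epsilon>) \<in> r"
        proof -
          let ?\<sigma> = "wo.suc {\<beta>}"
          have ab: "\<beta> \<in> Field r" and ne: "AboveS r {\<beta>} \<noteq> {}"
            using be False by (auto simp: AboveS_def Field_def)
          have g: "\<beta> \<in> underS r ?\<sigma>"
            using wo.suc_greater[of "{\<beta>}" \<beta>] ab ne by (auto simp: underS_def)
          have l: "(?\<sigma>, x) \<in> r" if "(\<beta>, x) \<in> r" "x \<noteq> \<beta>" for x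
            using wo.suc_least_AboveS[of x "{\<beta>}"] that by (auto simp: AboveS_def Field_def)
          have "underS r ?\<sigma> = under r \<beta>"
          proof
            show "under r \<beta> \<subseteq> underS r ?\<sigma>"
              using g wo.TRANS wo.ANTISYM
              unfolding under_def underS_def trans_def antisym_def by blast
            show "underS r ?\<sigma> \<subseteq> under r \<beta>"
            proof
              fix x assume x: "x \<in> underS r ?\<sigma>"
              then have "x \<in> Field r" by (auto simp: underS_def Field_def)
              moreover have "\<not> ((\<beta>, x) \<in> r \<and> x \<noteq> \<beta>)"
                using l x wo.ANTISYM by (auto simp: underS_def antisym_def)
              ultimately show "x \<in> under r \<beta>"
                using wo.TOTALS ab by (auto simp: under_def)
            qed
          qed
          then show ?thesis using g l be False by blast
        qed
        then obtain \<sigma> where s: "\<beta> \<in> underS r \<sigma>" "underS r \<sigma> = under r \<beta>" "(\<sigma>, \<epsilon>) \<in> r"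
          by blast
        have "\<sigma> \<in> underS r \<delta>" using s(3) 1 by (auto simp: under_def)
        then have "?Z \<sigma> = ?Z \<beta>" using IH s(1) by (auto simp: underS_def)
        moreover have "?Z \<sigma> = center_modulo G (?Z \<beta>)"
          by (rule upper_central_series_succ[OF assms(2) s(1,2)])
        moreover have "?Z \<delta> = center_modulo G (?Z \<epsilon>)"
          by (rule upper_central_series_succ[OF assms(2) 1])
        ultimately show ?thesis using IH[OF 1(1) be] by simp
      qed
    next
      case 2
      have "?Z \<delta> = (\<Union>y \<in> underS r \<delta>. ?Z y)"
        using b 2 by (intro upper_central_series_limit[OF assms(2)]) auto
      moreover have "?Z y \<subseteq> ?Z \<beta>" if "y \<in> underS r \<delta>" for y
        using tot[OF that] IH[OF that] mono by blast
      ultimately show ?thesis using b by blast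
    qed
  qed simp
qed

lemma upper_central_series_embed:
  assumes "Well_order r" "Well_order r'" "embed r r' f"
  shows "\<alpha> \<in> Field r \<Longrightarrow> upper_central_series G r' (f \<alpha>) = upper_central_series G r \<alpha>"
proof (induction \<alpha> rule: wo_rel.well_order_induct[of r])
  case 1
  show ?case using assms by (simp add: wo_rel_def)
next
  case (2 \<alpha>)
  interpret wo: wo_rel r using assms by (simp add: wo_rel_def)
  have u: "under r' (f x) = f ` under r x" if "x \<in> Field r" for x
    using assms(3) that by (auto simp: embed_def bij_betw_def)
  have inj: "inj_on f (Field r)" using embed_inj_on assms by blast
  have Fu: "under r x \<subseteq> Field r" "underS r x \<subseteq> Field r" for x
    by (auto simp: under_def underS_def Field_def)
  have uS: "underS r' (f \<alpha>) = f ` underS r \<alpha>"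
    using embed_underS[OF assms(1,3) 2(2)] by (simp add: bij_betw_def)
  have IH: "upper_central_series G r' (f \<beta>) = upper_central_series G r \<beta>"
    if "\<beta> \<in> underS r \<alpha>" for \<beta>
    using that 2 by (auto simp: underS_def Field_def)
  have pred: "underS r' (f \<alpha>) = under r' (f \<beta>) \<longleftrightarrow> underS r \<alpha> = under r \<beta>"
    if "\<beta> \<in> underS r \<alpha>" for \<beta>
  proof -
    have "\<beta> \<in> Field r" using that Fu(2) by blast
    then show ?thesis
      by (simp only: uS u inj_on_image_eq_iff[OF inj Fu(2) Fu(1)])
  qed
  consider "underS r \<alpha> = {}"
    | \<beta> where "\<beta> \<in> underS r \<alpha>" "underS r \<alpha> = under r \<beta>"
    | "underS r \<alpha> \<noteq> {}" "\<And>\<beta>. \<beta> \<in> underS r \<alpha> \<Longrightarrow> underS r \<alpha> \<noteq> under r \<beta>"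
    by blast
  then show ?case
  proof cases
    case 1
    then show ?thesis using uS assms by (simp add: upper_central_series_zero)
  next
    case (2 \<beta>)
    then show ?thesis
      using upper_central_series_succ[OF assms(1) 2, of G]
        upper_central_series_succ[OF assms(2), of "f \<beta>" "f \<alpha>" G] uS pred IH by auto
  next
    case 3
    have "underS r' (f \<alpha>) \<noteq> under r' \<gamma>" if \<gamma>: "\<gamma> \<in> underS r' (f \<alpha>)" for \<gamma>
    proof -
      obtain \<beta> where "\<beta> \<in> underS r \<alpha>" "\<gamma> = f \<beta>"
        using \<gamma> uS by blast
      then show ?thesis using 3(2) pred by simp
    qed
    moreover have "underS r' (f \<alpha>) \<noteq> {}" using 3(1) uS by simp
    ultimately have "upper_central_series G r' (f \<alpha>) =
        (\<Union>\<gamma> \<in> underS r' (f \<alpha>). upper_central_series G r' \<gamma>)"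
      by (intro upper_central_series_limit[OF assms(2)])
    also have "\<dots> = (\<Union>\<beta> \<in> underS r \<alpha>. upper_central_series G r \<beta>)"
      using IH by (simp add: uS)
    also have "\<dots> = upper_central_series G r \<alpha>"
      by (rule upper_central_series_limit[OF assms(1) 3, symmetric])
    finally show ?thesis .
  qed
qed

lemma hypercentralI:
  fixes r :: "'o rel"
  assumes "group G" "Well_order r" "\<alpha> \<in> Field r" "upper_central_series G r \<alpha> = carrier G"
  shows "hypercentral G"
proof -
  interpret wo: wo_rel r using assms by (simp add: wo_rel_def)
  let ?Z = "upper_central_series G r"
  let ?A = "{\<beta> \<in> Field r. ?Z \<beta> = carrier G}"
  define \<mu> where "\<mu> = wo.minim ?A"
  have "?A \<subseteq> Field r" "?A \<noteq> {}" using assms by auto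
  then have m: "\<mu> \<in> ?A" "\<And>\<beta>. \<beta> \<in> ?A \<Longrightarrow> (\<mu>, \<beta>) \<in> r"
    unfolding \<mu>_def using wo.minim_in wo.minim_least by blast+
  define s where "s = Restr r (under r \<mu>)"
  have of: "wo.ofilter (under r \<mu>)" by (rule wo.under_ofilter)
  have ws: "Well_order s" and Fs: "Field s = under r \<mu>" and es: "embed s r id"
    unfolding s_def using Well_order_Restr assms(2) Field_Restr_ofilter[OF assms(2) of]
      ofilter_embed[OF assms(2)] of by blast+
  have ne: "?Z x \<noteq> ?Z y" if "(x, y) \<in> r" "x \<noteq> y" "(y, \<mu>) \<in> r" for x y
  proof
    assume eq: "?Z x = ?Z y"
    have x\<mu>: "(x, \<mu>) \<in> r" using that wo.TRANS by (auto simp: trans_def)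
    then have "?Z \<mu> = ?Z x"
      using upper_central_series_stationary[OF assms(1,2) that(1,2) eq] by blast
    then have "x \<in> ?A" using m x\<mu> by (auto simp: Field_def)
    then have "(\<mu>, x) \<in> r" using m by blast
    then show False using x\<mu> that wo.ANTISYM by (auto simp: antisym_def)
  qed
  have inj: "inj_on ?Z (Field s)"
  proof (rule inj_onI)
    fix x y assume xy: "x \<in> Field s" "y \<in> Field s" "?Z x = ?Z y"
    then have \<mu>: "(x, \<mu>) \<in> r" "(y, \<mu>) \<in> r" by (simp_all add: Fs under_def)
    then have "x \<in> Field r" "y \<in> Field r" by (auto simp: Field_def)
    then have "(x, y) \<in> r \<or> (y, x) \<in> r" using wo.TOTALS by blast
    then show "x = y" using ne[of x y] ne[of y x] xy(3) \<mu> by auto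
  qed
  define t where "t = dir_image s ?Z"
  have wt: "Well_order t" unfolding t_def using Well_order_dir_image ws inj by blast
  have et: "embed s t ?Z"
    using dir_image_iso[OF ws inj] by (simp add: t_def BNF_Wellorder_Embedding.iso_def)
  have ms: "\<mu> \<in> Field s" using m wo.REFL by (auto simp: Fs under_def refl_on_def)
  have "upper_central_series G t (?Z \<mu>) = upper_central_series G s \<mu>"
    by (rule upper_central_series_embed[OF ws wt et ms])
  also have "\<dots> = ?Z \<mu>"
    using upper_central_series_embed[OF ws assms(2) es ms, of G] by simp
  also have "\<dots> = carrier G" using m by blast
  finally have "upper_central_series G t (?Z \<mu>) = carrier G" .
  moreover have "?Z \<mu> \<in> Field t" using ms by (auto simp: t_def dir_image_Field)
  ultimately show ?thesis using wt unfolding hypercentral_def by blast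
qed

section \<open>The p-adic integers\<close>

text \<open>
  The additive group of $p$-adic integers is the inverse limit of the groups
  $\mathbf{Z}/p^n\mathbf{Z}$, residue classes modulo $p^n$ being represented by the integers
  $0, \dots, p^n - 1$. The projection \<open>\<lambda>x. x n\<close> has kernel $p^n\mathbf{Z}_p$, so
  \<open>{y \<in> carrier. y n = x n}\<close> is the coset $x + p^n\mathbf{Z}_p$.
\<close>

definition padic_integers :: "nat \<Rightarrow> (nat \<Rightarrow> int) monoid" where
  "padic_integers p =
     \<lparr>carrier = {x. \<forall>n. x n \<in> {0..<int p ^ n} \<and> x (Suc n) mod int p ^ n = x n},
      monoid.mult = (\<lambda>x y n. (x n + y n) mod int p ^ n),
      one = (\<lambda>n. 0)\<rparr>"

definition padic_topology :: "nat \<Rightarrow> (nat \<Rightarrow> int) topology" where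
  "padic_topology p =
     subtopology (product_topology (\<lambda>n. discrete_topology UNIV) UNIV) (carrier (padic_integers p))"

lemma openin_padic_topology:
  "openin (padic_topology p) U \<longleftrightarrow>
     U \<subseteq> carrier (padic_integers p) \<and>
     (\<forall>x \<in> U. \<exists>n. {y \<in> carrier (padic_integers p). y n = x n} \<subseteq> U)"
    (is "_ \<longleftrightarrow> ?R")
proof
  let ?C = "carrier (padic_integers p)"
  have down: "x n = y n" if "x \<in> ?C" "y \<in> ?C" "x m = y m" "n \<le> m" for x y n m
    using that(4,3)
  proof (induction m rule: dec_induct)
    case (step k)
    have "x k = x (Suc k) mod int p ^ k" "y k = y (Suc k) mod int p ^ k"
      using that(1,2) by (auto simp: padic_integers_def)
    with step show ?case by simp
  qed simp
  show ?R if "openin (padic_topology p) U"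
  proof (intro conjI ballI)
    obtain V where V: "openin (product_topology (\<lambda>n. discrete_topology UNIV) UNIV) V"
      "U = V \<inter> ?C"
      using \<open>openin (padic_topology p) U\<close>
      by (auto simp: padic_topology_def openin_subtopology)
    show "U \<subseteq> ?C" using V by blast
    fix x assume x: "x \<in> U"
    then obtain W where W: "finite {i. W i \<noteq> UNIV}" "x \<in> Pi\<^sub>E UNIV W" "Pi\<^sub>E UNIV W \<subseteq> V"
      using V unfolding openin_product_topology_alt by fastforce
    obtain m where m: "\<And>i. W i \<noteq> UNIV \<Longrightarrow> i \<le> m"
      using W(1) finite_nat_set_iff_bounded_le by auto
    have "y \<in> U" if y: "y \<in> ?C" "y m = x m" for y
    proof -
      have "y i \<in> W i" for i
        using m[of i] down[of y x m i] y x V W(2) by (cases "W i = UNIV") (auto simp: PiE_iff)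
      then show ?thesis using W(3) V y by (auto simp: PiE_iff)
    qed
    then show "\<exists>n. {y \<in> ?C. y n = x n} \<subseteq> U" by blast
  qed
  show "openin (padic_topology p) U" if R: ?R
  proof (subst openin_subopen, intro ballI)
    fix x assume x: "x \<in> U"
    then obtain n where n: "{y \<in> ?C. y n = x n} \<subseteq> U" using R by blast
    have "openin (product_topology (\<lambda>n. discrete_topology UNIV) UNIV)
        {y. y \<in> topspace (product_topology (\<lambda>n::nat. discrete_topology (UNIV::int set)) UNIV) \<and> y n \<in> {x n}}"
      by (rule openin_continuous_map_preimage[OF continuous_map_product_projection]) auto
    then have "openin (padic_topology p) {y \<in> ?C. y n = x n}"
      unfolding padic_topology_def openin_subtopology by (intro exI conjI) auto
    then show "\<exists>T. openin (padic_topology p) T \<and> x \<in> T \<and> T \<subseteq> U"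
      using n x R by blast
  qed
qed

end

theory Submission
  imports Defs "HOL-Algebra.Multiplicative_Group"
begin

text \<open>Minimality says that a Hausdorff group topology on an abelian subgroup
  \<open>H\<close> that is coarser than the given one equals it. Applied to the topology induced
  from the quotient by \<open>N\<close>, this shows that every nontrivial closed subgroup
  \<open>N\<close> of the closure of \<open>H\<close> meets \<open>H\<close>; applied to Bohr
  topologies, it shows that residually discrete \<open>H\<close> are totally bounded. Hence an
  element \<open>x\<close> of infinite order generates a nondiscrete subgroup, whose closure
  \<open>K\<close> is compact and torsion-free; \<open>K\<close> is not divisible, because halving
  would contract it to a point, so \<open>p K \<noteq> K\<close> for some prime \<open>p\<close>,
  and \<open>K\<close> is $\mathbf{Z}_p$. If \<open>a \<in> K\<close> is independent of
  \<open>x\<close> and \<open>g\<close> commutes with \<open>x\<close>, then the closure of the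
  subgroup generated by \<open>x\<close> and \<open>a g\<close> contains \<open>g\<close>, so
  \<open>K\<close> meets the closure of every nontrivial cyclic subgroup that commutes with
  \<open>x\<close>.

  If the centre contains an element of infinite order, it follows that \<open>G\<close> is
  torsion-free and a torsion group modulo its centre, hence abelian; total boundedness and Baire's
  theorem give a uniform exponent modulo \<open>K\<close>, and when \<open>x\<close> minimizes
  this exponent, \<open>K = G\<close>. Otherwise \<open>G\<close> is a torsion group; it has an
  infinite abelian subgroup, and a countably infinite subgroup of the latter has a countable
  closure, hence is discrete by Baire's theorem, which contradicts total boundedness.\<close>

section \<open>Hausdorff group topologies and minimality\<close>

text \<open>Minimality is used for abelian subgroups only, where a base at the identity needs no
  condition on conjugates. The element \<open>a\<close> is needed because the subgroup generated by
  \<open>x\<close> and \<open>g\<close> already meets the closure of the powers of \<open>g\<close>.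
  Replacing \<open>g\<close> by \<open>a g\<close> keeps the closure, since \<open>a\<close> lies in
  \<open>K\<close>, but removes the intersection, since no nontrivial power of \<open>a\<close> is a
  power of \<open>x\<close>. Such an \<open>a\<close> exists because \<open>K\<close> is compact and
  not discrete, hence uncountable. If \<open>K\<close> were divisible, it would have no proper
  nontrivial closed subgroup. Then a neighbourhood \<open>U\<close> of the identity disjoint from
  one of \<open>x\<close> contains no nontrivial subgroup of \<open>K\<close>, and quantitatively:
  an element with many consecutive powers in \<open>U\<close> is close to the identity. This is what
  makes halving a contraction. The exponent is minimized because an element outside \<open>K\<close>
  yields some \<open>h\<close> outside \<open>K\<close> such that \<open>h [^] p\<close> generates
  \<open>K\<close>; passing from \<open>x\<close> to \<open>h\<close> divides the exponent by
  \<open>p\<close>. Hypercentrality enters through commutators: a normal subgroup not inside a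
  subgroup \<open>A\<close> has an element outside \<open>A\<close> all of whose commutators lie in
  \<open>A\<close>.\<close>

locale group_filter_base = comm_group A for A :: "('a, 'm) monoid_scheme" (structure) +
  fixes F :: "'a set set"
  assumes nonempty: "F \<noteq> {}"
    and sub: "U \<in> F \<Longrightarrow> U \<subseteq> carrier A"
    and one_mem: "U \<in> F \<Longrightarrow> \<one> \<in> U"
    and inter: "U \<in> F \<Longrightarrow> V \<in> F \<Longrightarrow> \<exists>W\<in>F. W \<subseteq> U \<inter> V"
    and div: "U \<in> F \<Longrightarrow> \<exists>V\<in>F. \<forall>a\<in>V. \<forall>b\<in>V. a \<otimes> inv b \<in> U"
    and sep: "x \<in> carrier A \<Longrightarrow> x \<noteq> \<one> \<Longrightarrow> \<exists>U\<in>F. x \<notin> U"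
begin

definition group_topology :: "'a topology" where
  "group_topology = topology (\<lambda>W. W \<subseteq> carrier A \<and> (\<forall>w\<in>W. \<exists>U\<in>F. \<forall>u\<in>U. w \<otimes> u \<in> W))"

lemma openin_group_topology:
  "openin group_topology W \<longleftrightarrow> W \<subseteq> carrier A \<and> (\<forall>w\<in>W. \<exists>U\<in>F. \<forall>u\<in>U. w \<otimes> u \<in> W)"
proof -
  have "istopology (\<lambda>W. W \<subseteq> carrier A \<and> (\<forall>w\<in>W. \<exists>U\<in>F. \<forall>u\<in>U. w \<otimes> u \<in> W))"
    unfolding istopology_def
  proof (intro conjI allI impI ballI)
    fix S S' w assume S: "S \<subseteq> carrier A \<and> (\<forall>w\<in>S. \<exists>U\<in>F. \<forall>u\<in>U. w \<otimes> u \<in> S)"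
      "S' \<subseteq> carrier A \<and> (\<forall>w\<in>S'. \<exists>U\<in>F. \<forall>u\<in>U. w \<otimes> u \<in> S')" and w: "w \<in> S \<inter> S'"
    have "\<exists>U\<in>F. \<forall>u\<in>U. w \<otimes> u \<in> S" "\<exists>U\<in>F. \<forall>u\<in>U. w \<otimes> u \<in> S'" using S w by auto
    then obtain U U' where "U \<in> F" "U' \<in> F" "\<forall>u\<in>U. w \<otimes> u \<in> S" "\<forall>u\<in>U'. w \<otimes> u \<in> S'"
      by blast
    with inter[of U U'] show "\<exists>U\<in>F. \<forall>u\<in>U. w \<otimes> u \<in> S \<inter> S'" by blast
  next
    fix K w assume K: "\<forall>S\<in>K. S \<subseteq> carrier A \<and> (\<forall>w\<in>S. \<exists>U\<in>F. \<forall>u\<in>U. w \<otimes> u \<in> S)" "w \<in> \<Union> K"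
    then obtain S where S: "S \<in> K" "w \<in> S" by blast
    then obtain U where "U \<in> F" "\<forall>u\<in>U. w \<otimes> u \<in> S" using K by meson
    then show "\<exists>U\<in>F. \<forall>u\<in>U. w \<otimes> u \<in> \<Union> K" using S by blast
  qed blast+
  then show ?thesis unfolding group_topology_def by (simp add: topology_inverse')
qed

lemma mult_base: "U \<in> F \<Longrightarrow> \<exists>V\<in>F. \<forall>a\<in>V. \<forall>b\<in>V. a \<otimes> b \<in> U"
proof -
  assume "U \<in> F"
  then obtain V where V: "V \<in> F" "\<forall>a\<in>V. \<forall>b\<in>V. a \<otimes> inv b \<in> U" using div by blast
  obtain W where W: "W \<in> F" "\<forall>a\<in>W. \<forall>b\<in>W. a \<otimes> inv b \<in> V" using div V by blast
  have "a \<otimes> b \<in> U" if ab: "a \<in> W" "b \<in> W" for a b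
  proof -
    have c: "a \<in> carrier A" "b \<in> carrier A" using ab sub W by blast+
    have "a \<otimes> inv \<one> \<in> V" "\<one> \<otimes> inv b \<in> V" using ab W one_mem[of W] by blast+
    then have "a \<in> V" "inv b \<in> V" using c by simp_all
    then have "a \<otimes> inv (inv b) \<in> U" using V by blast
    then show ?thesis using c by simp
  qed
  then show ?thesis using W by blast
qed

text \<open>Members of \<open>F\<close> need not be open, so neither need their translates be. The
  witness is the interior of the translate: the points \<open>z\<close> with \<open>z V\<close>
  inside it for some \<open>V\<close> in \<open>F\<close>. By \<open>mult_base\<close> this set is
  open.\<close>

lemma nbhd_group_topology:
  assumes "x \<in> carrier A" "U \<in> F"
  shows "\<exists>W. openin group_topology W \<and> x \<in> W \<and> W \<subseteq> (\<lambda>u. x \<otimes> u) ` U"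
proof (intro exI conjI)
  let ?W = "{z \<in> carrier A. \<exists>V\<in>F. \<forall>v\<in>V. z \<otimes> v \<in> (\<lambda>u. x \<otimes> u) ` U}"
  show "openin group_topology ?W"
    unfolding openin_group_topology
  proof (intro conjI ballI)
    fix w assume "w \<in> ?W"
    then obtain V where w: "w \<in> carrier A" and V: "V \<in> F" "\<forall>v\<in>V. w \<otimes> v \<in> (\<lambda>u. x \<otimes> u) ` U" by blast
    obtain V' where V': "V' \<in> F" "\<forall>a\<in>V'. \<forall>b\<in>V'. a \<otimes> b \<in> V" using mult_base V by blast
    have "w \<otimes> u \<in> ?W" if u: "u \<in> V'" for u
    proof -
      have uc: "u \<in> carrier A" using u V' sub by blast
      have "w \<otimes> u \<otimes> v \<in> (\<lambda>u. x \<otimes> u) ` U" if "v \<in> V'" for v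
      proof -
        have "v \<in> carrier A" using that V' sub by blast
        then have "w \<otimes> u \<otimes> v = w \<otimes> (u \<otimes> v)" using w uc by (simp add: m_assoc)
        then show ?thesis using V' V u that by auto
      qed
      then show ?thesis using w uc V' by blast
    qed
    then show "\<exists>U\<in>F. \<forall>u\<in>U. w \<otimes> u \<in> ?W" using V' by blast
  qed blast
  show "x \<in> ?W" using assms by blast
  show "?W \<subseteq> (\<lambda>u. x \<otimes> u) ` U"
  proof
    fix z assume "z \<in> ?W"
    then obtain V where z: "z \<in> carrier A" and V: "V \<in> F" "\<forall>v\<in>V. z \<otimes> v \<in> (\<lambda>u. x \<otimes> u) ` U" by blast
    then have "z \<otimes> \<one> \<in> (\<lambda>u. x \<otimes> u) ` U" using one_mem by blast
    then show "z \<in> (\<lambda>u. x \<otimes> u) ` U" using z by simp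
  qed
qed

lemma topspace_group_topology: "topspace group_topology = carrier A"
proof -
  have "openin group_topology (carrier A)"
    unfolding openin_group_topology using nonempty sub by blast
  then have "carrier A \<subseteq> topspace group_topology" by (rule openin_subset)
  moreover have "topspace group_topology \<subseteq> carrier A"
    using openin_topspace[of group_topology] unfolding openin_group_topology by blast
  ultimately show ?thesis by blast
qed

lemma topological_group_group_topology: "topological_group A group_topology"
  unfolding topological_group_def
proof (intro conjI)
  show "Hausdorff_space group_topology"
    unfolding Hausdorff_space_def topspace_group_topology
  proof (intro allI impI)
    fix x y assume xy: "x \<in> carrier A \<and> y \<in> carrier A \<and> x \<noteq> y"
    have "inv x \<otimes> y \<noteq> \<one>" using xy by (metis inv_equality inv_inv inv_closed)
    then obtain U where U: "U \<in> F" "inv x \<otimes> y \<notin> U" using sep[of "inv x \<otimes> y"] xy by auto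
    obtain V where V: "V \<in> F" "\<forall>a\<in>V. \<forall>b\<in>V. a \<otimes> inv b \<in> U" using div U by blast
    obtain W where W: "openin group_topology W" "x \<in> W" "W \<subseteq> (\<lambda>u. x \<otimes> u) ` V"
      using nbhd_group_topology[of x V] xy V by blast
    obtain W' where W': "openin group_topology W'" "y \<in> W'" "W' \<subseteq> (\<lambda>u. y \<otimes> u) ` V"
      using nbhd_group_topology[of y V] xy V by blast
    have "x \<otimes> a \<noteq> y \<otimes> b" if "a \<in> V" "b \<in> V" for a b
    proof
      assume eq: "x \<otimes> a = y \<otimes> b"
      have c: "a \<in> carrier A" "b \<in> carrier A" using that sub V by blast+
      have "inv x \<otimes> (x \<otimes> a) \<otimes> inv b = inv x \<otimes> (y \<otimes> b) \<otimes> inv b" using eq by simp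
      also have "inv x \<otimes> (x \<otimes> a) \<otimes> inv b = a \<otimes> inv b" using c xy by (simp flip: m_assoc)
      also have "inv x \<otimes> (y \<otimes> b) \<otimes> inv b = inv x \<otimes> y" using c xy by (simp add: m_assoc)
      finally have "a \<otimes> inv b = inv x \<otimes> y" .
      moreover have "a \<otimes> inv b \<in> U" using V(2) that by blast
      ultimately show False using U(2) by metis
    qed
    then have "disjnt W W'" using W(3) W'(3) unfolding disjnt_def by blast
    then show "\<exists>U V. openin group_topology U \<and> openin group_topology V \<and> x \<in> U \<and> y \<in> V \<and> disjnt U V"
      using W W' by blast
  qed
  show "continuous_map (prod_topology group_topology group_topology) group_topology (\<lambda>(x, y). x \<otimes> y)"
    unfolding continuous_map_def topspace_prod_topology topspace_group_topology
  proof (intro conjI allI impI)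
    fix S assume S: "openin group_topology S"
    show "openin (prod_topology group_topology group_topology)
      {z \<in> carrier A \<times> carrier A. (case z of (x, y) \<Rightarrow> x \<otimes> y) \<in> S}"
      unfolding openin_prod_topology_alt
    proof (intro allI impI)
      fix x y assume "(x, y) \<in> {z \<in> carrier A \<times> carrier A. (case z of (x, y) \<Rightarrow> x \<otimes> y) \<in> S}"
      then have xy: "x \<in> carrier A" "y \<in> carrier A" "x \<otimes> y \<in> S" by auto
      obtain U where U: "U \<in> F" "\<forall>u\<in>U. x \<otimes> y \<otimes> u \<in> S" using S xy unfolding openin_group_topology by blast
      obtain V where V: "V \<in> F" "\<forall>a\<in>V. \<forall>b\<in>V. a \<otimes> b \<in> U" using mult_base U by blast
      obtain W where W: "openin group_topology W" "x \<in> W" "W \<subseteq> (\<lambda>u. x \<otimes> u) ` V"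
        using nbhd_group_topology[of x V] xy V by blast
      obtain W' where W': "openin group_topology W'" "y \<in> W'" "W' \<subseteq> (\<lambda>u. y \<otimes> u) ` V"
        using nbhd_group_topology[of y V] xy V by blast
      have "a \<otimes> b \<in> S" if "a \<in> W" "b \<in> W'" for a b
      proof -
        have "a \<in> (\<lambda>u. x \<otimes> u) ` V" "b \<in> (\<lambda>u. y \<otimes> u) ` V"
          using that W(3) W'(3) by (meson subsetD)+
        then obtain u v where uv: "u \<in> V" "v \<in> V" "a = x \<otimes> u" "b = y \<otimes> v" by (elim imageE)
        then have c: "u \<in> carrier A" "v \<in> carrier A" using V sub by blast+
        \<comment> \<open>Commutativity moves \<open>u\<close> past \<open>y\<close>; in a
          noncommutative group the base would have to be compatible with conjugation.\<close>
        have "a \<otimes> b = x \<otimes> y \<otimes> (u \<otimes> v)" using uv c xy by (simp add: m_ac)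
        then show ?thesis using U V uv by auto
      qed
      moreover have "W \<subseteq> carrier A" "W' \<subseteq> carrier A"
        using W W' openin_group_topology by blast+
      ultimately show "\<exists>U V. openin group_topology U \<and> openin group_topology V \<and> x \<in> U \<and> y \<in> V \<and>
          U \<times> V \<subseteq> {z \<in> carrier A \<times> carrier A. (case z of (x, y) \<Rightarrow> x \<otimes> y) \<in> S}"
        using W W' by (intro exI[of _ W] exI[of _ W']) auto
    qed
  qed auto
  show "continuous_map group_topology group_topology (\<lambda>x. inv x)"
    unfolding continuous_map_def topspace_group_topology
  proof (intro conjI allI impI)
    fix S assume S: "openin group_topology S"
    show "openin group_topology {x \<in> carrier A. inv x \<in> S}"
      unfolding openin_group_topology
    proof (intro conjI ballI)
      fix w assume w: "w \<in> {x \<in> carrier A. inv x \<in> S}"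
      then obtain U where U: "U \<in> F" "\<forall>u\<in>U. inv w \<otimes> u \<in> S" using S unfolding openin_group_topology by blast
      obtain V where V: "V \<in> F" "\<forall>a\<in>V. \<forall>b\<in>V. a \<otimes> inv b \<in> U" using div U by blast
      have "inv (w \<otimes> v) \<in> S \<and> w \<otimes> v \<in> carrier A" if "v \<in> V" for v
      proof -
        have "v \<in> carrier A" "\<one> \<otimes> inv v \<in> U" using that V sub one_mem by blast+
        then show ?thesis using U w by (simp add: inv_mult)
      qed
      then show "\<exists>U\<in>F. \<forall>u\<in>U. w \<otimes> u \<in> {x \<in> carrier A. inv x \<in> S}" using V by blast
    qed blast
  qed auto
qed (auto simp: topspace_group_topology is_group)

end

section \<open>Neighbourhoods of the identity and closures of subgroups\<close>

locale topgroup = group G for G :: "('a, 'm) monoid_scheme" (structure) +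
  fixes T :: "'a topology"
  assumes topological_group: "topological_group G T"
begin

definition nbhd_one :: "'a set \<Rightarrow> bool" where
  "nbhd_one U \<longleftrightarrow> openin T U \<and> \<one> \<in> U"

definition abelian_subgroup :: "'a set \<Rightarrow> bool" where
  "abelian_subgroup H \<longleftrightarrow> subgroup H G \<and> (\<forall>x\<in>H. \<forall>y\<in>H. x \<otimes> y = y \<otimes> x)"

lemma topspace [simp]: "topspace T = carrier G"
  and Hausdorff: "Hausdorff_space T"
  and mult_cont: "continuous_map (prod_topology T T) T (\<lambda>(x, y). x \<otimes> y)"
  and inv_cont: "continuous_map T T (\<lambda>x. inv x)"
  using topological_group by (auto simp: topological_group_def)

lemma openin_carrier: "openin T U \<Longrightarrow> U \<subseteq> carrier G"
  using openin_subset by fastforce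

lemma nbhd_oneD: assumes "nbhd_one U" shows "openin T U" "\<one> \<in> U" "U \<subseteq> carrier G"
  using assms openin_carrier by (auto simp: nbhd_one_def)

lemma nbhd_one_Int: "nbhd_one U \<Longrightarrow> nbhd_one V \<Longrightarrow> nbhd_one (U \<inter> V)"
  by (auto simp: nbhd_one_def)

lemma nbhd_one_carrier: "nbhd_one (carrier G)"
  using openin_topspace[of T] by (simp add: nbhd_one_def)

lemma cont_mult:
  assumes "continuous_map X T f" "continuous_map X T g"
  shows "continuous_map X T (\<lambda>x. f x \<otimes> g x)"
proof -
  have "continuous_map X (prod_topology T T) (\<lambda>x. (f x, g x))"
    using assms by (simp add: continuous_map_pairedI)
  from continuous_map_compose[OF this mult_cont] show ?thesis by (simp add: o_def)
qed

lemma cont_lmult: "a \<in> carrier G \<Longrightarrow> continuous_map T T (\<lambda>x. a \<otimes> x)"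
  by (rule cont_mult) auto

lemma cont_pow: "continuous_map X T f \<Longrightarrow> continuous_map X T (\<lambda>x. f x [^] (n::nat))"
  by (induction n) (auto intro: cont_mult)

lemma openin_lmult: "a \<in> carrier G \<Longrightarrow> openin T U \<Longrightarrow> openin T {x \<in> carrier G. a \<otimes> x \<in> U}"
  using openin_continuous_map_preimage[OF cont_lmult] by fastforce

lemma nbhd_one_div:
  assumes "nbhd_one U"
  shows "\<exists>V. nbhd_one V \<and> V \<subseteq> U \<and> (\<forall>v\<in>V. inv v \<in> V) \<and> (\<forall>a\<in>V. \<forall>b\<in>V. a \<otimes> b \<in> U)"
proof -
  let ?P = "{z \<in> topspace (prod_topology T T). (case z of (x, y) \<Rightarrow> x \<otimes> y) \<in> U}"
  have "openin (prod_topology T T) ?P"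
    using openin_continuous_map_preimage[OF mult_cont nbhd_oneD(1)[OF assms]] .
  moreover have "(\<one>, \<one>) \<in> ?P"
    using nbhd_oneD[OF assms] by simp
  ultimately have "\<exists>A B. openin T A \<and> openin T B \<and> \<one> \<in> A \<and> \<one> \<in> B \<and> A \<times> B \<subseteq> ?P"
    unfolding openin_prod_topology_alt[of T T ?P] by (elim allE impE)
  then obtain A B where AB: "openin T A" "openin T B" "\<one> \<in> A" "\<one> \<in> B" "A \<times> B \<subseteq> ?P"
    by (elim exE conjE)
  define C where "C = A \<inter> B \<inter> U"
  have C: "nbhd_one C" using AB nbhd_oneD[OF assms] by (auto simp: nbhd_one_def C_def)
  define V where "V = C \<inter> {x \<in> topspace T. inv x \<in> C}"
  have "nbhd_one V"
    using C openin_continuous_map_preimage[OF inv_cont nbhd_oneD(1)[OF C]]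
    by (auto simp: nbhd_one_def V_def)
  moreover have "\<forall>v\<in>V. inv v \<in> V" using nbhd_oneD[OF C] by (auto simp: V_def)
  moreover have "\<forall>a\<in>V. \<forall>b\<in>V. a \<otimes> b \<in> U" using AB(5) by (force simp: V_def C_def)
  ultimately show ?thesis by (auto simp: V_def C_def)
qed

lemma nbhd_one_sep:
  assumes "x \<in> carrier G" "x \<noteq> \<one>"
  shows "\<exists>U. nbhd_one U \<and> x \<notin> U"
proof -
  obtain U V where "openin T U" "openin T V" "\<one> \<in> U" "x \<in> V" "disjnt U V"
    using Hausdorff assms unfolding Hausdorff_space_def by (metis one_closed topspace)
  then show ?thesis by (auto simp: nbhd_one_def disjnt_iff)
qed

lemma nbhd_one_ball:
  assumes "finite I" "\<And>i. i \<in> I \<Longrightarrow> \<exists>V. nbhd_one V \<and> (\<forall>v\<in>V. P i v)"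
  shows "\<exists>V. nbhd_one V \<and> (\<forall>v\<in>V. \<forall>i\<in>I. P i v)"
  using assms
proof (induction I)
  case empty
  show ?case using nbhd_one_carrier by blast
next
  case (insert i I)
  then obtain V where V: "nbhd_one V" "\<forall>v\<in>V. \<forall>i\<in>I. P i v" by auto
  obtain W where W: "nbhd_one W" "\<forall>v\<in>W. P i v" using insert.prems by blast
  show ?case using nbhd_one_Int[OF V(1) W(1)] V(2) W(2) by (intro exI[of _ "V \<inter> W"]) auto
qed

lemma nbhd_one_pow:
  assumes "nbhd_one U"
  shows "\<exists>V. nbhd_one V \<and> (\<forall>v\<in>V. v [^] (n::nat) \<in> U)"
proof -
  have "continuous_map T T (\<lambda>x. x [^] n)" by (rule cont_pow) auto
  then have "openin T {x \<in> topspace T. x [^] n \<in> U}"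
    using openin_continuous_map_preimage[of T T] assms by (auto simp: nbhd_one_def)
  then have "nbhd_one {x \<in> topspace T. x [^] n \<in> U}"
    using assms by (auto simp: nbhd_one_def)
  then show ?thesis by blast
qed

lemma openin_iff_nbhd_one:
  "openin T W \<longleftrightarrow> W \<subseteq> carrier G \<and> (\<forall>w\<in>W. \<exists>U. nbhd_one U \<and> (\<forall>u\<in>U. w \<otimes> u \<in> W))"
proof (intro iffI conjI ballI)
  fix w assume W: "openin T W" "w \<in> W"
  then have c: "w \<in> carrier G" using openin_carrier by blast
  have "nbhd_one {x \<in> carrier G. w \<otimes> x \<in> W}"
    using openin_lmult[OF c W(1)] W c by (simp add: nbhd_one_def)
  then show "\<exists>U. nbhd_one U \<and> (\<forall>u\<in>U. w \<otimes> u \<in> W)" by blast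
next
  assume R: "W \<subseteq> carrier G \<and> (\<forall>w\<in>W. \<exists>U. nbhd_one U \<and> (\<forall>u\<in>U. w \<otimes> u \<in> W))"
  show "openin T W"
  proof (subst openin_subopen, intro ballI)
    fix w assume w: "w \<in> W"
    then obtain U where U: "nbhd_one U" "\<forall>u\<in>U. w \<otimes> u \<in> W" using R by blast
    have c: "w \<in> carrier G" using w R by blast
    let ?V = "{x \<in> carrier G. inv w \<otimes> x \<in> U}"
    have "x \<in> W" if "x \<in> ?V" for x
    proof -
      have "w \<otimes> (inv w \<otimes> x) \<in> W" using that U by blast
      then show ?thesis using c that by (simp flip: m_assoc)
    qed
    moreover have "openin T ?V" using openin_lmult[of "inv w" U] c U by (simp add: nbhd_one_def)
    moreover have "w \<in> ?V" using c U by (simp add: nbhd_one_def)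
    ultimately show "\<exists>T'. openin T T' \<and> w \<in> T' \<and> T' \<subseteq> W" by blast
  qed
qed (use openin_carrier in blast)

lemma in_closure:
  assumes "S \<subseteq> carrier G"
  shows "x \<in> T closure_of S \<longleftrightarrow> x \<in> carrier G \<and> (\<forall>U. nbhd_one U \<longrightarrow> (\<exists>s\<in>S. inv x \<otimes> s \<in> U))"
proof (intro iffI conjI allI impI)
  assume x: "x \<in> T closure_of S"
  then show c: "x \<in> carrier G" using closure_of_subset_topspace by fastforce
  fix U assume U: "nbhd_one U"
  have "openin T {y \<in> carrier G. inv x \<otimes> y \<in> U}" "x \<in> {y \<in> carrier G. inv x \<otimes> y \<in> U}"
    using c U openin_lmult[of "inv x" U] by (auto simp: nbhd_one_def)
  moreover have "\<forall>W. x \<in> W \<and> openin T W \<longrightarrow> (\<exists>y. y \<in> S \<and> y \<in> W)"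
    using x by (simp add: in_closure_of)
  ultimately have "\<exists>y. y \<in> S \<and> y \<in> {y \<in> carrier G. inv x \<otimes> y \<in> U}" by meson
  then show "\<exists>s\<in>S. inv x \<otimes> s \<in> U" by blast
next
  assume R: "x \<in> carrier G \<and> (\<forall>U. nbhd_one U \<longrightarrow> (\<exists>s\<in>S. inv x \<otimes> s \<in> U))"
  show "x \<in> T closure_of S"
    unfolding in_closure_of
  proof (intro conjI allI impI)
    fix W assume W: "x \<in> W \<and> openin T W"
    then obtain U where U: "nbhd_one U" "\<forall>u\<in>U. x \<otimes> u \<in> W" using openin_iff_nbhd_one by blast
    then obtain s where s: "s \<in> S" "inv x \<otimes> s \<in> U" using R by blast
    have "x \<otimes> (inv x \<otimes> s) = s" using R s assms by (simp flip: m_assoc add: subset_iff)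
    then have "s \<in> W" using U(2) s(2) by metis
    then show "\<exists>y. y \<in> S \<and> y \<in> W" using s by blast
  qed (use R in simp)
qed

lemma closure_in_carrier: "T closure_of S \<subseteq> carrier G"
  using closure_of_subset_topspace[of T S] by simp

lemma subgroup_closure:
  assumes "subgroup H G"
  shows "subgroup (T closure_of H) G"
proof (rule subgroupI)
  have H: "H \<subseteq> carrier G" using assms by (rule subgroup.subset)
  show "T closure_of H \<noteq> {}" using subgroup.one_closed[OF assms] closure_of_subset[of H T] H by auto
  have img: "f ` (T closure_of H) \<subseteq> T closure_of H" if "continuous_map T T f" "f ` H \<subseteq> H" for f
    using continuous_map_image_closure_subset[OF that(1), of H] closure_of_mono[OF that(2), of T] by blast
  show "inv a \<in> T closure_of H" if "a \<in> T closure_of H" for a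
    using img[OF inv_cont] that subgroup.m_inv_closed[OF assms] by blast
  \<comment> \<open>Separate continuity suffices: left factors from \<open>H\<close> are treated
    first, then right translation by \<open>b\<close> carries the closure of \<open>H\<close> into
    the closure.\<close>
  have 1: "h \<otimes> b \<in> T closure_of H" if "h \<in> H" "b \<in> T closure_of H" for h b
    using img[OF cont_lmult[of h]] that subgroup.m_closed[OF assms] H by blast
  show "a \<otimes> b \<in> T closure_of H" if "a \<in> T closure_of H" "b \<in> T closure_of H" for a b
  proof -
    have b: "b \<in> carrier G" using that closure_in_carrier by blast
    then have "continuous_map T T (\<lambda>x. x \<otimes> b)" by (intro cont_mult) auto
    from continuous_map_image_closure_subset[OF this, of H]
    have "a \<otimes> b \<in> T closure_of ((\<lambda>x. x \<otimes> b) ` H)" using that by blast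
    also have "\<dots> \<subseteq> T closure_of (T closure_of H)" using 1 that by (intro closure_of_mono) auto
    finally show ?thesis by simp
  qed
qed (rule closure_in_carrier)

lemma closedin_equalizer:
  assumes "continuous_map T T f" "continuous_map T T g"
  shows "closedin T {x \<in> carrier G. f x = g x}"
  using closedin_continuous_maps_eq[OF Hausdorff assms] by simp

lemma closure_commute:
  assumes "S \<subseteq> carrier G" "a \<in> carrier G" "\<And>s. s \<in> S \<Longrightarrow> s \<otimes> a = a \<otimes> s" "x \<in> T closure_of S"
  shows "x \<otimes> a = a \<otimes> x"
proof -
  have "closedin T {x \<in> carrier G. x \<otimes> a = a \<otimes> x}"
    using assms by (intro closedin_equalizer cont_mult) auto
  then have "T closure_of S \<subseteq> {x \<in> carrier G. x \<otimes> a = a \<otimes> x}"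
    using assms by (intro closure_of_minimal) auto
  then show ?thesis using assms by blast
qed

lemma abelian_subgroup_closure:
  assumes "abelian_subgroup H"
  shows "abelian_subgroup (T closure_of H)"
proof -
  have H: "subgroup H G" "H \<subseteq> carrier G" "\<And>x y. x \<in> H \<Longrightarrow> y \<in> H \<Longrightarrow> x \<otimes> y = y \<otimes> x"
    using assms subgroup.subset by (auto simp: abelian_subgroup_def)
  have 1: "x \<otimes> y = y \<otimes> x" if "x \<in> T closure_of H" "y \<in> H" for x y
    using closure_commute[of H y x] H that by blast
  have "x \<otimes> y = y \<otimes> x" if "x \<in> T closure_of H" "y \<in> T closure_of H" for x y
    using closure_commute[of H y x] H that 1[OF that(2)] closure_in_carrier[of H] by force
  then show ?thesis using subgroup_closure H by (auto simp: abelian_subgroup_def)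
qed

lemma comm_group_abelian:
  assumes "abelian_subgroup H" shows "comm_group (G\<lparr>carrier := H\<rparr>)"
proof -
  have "subgroup H G" using assms by (simp add: abelian_subgroup_def)
  then interpret H: group "G\<lparr>carrier := H\<rparr>" by (rule subgroup_imp_group)
  show ?thesis
    using assms by (intro H.group_comm_groupI) (auto simp: abelian_subgroup_def)
qed

end

locale hm_group = topgroup +
  assumes hereditarily_minimal: "hereditarily_minimal G T"
begin

text \<open>Every use of minimality goes through this criterion: a Hausdorff group topology on \<open>H\<close>
  with neighbourhood base \<open>F\<close> at the identity that is coarser than \<open>T\<close> is as fine as \<open>T\<close>.\<close>

lemma minimality_criterion:
  assumes H: "abelian_subgroup H"
    and F: "F \<noteq> {}" "\<And>U. U \<in> F \<Longrightarrow> U \<subseteq> H" "\<And>U. U \<in> F \<Longrightarrow> \<exists>V. nbhd_one V \<and> H \<inter> V \<subseteq> U"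
      "\<And>U V. U \<in> F \<Longrightarrow> V \<in> F \<Longrightarrow> \<exists>W\<in>F. W \<subseteq> U \<inter> V"
      "\<And>U. U \<in> F \<Longrightarrow> \<exists>V\<in>F. \<forall>a\<in>V. \<forall>b\<in>V. a \<otimes> inv b \<in> U"
      "\<And>x. x \<in> H \<Longrightarrow> x \<noteq> \<one> \<Longrightarrow> \<exists>U\<in>F. x \<notin> U"
    and U: "nbhd_one U"
  shows "\<exists>V\<in>F. V \<subseteq> U"
proof -
  let ?A = "G\<lparr>carrier := H\<rparr>"
  have sH: "subgroup H G" using H by (simp add: abelian_subgroup_def)
  have HG: "H \<subseteq> carrier G" using sH subgroup.subset by blast
  interpret A: comm_group ?A using H by (rule comm_group_abelian)
  interpret A: group_filter_base ?A F
  proof unfold_locales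
    fix U assume U: "U \<in> F"
    show "U \<subseteq> carrier ?A" using F(2) U by simp
    obtain V where "nbhd_one V" "H \<inter> V \<subseteq> U" using F(3) U by blast
    then show "\<one>\<^bsub>?A\<^esub> \<in> U" using subgroup.one_closed[OF sH] by (auto simp: nbhd_one_def)
    obtain W where W: "W\<in>F" "\<forall>a\<in>W. \<forall>b\<in>W. a \<otimes> inv b \<in> U" using F(5) U by blast
    have "W \<subseteq> H" using W F(2) by blast
    then have "a \<otimes>\<^bsub>?A\<^esub> inv\<^bsub>?A\<^esub> b \<in> U" if "a \<in> W" "b \<in> W" for a b
      using W that m_inv_consistent[OF sH, of b] by auto
    then show "\<exists>V\<in>F. \<forall>a\<in>V. \<forall>b\<in>V. a \<otimes>\<^bsub>?A\<^esub> inv\<^bsub>?A\<^esub> b \<in> U" using W by blast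
  qed (use F in auto)
  let ?S = "A.group_topology"
  have coarse: "openin (subtopology T H) W" if W: "openin ?S W" for W
  proof (subst openin_subopen, intro ballI)
    fix w assume w: "w \<in> W"
    then obtain U where U: "U \<in> F" "\<forall>u\<in>U. w \<otimes> u \<in> W" and WH: "W \<subseteq> H"
      using W unfolding A.openin_group_topology by auto
    obtain V where V: "nbhd_one V" "H \<inter> V \<subseteq> U" using F(3) U by blast
    have c: "w \<in> carrier G" "w \<in> H" using w WH HG by auto
    let ?V = "{x \<in> carrier G. inv w \<otimes> x \<in> V}"
    have "openin T ?V" using openin_lmult[of "inv w" V] c V by (simp add: nbhd_one_def)
    moreover have "x \<in> W" if "x \<in> H" "x \<in> ?V" for x
    proof -
      have "inv w \<otimes> x \<in> H" using that c sH by (simp add: subgroup.m_closed subgroup.m_inv_closed)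
      then have "w \<otimes> (inv w \<otimes> x) \<in> W" using that U V by blast
      then show ?thesis using c that by (simp flip: m_assoc)
    qed
    moreover have "w \<in> ?V" using c V by (simp add: nbhd_one_def)
    ultimately show "\<exists>S. openin (subtopology T H) S \<and> w \<in> S \<and> S \<subseteq> W"
      using c by (intro exI[of _ "?V \<inter> H"]) (auto simp: openin_subtopology)
  qed
  have "minimal_topological_group ?A (subtopology T H)"
    using hereditarily_minimal sH unfolding hereditarily_minimal_def by blast
  then have eq: "?S = subtopology T H"
    using A.topological_group_group_topology coarse
    unfolding minimal_topological_group_def strictly_coarser_def by blast
  have "openin ?S (U \<inter> H)" unfolding eq using U by (auto simp: openin_subtopology nbhd_one_def)
  moreover have "\<one> \<in> U \<inter> H" using U subgroup.one_closed[OF sH] by (auto simp: nbhd_one_def)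
  ultimately obtain V where V: "V \<in> F" "\<forall>v\<in>V. \<one> \<otimes>\<^bsub>?A\<^esub> v \<in> U \<inter> H"
    unfolding A.openin_group_topology by blast
  moreover have "V \<subseteq> carrier G" using V F(2) HG by blast
  then have "\<one> \<otimes>\<^bsub>?A\<^esub> v = v" if "v \<in> V" for v using that by auto
  ultimately show ?thesis by auto
qed

text \<open>The traces on \<open>H\<close> of the sets \<open>P N\<close> form a Hausdorff base
  because \<open>N\<close> is closed and meets \<open>H\<close> trivially. By minimality these
  traces shrink to the identity, although each contains elements of \<open>H\<close> arbitrarily
  close to any given \<open>n\<close> in \<open>N\<close>.\<close>

lemma essential:
  assumes H: "abelian_subgroup H" and N: "subgroup N G" "closedin T N" "N \<subseteq> T closure_of H"
    and NH: "N \<inter> H \<subseteq> {\<one>}"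
  shows "N = {\<one>}"
proof -
  have sH: "subgroup H G" using H by (simp add: abelian_subgroup_def)
  have HG: "H \<subseteq> carrier G" using sH subgroup.subset by blast
  have NG: "N \<subseteq> carrier G" using N subgroup.subset by blast
  have comm: "x \<otimes> y = y \<otimes> x" if "x \<in> N" "y \<in> H \<union> N" for x y
  proof -
    have "y \<in> T closure_of H" "x \<in> T closure_of H" using that N closure_of_subset[of H T] HG by auto
    then show ?thesis using abelian_subgroup_closure[OF H] by (simp add: abelian_subgroup_def)
  qed
  define B where "B P = {h \<in> H. \<exists>n\<in>N. h \<otimes> n \<in> P}" for P
  have crit: "\<exists>V\<in>B ` {P. nbhd_one P}. V \<subseteq> U" if U: "nbhd_one U" for U
  proof (rule minimality_criterion[OF H _ _ _ _ _ _ U])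
    show "B ` {P. nbhd_one P} \<noteq> {}" using U by blast
    show "V \<subseteq> H" if "V \<in> B ` {P. nbhd_one P}" for V using that by (auto simp: B_def)
    show "\<exists>W. nbhd_one W \<and> H \<inter> W \<subseteq> V" if V: "V \<in> B ` {P. nbhd_one P}" for V
    proof -
      obtain P where P: "nbhd_one P" "V = B P" using V by blast
      have "H \<inter> P \<subseteq> B P"
        unfolding B_def using subgroup.one_closed[OF N(1)] HG by (auto intro!: bexI[of _ \<one>])
      then show ?thesis using P by blast
    qed
    show "\<exists>W\<in>B ` {P. nbhd_one P}. W \<subseteq> V \<inter> V'"
      if V: "V \<in> B ` {P. nbhd_one P}" "V' \<in> B ` {P. nbhd_one P}" for V V'
    proof -
      obtain P where P: "nbhd_one P" "V = B P" using V(1) by blast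
      obtain P' where P': "nbhd_one P'" "V' = B P'" using V(2) by blast
      have "B (P \<inter> P') \<subseteq> V \<inter> V'" using P P' by (auto simp: B_def)
      then show ?thesis using nbhd_one_Int[OF P(1) P'(1)] by blast
    qed
    show "\<exists>W\<in>B ` {P. nbhd_one P}. \<forall>a\<in>W. \<forall>b\<in>W. a \<otimes> inv b \<in> V" if V: "V \<in> B ` {P. nbhd_one P}" for V
    proof -
      obtain P where P: "nbhd_one P" "V = B P" using V by blast
      obtain Q where Q: "nbhd_one Q" "\<forall>v\<in>Q. inv v \<in> Q" "\<forall>a\<in>Q. \<forall>b\<in>Q. a \<otimes> b \<in> P"
        using nbhd_one_div[OF P(1)] by blast
      have "a \<otimes> inv b \<in> B P" if ab: "a \<in> B Q" "b \<in> B Q" for a b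
      proof -
        obtain n m where nm: "n \<in> N" "m \<in> N" "a \<otimes> n \<in> Q" "b \<otimes> m \<in> Q" and h: "a \<in> H" "b \<in> H"
          using ab by (auto simp: B_def)
        have c: "a \<in> carrier G" "b \<in> carrier G" "n \<in> carrier G" "m \<in> carrier G" using h nm HG NG by auto
        have ib: "inv b \<in> H" "inv m \<in> N"
          using subgroup.m_inv_closed[OF sH h(2)] subgroup.m_inv_closed[OF N(1) nm(2)] by auto
        have nm': "n \<otimes> inv m \<in> N" using subgroup.m_closed[OF N(1) nm(1) ib(2)] .
        have "inv (b \<otimes> m) = inv m \<otimes> inv b" using c by (simp add: inv_mult_group)
        then have "a \<otimes> n \<otimes> inv (b \<otimes> m) = a \<otimes> ((n \<otimes> inv m) \<otimes> inv b)" using c by (simp add: m_assoc)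
        also have "\<dots> = a \<otimes> (inv b \<otimes> (n \<otimes> inv m))" using comm[OF nm'] ib by simp
        finally have "a \<otimes> n \<otimes> inv (b \<otimes> m) = a \<otimes> inv b \<otimes> (n \<otimes> inv m)" using c by (simp add: m_assoc)
        moreover have "a \<otimes> n \<otimes> inv (b \<otimes> m) \<in> P" using Q nm by blast
        moreover have "a \<otimes> inv b \<in> H" using subgroup.m_closed[OF sH h(1) ib(1)] .
        ultimately show ?thesis unfolding B_def using nm' by auto
      qed
      then show ?thesis using P Q by blast
    qed
    \<comment> \<open>An element of \<open>H\<close> in every \<open>B P\<close> has its inverse in
      the closure of \<open>N\<close>, hence in \<open>N\<close>, and is therefore the
      identity.\<close>
    show "\<exists>V\<in>B ` {P. nbhd_one P}. x \<notin> V" if x: "x \<in> H" "x \<noteq> \<one>" for x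
    proof (rule ccontr)
      assume "\<not> ?thesis"
      then have all: "\<And>P. nbhd_one P \<Longrightarrow> \<exists>n\<in>N. x \<otimes> n \<in> P" by (auto simp: B_def)
      have xc: "x \<in> carrier G" using x HG by blast
      have "inv x \<in> T closure_of N" using in_closure[OF NG, of "inv x"] xc all by auto
      then have "inv x \<in> N" using N closure_of_closedin by auto
      then have "inv (inv x) \<in> N" using subgroup.m_inv_closed[OF N(1)] by blast
      then show False using x NH xc by auto
    qed
  qed
  have "n = \<one>" if n: "n \<in> N" for n
  proof (rule ccontr)
    assume n1: "n \<noteq> \<one>"
    have nc: "n \<in> carrier G" using n NG by blast
    obtain U where U: "nbhd_one U" "n \<notin> U" using nbhd_one_sep nc n1 by blast
    obtain O' where O: "nbhd_one O'" "\<forall>v\<in>O'. inv v \<in> O'" "\<forall>a\<in>O'. \<forall>b\<in>O'. a \<otimes> b \<in> U"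
      using nbhd_one_div[OF U(1)] by blast
    obtain P where P: "nbhd_one P" "B P \<subseteq> O'" using crit[OF O(1)] by blast
    \<comment> \<open>Some \<open>h\<close> in \<open>H\<close> near \<open>n\<close> lies in
      \<open>B P\<close>, so it is also near the identity; this forces \<open>n\<close> into
      \<open>U\<close>.\<close>
    have "n \<in> T closure_of H" using n N by blast
    then obtain h where h: "h \<in> H" "inv n \<otimes> h \<in> P \<inter> O'"
      using in_closure[OF HG] nbhd_one_Int[OF P(1) O(1)] by blast
    have hc: "h \<in> carrier G" using h HG by blast
    have ni: "inv n \<in> N" using subgroup.m_inv_closed[OF N(1) n] .
    have "inv n \<otimes> h = h \<otimes> inv n" using comm ni h by blast
    then have "h \<in> O'" using P(2) h ni unfolding B_def by auto
    moreover have "inv (inv n \<otimes> h) \<in> O'" using h O by blast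
    ultimately have "h \<otimes> inv (inv n \<otimes> h) \<in> U" using O by blast
    then show False using U hc nc by (simp add: inv_mult_group flip: m_assoc)
  qed
  then show ?thesis using subgroup.one_closed[OF N(1)] by blast
qed

end

section \<open>Characters and total boundedness\<close>

context comm_group
begin

text \<open>The graph of a homomorphism from a subgroup to the circle. As graphs, chains of partial
  homomorphisms have their union as upper bound; single-valuedness follows from the condition at the
  identity.\<close>

definition partial_character :: "('a \<times> complex) set \<Rightarrow> bool" where
  "partial_character \<Gamma> \<longleftrightarrow>
     (\<forall>(x, u) \<in> \<Gamma>. x \<in> carrier G \<and> norm u = 1 \<and> (inv x, inverse u) \<in> \<Gamma> \<and>
        (\<forall>(y, v) \<in> \<Gamma>. (x \<otimes> y, u * v) \<in> \<Gamma>)) \<and>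
     (\<one>, 1) \<in> \<Gamma> \<and> (\<forall>u. (\<one>, u) \<in> \<Gamma> \<longrightarrow> u = 1)"

lemma partial_characterD:
  assumes "partial_character \<Gamma>"
  shows "(x, u) \<in> \<Gamma> \<Longrightarrow> x \<in> carrier G" "(x, u) \<in> \<Gamma> \<Longrightarrow> norm u = 1"
    "(x, u) \<in> \<Gamma> \<Longrightarrow> (inv x, inverse u) \<in> \<Gamma>"
    "(x, u) \<in> \<Gamma> \<Longrightarrow> (y, v) \<in> \<Gamma> \<Longrightarrow> (x \<otimes> y, u * v) \<in> \<Gamma>"
    "(\<one>, 1) \<in> \<Gamma>" "(\<one>, u) \<in> \<Gamma> \<Longrightarrow> u = 1"
  using assms unfolding partial_character_def by blast+

lemma partial_character_unique:
  assumes "partial_character \<Gamma>" "(x, u) \<in> \<Gamma>" "(x, v) \<in> \<Gamma>"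
  shows "u = v"
proof -
  note D = partial_characterD[OF assms(1)]
  have "(x \<otimes> inv x, u * inverse v) \<in> \<Gamma>" using D(3,4) assms by blast
  then have "u * inverse v = 1" using D(1,6) assms(2) by simp
  moreover have "v \<noteq> 0" using D(2) assms(3) by fastforce
  ultimately show ?thesis by (simp add: field_simps)
qed

lemma partial_character_pow:
  assumes "partial_character \<Gamma>" "(x, u) \<in> \<Gamma>"
  shows "(x [^] (i::int), u powi i) \<in> \<Gamma>"
proof -
  note D = partial_characterD[OF assms(1)]
  have n: "(x [^] (n::nat), u ^ n) \<in> \<Gamma>" for n
  proof (induction n)
    case (Suc n)
    show ?case using D(4)[OF Suc assms(2)] by (simp add: mult.commute)
  qed (simp add: D(5))
  have x: "x \<in> carrier G" using D(1) assms(2) by blast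
  show ?thesis
  proof (cases i rule: int_cases2)
    case (nonneg k)
    then show ?thesis using n[of k] by (simp add: int_pow_int)
  next
    case (nonpos k)
    then show ?thesis using D(3)[OF n[of k]] x
      by (simp add: int_pow_neg_int power_int_minus)
  qed
qed

text \<open>The exponents \<open>i\<close> with \<open>b [^] i\<close> in the domain are the
  multiples of some \<open>n\<close>. If \<open>n\<close> is positive, the value at \<open>b\<close>
  must be an \<open>n\<close>-th root of the value at \<open>b [^] n\<close>, and since
  \<open>n\<close> is at least 2 a root other than 1 exists. Otherwise the value is free. Avoiding 1
  is what later separates points.\<close>

lemma partial_character_extend:
  assumes \<Gamma>: "partial_character \<Gamma>" and b: "b \<in> carrier G" "b \<notin> fst ` \<Gamma>"
  shows "\<exists>\<Delta> z. partial_character \<Delta> \<and> \<Gamma> \<subseteq> \<Delta> \<and> (b, z) \<in> \<Delta> \<and> z \<noteq> 1"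
proof -
  note D = partial_characterD[OF \<Gamma>]
  have dompow: "b [^] (i * j :: int) \<in> fst ` \<Gamma>" if "b [^] i \<in> fst ` \<Gamma>" for i j
    using that partial_character_pow[OF \<Gamma>, of "b [^] i" _ j] b by (force simp: int_pow_pow)
  have dommult: "b [^] (i + j :: int) \<in> fst ` \<Gamma>" if "b [^] i \<in> fst ` \<Gamma>" "b [^] j \<in> fst ` \<Gamma>" for i j
    using that D(4) b by (force simp: int_pow_mult)
  have "\<exists>z. norm z = 1 \<and> z \<noteq> 1 \<and> (\<forall>i v. (b [^] (i::int), v) \<in> \<Gamma> \<longrightarrow> v = z powi i)"
  proof (cases "\<exists>n::nat. 0 < n \<and> b [^] int n \<in> fst ` \<Gamma>")
    case True
    define n where "n = (LEAST n::nat. 0 < n \<and> b [^] int n \<in> fst ` \<Gamma>)"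
    have n: "0 < n" "b [^] int n \<in> fst ` \<Gamma>"
      using LeastI_ex[OF True] unfolding n_def by blast+
    have least: "n \<le> m" if "0 < m" "b [^] int m \<in> fst ` \<Gamma>" for m
      unfolding n_def using that by (intro Least_le) blast
    obtain w where w: "(b [^] int n, w) \<in> \<Gamma>" using n by auto
    have "n \<noteq> 1" using n(2) b by (metis int_pow_1 of_nat_1)
    then have n2: "n \<ge> 2" using n by simp
    have w1: "norm w = 1" using D w by blast
    have "\<exists>z. z ^ n = w \<and> z \<noteq> 1"
    proof (cases "w = 1")
      case True
      \<comment> \<open>For value 1 a nontrivial root of unity is needed. Its imaginary part is
        positive except for \<open>n = 2\<close>, where the root is -1.\<close>
      have "cis (2 * pi / n) \<noteq> 1"
      proof (cases "n = 2")
        case False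
        then have "sin (2 * pi / n) > 0"
          using n2 by (intro sin_gt_zero) (auto simp: field_simps)
        then show ?thesis by (auto simp: complex_eq_iff)
      qed auto
      moreover have "cis (2 * pi / n) ^ n = 1" using n Complex.DeMoivre[of "2 * pi / n" n] by simp
      ultimately show ?thesis using True by blast
    next
      case False
      have "w = cis (Arg w)" using w1 rcis_cmod_Arg[of w] by (simp add: rcis_def)
      moreover have "cis (Arg w / n) ^ n = cis (Arg w)" using n Complex.DeMoivre[of "Arg w / n" n] by simp
      ultimately show ?thesis using False by (metis power_one)
    qed
    then obtain z where z: "z ^ n = w" "z \<noteq> 1" by blast
    have "norm z ^ n = 1" using w1 z by (metis norm_power)
    then have nz: "norm z = 1" using n power_eq_imp_eq_base[of "norm z" n 1] by simp
    have "v = z powi i" if iv: "(b [^] i, v) \<in> \<Gamma>" for i v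
    proof -
      have "b [^] i \<in> fst ` \<Gamma>" using iv by (rule image_eqI[rotated]) simp
      \<comment> \<open>The remainder of \<open>i\<close> modulo \<open>n\<close> is again an
        exponent in the domain, so it vanishes by minimality of \<open>n\<close>.\<close>
      then have "b [^] (i + int n * (- (i div int n))) \<in> fst ` \<Gamma>"
        by (intro dommult dompow[OF n(2)])
      then have "b [^] (i mod int n) \<in> fst ` \<Gamma>" by (simp add: minus_mult_div_eq_mod)
      moreover have k: "i mod int n = int (nat (i mod int n))" using n by simp
      ultimately have "b [^] int (nat (i mod int n)) \<in> fst ` \<Gamma>" by metis
      then have "\<not> 0 < nat (i mod int n) \<or> n \<le> nat (i mod int n)" using least by blast
      moreover have "i mod int n < int n" using n by simp
      ultimately have "i mod int n = 0" using k by linarith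
      then obtain q where q: "i = int n * q" by auto
      have "(b [^] i, w powi q) \<in> \<Gamma>"
        using partial_character_pow[OF \<Gamma> w, of q] b q by (simp add: int_pow_pow)
      then have "v = w powi q" using partial_character_unique[OF \<Gamma>] iv by blast
      also have "\<dots> = z powi i" unfolding q z(1)[symmetric] by (simp add: power_int_mult)
      finally show ?thesis .
    qed
    then show ?thesis using nz z by blast
  next
    case False
    have "i = 0" if "(b [^] i, v) \<in> \<Gamma>" for i :: int and v
    proof (rule ccontr)
      assume "i \<noteq> 0"
      moreover have "b [^] (i * sgn i) \<in> fst ` \<Gamma>" using that by (intro dompow) force
      ultimately show False using False
        by (metis abs_sgn mult_sgn_abs mult.commute nat_0_less_mult_iff zero_less_abs_iff zero_less_nat_eq int_nat_eq abs_ge_zero)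
    qed
    then have "v = (-1) powi i" if "(b [^] i, v) \<in> \<Gamma>" for i v
      using that D(6) by (metis int_pow_0 power_int_0_right)
    \<comment> \<open>No nontrivial power of \<open>b\<close> restricts the value; -1 is one choice
      on the circle different from 1.\<close>
    then show ?thesis by (intro exI[of _ "-1"]) auto
  qed
  then obtain z where z: "norm z = 1" "z \<noteq> 1" "\<And>i v. (b [^] (i::int), v) \<in> \<Gamma> \<Longrightarrow> v = z powi i" by blast
  have z0: "z \<noteq> 0" using z(1) by auto
  define \<Delta> where "\<Delta> = {(x \<otimes> b [^] i, u * z powi i) | x u (i::int). (x, u) \<in> \<Gamma>}"
  have \<Delta>I: "(x \<otimes> b [^] i, u * z powi i) \<in> \<Delta>" if "(x, u) \<in> \<Gamma>" for x u and i :: int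
    using that by (auto simp: \<Delta>_def)
  have \<Delta>E: "\<exists>x u i. p = (x \<otimes> b [^] (i::int), u * z powi i) \<and> (x, u) \<in> \<Gamma>" if "p \<in> \<Delta>" for p
    using that by (auto simp: \<Delta>_def)
  have sub: "\<Gamma> \<subseteq> \<Delta>"
  proof
    fix p assume p: "p \<in> \<Gamma>"
    then show "p \<in> \<Delta>" using \<Delta>I[of "fst p" "snd p" 0] D(1)[of "fst p" "snd p"] by simp
  qed
  have "partial_character \<Delta>"
    unfolding partial_character_def
  proof (intro conjI ballI allI impI; (unfold case_prod_beta)?)
    fix p assume p: "p \<in> \<Delta>"
    obtain x u i where xu: "p = (x \<otimes> b [^] (i::int), u * z powi i)" "(x, u) \<in> \<Gamma>"
      using \<Delta>E[OF p] by blast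
    have x: "x \<in> carrier G" "norm u = 1" using D xu by blast+
    show "fst p \<in> carrier G \<and> norm (snd p) = 1 \<and> (inv fst p, inverse (snd p)) \<in> \<Delta> \<and>
          (\<forall>q \<in> \<Delta>. (fst p \<otimes> fst q, snd p * snd q) \<in> \<Delta>)"
    proof (intro conjI ballI)
      show "fst p \<in> carrier G" using x xu b by simp
      show "norm (snd p) = 1" using x xu z by (simp add: norm_mult norm_power_int)
      have "(inv x \<otimes> b [^] (- i), inverse u * z powi (- i)) \<in> \<Delta>" using \<Delta>I D(3) xu by blast
      moreover have "inv (x \<otimes> b [^] i) = inv x \<otimes> b [^] (- i)" using x b by (simp add: inv_mult int_pow_neg)
      ultimately show "(inv fst p, inverse (snd p)) \<in> \<Delta>"
        using xu by (simp add: power_int_minus)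
      fix q assume "q \<in> \<Delta>"
      then obtain y v j where yv: "q = (y \<otimes> b [^] (j::int), v * z powi j)" "(y, v) \<in> \<Gamma>"
        using \<Delta>E by blast
      have y: "y \<in> carrier G" using D yv by blast
      have "(x \<otimes> y \<otimes> b [^] (i + j), u * v * z powi (i + j)) \<in> \<Delta>" using \<Delta>I D(4) xu yv by blast
      moreover have "x \<otimes> y \<otimes> b [^] (i + j) = x \<otimes> b [^] i \<otimes> (y \<otimes> b [^] j)"
        using x y b by (simp add: int_pow_mult m_ac)
      moreover have "u * v * z powi (i + j) = u * z powi i * (v * z powi j)"
        using z0 by (simp add: power_int_add)
      ultimately show "(fst p \<otimes> fst q, snd p * snd q) \<in> \<Delta>" using xu yv by simp
    qed
  next
    show "(\<one>, 1) \<in> \<Delta>" using sub D(5) by blast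
    fix u assume "(\<one>, u) \<in> \<Delta>"
    then obtain x v i where xv: "\<one> = x \<otimes> b [^] (i::int)" "u = v * z powi i" "(x, v) \<in> \<Gamma>"
      using \<Delta>E by blast
    have x: "x \<in> carrier G" "norm v = 1" using D xv by blast+
    \<comment> \<open>This power of \<open>b\<close> lies in the old domain, where the choice of
      \<open>z\<close> agrees with the old values.\<close>
    have "b [^] i = inv x" using xv(1) x b by (metis inv_equality inv_inv m_comm int_pow_closed)
    then have "inverse v = z powi i" using z(3) D(3)[OF xv(3)] by metis
    moreover have "v \<noteq> 0" using x by auto
    ultimately show "u = 1" using xv(2) by (metis right_inverse)
  qed
  moreover have "(\<one> \<otimes> b [^] (1::int), 1 * z powi 1) \<in> \<Delta>" using \<Delta>I D(5) by blast
  ultimately show ?thesis using sub z(2) b by auto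
qed

text \<open>The trivial character of \<open>N\<close> is first extended to \<open>a\<close> with a
  value other than 1. Zorn's lemma then extends it further, and a maximal graph has full domain
  because any missing element could be adjoined.\<close>

lemma character_separates:
  assumes N: "subgroup N G" and a: "a \<in> carrier G" "a \<notin> N"
  shows "\<exists>\<psi> :: 'a \<Rightarrow> complex. (\<forall>x\<in>carrier G. \<forall>y\<in>carrier G. \<psi> (x \<otimes> y) = \<psi> x * \<psi> y) \<and>
    (\<forall>x\<in>carrier G. norm (\<psi> x) = 1) \<and> (\<forall>x\<in>N. \<psi> x = 1) \<and> \<psi> a \<noteq> 1"
proof -
  have "partial_character (N \<times> {1})"
    using subgroup.subset[OF N] subgroup.m_closed[OF N] subgroup.m_inv_closed[OF N] subgroup.one_closed[OF N]
    unfolding partial_character_def by auto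
  from partial_character_extend[OF this a(1)] a(2)
  obtain \<Delta> z where \<Delta>: "partial_character \<Delta>" "N \<times> {1} \<subseteq> \<Delta>" "(a, z) \<in> \<Delta>" "z \<noteq> 1" by auto
  let ?S = "{\<Gamma>. partial_character \<Gamma> \<and> \<Delta> \<subseteq> \<Gamma>}"
  have "\<exists>M\<in>?S. \<forall>X\<in>?S. M \<subseteq> X \<longrightarrow> X = M"
  proof (rule subset_Zorn_nonempty)
    show "?S \<noteq> {}" using \<Delta> by blast
    fix C assume C: "C \<noteq> {}" "subset.chain ?S C"
    have P: "partial_character \<Gamma>" "\<Delta> \<subseteq> \<Gamma>" if "\<Gamma> \<in> C" for \<Gamma>
      using C(2) that unfolding subset_chain_def by blast+
    have "partial_character (\<Union>C)"
      unfolding partial_character_def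
    proof (intro conjI ballI allI impI; (unfold case_prod_beta)?)
      fix p assume "p \<in> \<Union>C"
      then obtain \<Gamma> where \<Gamma>: "\<Gamma> \<in> C" "(fst p, snd p) \<in> \<Gamma>" by auto
      note D = partial_characterD[OF P(1)[OF \<Gamma>(1)]]
      show "fst p \<in> carrier G \<and> norm (snd p) = 1 \<and> (inv fst p, inverse (snd p)) \<in> \<Union>C \<and>
          (\<forall>q \<in> \<Union>C. (fst p \<otimes> fst q, snd p * snd q) \<in> \<Union>C)"
      proof (intro conjI ballI)
        show "fst p \<in> carrier G" "norm (snd p) = 1" using D(1,2)[OF \<Gamma>(2)] .
        show "(inv fst p, inverse (snd p)) \<in> \<Union>C" using D(3)[OF \<Gamma>(2)] \<Gamma>(1) by blast
        fix q assume "q \<in> \<Union>C"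
        then obtain \<Gamma>' where \<Gamma>': "\<Gamma>' \<in> C" "(fst q, snd q) \<in> \<Gamma>'" by auto
        have "\<Gamma> \<subseteq> \<Gamma>' \<or> \<Gamma>' \<subseteq> \<Gamma>" using C(2) \<Gamma>(1) \<Gamma>'(1) unfolding subset_chain_def by blast
        then have "(fst p \<otimes> fst q, snd p * snd q) \<in> \<Gamma> \<union> \<Gamma>'"
          using partial_characterD(4)[OF P(1)[OF \<Gamma>(1)]] partial_characterD(4)[OF P(1)[OF \<Gamma>'(1)]]
            \<Gamma>(2) \<Gamma>'(2) by (meson Un_iff subsetD)
        then show "(fst p \<otimes> fst q, snd p * snd q) \<in> \<Union>C" using \<Gamma> \<Gamma>' by blast
      qed
    next
      show "(\<one>, 1) \<in> \<Union>C" using C(1) P(1) partial_characterD(5) by blast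
      show "u = 1" if "(\<one>, u) \<in> \<Union>C" for u using that P(1) partial_characterD(6) by blast
    qed
    then show "\<Union>C \<in> ?S" using P(2) C(1) by blast
  qed
  then obtain M where M: "partial_character M" "\<Delta> \<subseteq> M" and
    max: "\<forall>X\<in>?S. M \<subseteq> X \<longrightarrow> X = M" by blast
  note D = partial_characterD[OF M(1)]
  have total: "\<exists>u. (x, u) \<in> M" if x: "x \<in> carrier G" for x
  proof (rule ccontr)
    assume no: "\<nexists>u. (x, u) \<in> M"
    then have "x \<notin> fst ` M" by auto
    then obtain X z where "partial_character X" "M \<subseteq> X" "(x, z) \<in> X"
      using partial_character_extend[OF M(1) x] by blast
    moreover from this have "X \<in> ?S" using M(2) by blast
    ultimately show False using max no by blast
  qed
  define \<psi> where "\<psi> x = (SOME u. (x, u) \<in> M)" for x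
  have \<psi>: "(x, \<psi> x) \<in> M" if "x \<in> carrier G" for x
    unfolding \<psi>_def using someI_ex[OF total[OF that]] .
  have \<psi>eq: "\<psi> x = u" if "(x, u) \<in> M" for x u
    using partial_character_unique[OF M(1) \<psi>[OF D(1)[OF that]] that] .
  show ?thesis
  proof (intro exI[of _ \<psi>] conjI ballI)
    show "\<psi> (x \<otimes> y) = \<psi> x * \<psi> y" if "x \<in> carrier G" "y \<in> carrier G" for x y
      using \<psi>eq D(4)[OF \<psi> \<psi>] that by blast
    show "norm (\<psi> x) = 1" if "x \<in> carrier G" for x using D(2) \<psi> that by blast
    show "\<psi> x = 1" if "x \<in> N" for x using \<psi>eq \<Delta>(2) M(2) that by blast
    show "\<psi> a \<noteq> 1" using \<psi>eq \<Delta>(3,4) M(2) by blast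
  qed
qed

end

text \<open>Bolzano-Weierstrass is applied for one index after the other; passing to a further
  subsequence keeps the convergence already obtained.\<close>

lemma common_convergent_subsequence:
  fixes f :: "'i \<Rightarrow> nat \<Rightarrow> complex"
  assumes "finite X" "\<And>\<psi> n. \<psi> \<in> X \<Longrightarrow> norm (f \<psi> n) \<le> 1"
  shows "\<exists>r :: nat \<Rightarrow> nat. strict_mono r \<and> (\<forall>\<psi>\<in>X. convergent (\<lambda>n. f \<psi> (r n)))"
  using assms
proof (induction X)
  case empty
  show ?case by (intro exI[of _ id]) (simp add: strict_mono_def)
next
  case (insert \<psi> X)
  then obtain r :: "nat \<Rightarrow> nat" where r: "strict_mono r" "\<forall>\<psi>\<in>X. convergent (\<lambda>n. f \<psi> (r n))" by auto
  have "\<forall>n. f \<psi> (r n) \<in> cball 0 1" using insert.prems by simp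
  then obtain l s where s: "strict_mono (s :: nat \<Rightarrow> nat)" "((\<lambda>n. f \<psi> (r n)) \<circ> s) \<longlonglongrightarrow> l"
    using compact_cball[of "0::complex" 1] unfolding compact_def by (metis (no_types, lifting))
  have "convergent (\<lambda>n. f \<phi> ((r \<circ> s) n))" if "\<phi> \<in> insert \<psi> X" for \<phi>
  proof (cases "\<phi> = \<psi>")
    case True
    then show ?thesis using s(2) by (auto simp: convergent_def o_def)
  next
    case False
    then have "convergent (\<lambda>n. f \<phi> (r n))" using r that by blast
    then show ?thesis using convergent_subseq_convergent[OF _ s(1)] by (auto simp: o_def)
  qed
  then show ?case using strict_mono_o[OF r(1) s(1)] by blast
qed

context hm_group
begin

text \<open>The Bohr topology defined by the characters of \<open>H\<close> with open kernel is Hausdorff and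
  coarser than the topology of \<open>H\<close>, so it equals it; it is totally bounded.\<close>

lemma totally_bounded:
  assumes H: "abelian_subgroup H"
    and res: "\<And>h. h \<in> H \<Longrightarrow> h \<noteq> \<one> \<Longrightarrow>
      \<exists>N V. subgroup N G \<and> N \<subseteq> H \<and> nbhd_one V \<and> H \<inter> V \<subseteq> N \<and> h \<notin> N"
    and a: "\<And>n::nat. a n \<in> H" and U: "nbhd_one U"
  shows "\<exists>i j. i < j \<and> a j \<otimes> inv (a i) \<in> U"
proof -
  have sH: "subgroup H G" using H by (simp add: abelian_subgroup_def)
  have HG: "H \<subseteq> carrier G" using sH subgroup.subset by blast
  interpret A: comm_group "G\<lparr>carrier := H\<rparr>" using H by (rule comm_group_abelian)
  define X0 where "X0 = {\<psi> :: 'a \<Rightarrow> complex. (\<forall>x\<in>H. \<forall>y\<in>H. \<psi> (x \<otimes> y) = \<psi> x * \<psi> y) \<and>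
    (\<forall>x\<in>H. norm (\<psi> x) = 1) \<and> (\<exists>V. nbhd_one V \<and> (\<forall>x\<in>H \<inter> V. \<psi> x = 1))}"
  have mult: "\<psi> (x \<otimes> y) = \<psi> x * \<psi> y" if "\<psi> \<in> X0" "x \<in> H" "y \<in> H" for \<psi> x y
    using that by (simp add: X0_def)
  have norm1: "norm (\<psi> x) = 1" if "\<psi> \<in> X0" "x \<in> H" for \<psi> x
    using that by (simp add: X0_def)
  have diff: "norm (\<psi> (x \<otimes> inv y) - 1) = norm (\<psi> x - \<psi> y)" if "\<psi> \<in> X0" "x \<in> H" "y \<in> H" for \<psi> x y
  proof -
    have iy: "inv y \<in> H" using subgroup.m_inv_closed[OF sH that(3)] .
    have c: "x \<in> carrier G" "y \<in> carrier G" using that HG by auto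
    have "\<psi> (x \<otimes> inv y) * \<psi> y = \<psi> x"
      using mult[OF that(1) subgroup.m_closed[OF sH that(2) iy] that(3)] c by (simp add: m_assoc)
    then have "(\<psi> (x \<otimes> inv y) - 1) * \<psi> y = \<psi> x - \<psi> y" by (simp add: left_diff_distrib)
    then show ?thesis using norm1[OF that(1,3)] by (metis mult.right_neutral norm_mult)
  qed
  define B where "B X e = {h \<in> H. \<forall>\<psi>\<in>X. norm (\<psi> h - 1) < e}" for X :: "('a \<Rightarrow> complex) set" and e :: real
  define F where "F = {B X e | X e. finite X \<and> X \<subseteq> X0 \<and> e > 0}"
  have FI: "B X e \<in> F" if "finite X" "X \<subseteq> X0" "e > 0" for X e using that by (auto simp: F_def)
  have FE: "\<exists>X e. V = B X e \<and> finite X \<and> X \<subseteq> X0 \<and> e > 0" if "V \<in> F" for V using that by (auto simp: F_def)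
  have "\<exists>V\<in>F. V \<subseteq> U"
  proof (rule minimality_criterion[OF H _ _ _ _ _ _ U])
    show "F \<noteq> {}" using FI[of "{}" 1] by auto
    show "V \<subseteq> H" if "V \<in> F" for V using FE[OF that] by (auto simp: B_def)
    show "\<exists>W. nbhd_one W \<and> H \<inter> W \<subseteq> V" if V: "V \<in> F" for V
    proof -
      obtain X e where X: "V = B X e" "finite X" "X \<subseteq> X0" "e > 0" using FE[OF V] by blast
      have "\<exists>W. nbhd_one W \<and> (\<forall>x\<in>W. \<forall>\<psi>\<in>X. x \<in> H \<longrightarrow> \<psi> x = 1)"
        by (rule nbhd_one_ball[OF X(2)]) (use X(3) in \<open>force simp: X0_def\<close>)
      then show ?thesis using X by (force simp: B_def)
    qed
    show "\<exists>W\<in>F. W \<subseteq> V \<inter> V'" if V: "V \<in> F" "V' \<in> F" for V V'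
    proof -
      obtain X e where X: "V = B X e" "finite X" "X \<subseteq> X0" "e > 0" using FE[OF V(1)] by blast
      obtain X' e' where X': "V' = B X' e'" "finite X'" "X' \<subseteq> X0" "e' > 0" using FE[OF V(2)] by blast
      have "B (X \<union> X') (min e e') \<subseteq> V \<inter> V'" using X X' by (auto simp: B_def)
      then show ?thesis using FI[of "X \<union> X'" "min e e'"] X X' by auto
    qed
    show "\<exists>W\<in>F. \<forall>a\<in>W. \<forall>b\<in>W. a \<otimes> inv b \<in> V" if V: "V \<in> F" for V
    proof -
      obtain X e where X: "V = B X e" "finite X" "X \<subseteq> X0" "e > 0" using FE[OF V] by blast
      have "x \<otimes> inv y \<in> V" if xy: "x \<in> B X (e/2)" "y \<in> B X (e/2)" for x y
      proof -
        have h: "x \<in> H" "y \<in> H" using xy by (auto simp: B_def)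
        have "norm (\<psi> (x \<otimes> inv y) - 1) < e" if \<psi>: "\<psi> \<in> X" for \<psi>
        proof -
          have "norm (\<psi> x - 1) < e / 2" "norm (\<psi> y - 1) < e / 2" using xy \<psi> by (auto simp: B_def)
          then have "norm (\<psi> x - \<psi> y) < e"
            using norm_triangle_ineq4[of "\<psi> x - 1" "\<psi> y - 1"] by simp
          then show ?thesis using diff h X(3) \<psi> by (simp add: subset_iff)
        qed
        moreover have "x \<otimes> inv y \<in> H" using h sH by (simp add: subgroup.m_closed subgroup.m_inv_closed)
        ultimately show ?thesis by (simp add: X(1) B_def)
      qed
      then show ?thesis using FI[of X "e/2"] X by (intro bexI[of _ "B X (e/2)"]) auto
    qed
    show "\<exists>V\<in>F. x \<notin> V" if x: "x \<in> H" "x \<noteq> \<one>" for x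
    proof -
      obtain N V where N: "subgroup N G" "N \<subseteq> H" "nbhd_one V" "H \<inter> V \<subseteq> N" "x \<notin> N"
        using res[OF x] by blast
      \<comment> \<open>Since \<open>N\<close> contains a neighbourhood of the identity in
        \<open>H\<close>, a character that is trivial on \<open>N\<close> belongs to
        \<open>X0\<close>.\<close>
      have "subgroup N (G\<lparr>carrier := H\<rparr>)" using subgroup_incl[OF N(1) sH N(2)] .
      from A.character_separates[OF this, of x] x N obtain \<psi> :: "'a \<Rightarrow> complex" where
        \<psi>: "\<forall>x\<in>H. \<forall>y\<in>H. \<psi> (x \<otimes> y) = \<psi> x * \<psi> y" "\<forall>x\<in>H. norm (\<psi> x) = 1" "\<forall>x\<in>N. \<psi> x = 1" "\<psi> x \<noteq> 1"
        by auto
      have "\<psi> \<in> X0" unfolding X0_def using \<psi> N by blast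
      moreover have "x \<notin> B {\<psi>} (norm (\<psi> x - 1))" by (simp add: B_def)
      ultimately show ?thesis using FI[of "{\<psi>}" "norm (\<psi> x - 1)"] \<psi>(4) by auto
    qed
  qed
  then obtain X e where X: "B X e \<subseteq> U" "finite X" "X \<subseteq> X0" "e > 0" using FE by blast
  \<comment> \<open>Finitely many characters control \<open>U\<close>. Along a common convergent
    subsequence two late terms have nearly equal values under all of them, so their quotient lies in
    \<open>B X e\<close>.\<close>
  have "\<exists>r :: nat \<Rightarrow> nat. strict_mono r \<and> (\<forall>\<psi>\<in>X. convergent (\<lambda>n. \<psi> (a (r n))))"
    using common_convergent_subsequence[OF X(2), of "\<lambda>\<psi> n. \<psi> (a n)"] norm1 X(3) a
    by (metis order_refl subset_iff)
  then obtain r :: "nat \<Rightarrow> nat" where r: "strict_mono r" "\<forall>\<psi>\<in>X. convergent (\<lambda>n. \<psi> (a (r n)))" by blast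
  have "\<exists>M. \<forall>\<psi>\<in>X. \<forall>m\<ge>M. \<forall>n\<ge>M. norm (\<psi> (a (r m)) - \<psi> (a (r n))) < e" using X(2) r(2)
  proof (induction X)
    case (insert \<psi> X)
    then obtain M where M: "\<forall>\<psi>\<in>X. \<forall>m\<ge>M. \<forall>n\<ge>M. norm (\<psi> (a (r m)) - \<psi> (a (r n))) < e" by auto
    have "Cauchy (\<lambda>n. \<psi> (a (r n)))" using insert.prems convergent_Cauchy by blast
    then obtain M' where "\<forall>m\<ge>M'. \<forall>n\<ge>M'. norm (\<psi> (a (r m)) - \<psi> (a (r n))) < e"
      using X(4) unfolding Cauchy_iff by blast
    then show ?case using M by (intro exI[of _ "max M M'"]) auto
  qed simp
  then obtain M where "\<forall>\<psi>\<in>X. \<forall>m\<ge>M. \<forall>n\<ge>M. norm (\<psi> (a (r m)) - \<psi> (a (r n))) < e" by blast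
  then have M: "\<And>\<psi>. \<psi> \<in> X \<Longrightarrow> norm (\<psi> (a (r (Suc M))) - \<psi> (a (r M))) < e" by simp
  have "a (r (Suc M)) \<otimes> inv (a (r M)) \<in> H"
    using a sH by (simp add: subgroup.m_closed subgroup.m_inv_closed)
  moreover have "norm (\<psi> (a (r (Suc M)) \<otimes> inv (a (r M))) - 1) < e" if "\<psi> \<in> X" for \<psi>
    using M diff[of \<psi>, OF _ a a] X(3) that by (simp add: subset_iff)
  ultimately have "a (r (Suc M)) \<otimes> inv (a (r M)) \<in> U" using X(1) by (auto simp: B_def)
  moreover have "r M < r (Suc M)" using r(1) by (simp add: strict_mono_def)
  ultimately show ?thesis by blast
qed

text \<open>Finiteness of discrete abelian subgroups in sequential form. The trivial subgroup is
  open in \<open>H\<close> and serves as \<open>N\<close> for every \<open>h\<close>, so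
  \<open>totally_bounded\<close> applies.\<close>

lemma discrete_sequence_repeats:
  assumes H: "abelian_subgroup H" and V: "nbhd_one V" "H \<inter> V \<subseteq> {\<one>}" and a: "\<And>n::nat. a n \<in> H"
  shows "\<exists>i j. i < j \<and> a j = a i"
proof -
  have sH: "subgroup H G" using H by (simp add: abelian_subgroup_def)
  have "\<exists>i j. i < j \<and> a j \<otimes> inv (a i) \<in> V"
  proof (rule totally_bounded[OF H _ a V(1)])
    fix h assume "h \<noteq> \<one>"
    then show "\<exists>N V. subgroup N G \<and> N \<subseteq> H \<and> nbhd_one V \<and> H \<inter> V \<subseteq> N \<and> h \<notin> N"
      using triv_subgroup subgroup.one_closed[OF sH] V
      by (intro exI[of _ "{\<one>}"] exI[of _ V]) auto
  qed
  then obtain i j where ij: "i < j" "a j \<otimes> inv (a i) \<in> V" by blast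
  have "a j \<otimes> inv (a i) \<in> H" using subgroup.m_closed[OF sH a subgroup.m_inv_closed[OF sH a]] .
  then have "a j \<otimes> inv (a i) = \<one>" using ij(2) V(2) by blast
  then have "a j = a i" using subgroup.mem_carrier[OF sH a] by (metis inv_equality inv_inv inv_closed)
  then show ?thesis using ij(1) by blast
qed

end

section \<open>Monothetic subgroups\<close>

context group
begin

definition cyc :: "'a \<Rightarrow> 'a set" where
  "cyc x = range (\<lambda>i::int. x [^] i)"

definition infinite_order :: "'a \<Rightarrow> bool" where
  "infinite_order x \<longleftrightarrow> x \<in> carrier G \<and> (\<forall>n::nat. 0 < n \<longrightarrow> x [^] n \<noteq> \<one>)"

lemma cyc_subgroup: assumes "x \<in> carrier G" shows "subgroup (cyc x) G"
proof (rule subgroupI)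
  fix a b assume ab: "a \<in> cyc x" "b \<in> cyc x"
  then obtain i j :: int where ij: "a = x [^] i" "b = x [^] j" by (auto simp: cyc_def)
  have "inv a = x [^] (- i)" "a \<otimes> b = x [^] (i + j)"
    using assms ij by (auto simp: int_pow_neg int_pow_mult)
  then show "inv a \<in> cyc x" "a \<otimes> b \<in> cyc x" by (auto simp: cyc_def)
qed (use assms in \<open>auto simp: cyc_def\<close>)

lemma cyc_subset: "subgroup N G \<Longrightarrow> x \<in> N \<Longrightarrow> cyc x \<subseteq> N"
  using subgroup_int_pow_closed by (auto simp: cyc_def)

lemma in_cyc [simp]: "x \<in> carrier G \<Longrightarrow> x \<in> cyc x"
  unfolding cyc_def by (rule image_eqI[of _ _ 1]) auto

lemma subgroup_nat_pow_closed: "subgroup N G \<Longrightarrow> x \<in> N \<Longrightarrow> x [^] (n::nat) \<in> N"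
  using subgroup_int_pow_closed[of N x "int n"] by (simp add: int_pow_int)

lemma coprime_int_pow_mem:
  assumes N: "subgroup N G" and x: "x \<in> carrier G" "x [^] (i::int) \<in> N" "x [^] (j::int) \<in> N" and "coprime i j"
  shows "x \<in> N"
proof -
  obtain u v where uv: "u * i + v * j = 1" using bezout_int[of i j] assms(5) by auto
  have "(x [^] i) [^] u \<otimes> (x [^] j) [^] v \<in> N"
    using subgroup.m_closed[OF N subgroup_int_pow_closed[OF N x(2)] subgroup_int_pow_closed[OF N x(3)]] .
  also have "(x [^] i) [^] u \<otimes> (x [^] j) [^] v = x [^] (u * i + v * j)"
    using x(1) by (simp only: int_pow_pow int_pow_mult mult.commute)
  finally show ?thesis using uv x(1) by simp
qed

lemma int_pow_eq_one_infinite_order: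
  assumes "infinite_order x" "x [^] (i::int) = \<one>"
  shows "i = 0"
proof (cases i rule: int_cases2)
  case (nonneg n)
  then have "x [^] n = \<one>" using assms by (simp add: int_pow_int)
  then have "\<not> 0 < n" using assms(1) unfolding infinite_order_def by metis
  then show ?thesis using nonneg by simp
next
  case (nonpos n)
  have xc: "x \<in> carrier G" using assms(1) by (simp add: infinite_order_def)
  then have "inv (x [^] n) = \<one>" using assms(2) unfolding nonpos by (simp only: int_pow_neg_int)
  then have "x [^] n = \<one>" using xc inv_inv[of "x [^] n"] inv_one by simp
  then have "\<not> 0 < n" using assms(1) unfolding infinite_order_def by metis
  then show ?thesis using nonpos by simp
qed

lemma finite_cyc:
  assumes "x \<in> carrier G" "0 < (n::nat)" "x [^] n = \<one>"
  shows "finite (cyc x)"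
proof -
  have "x [^] i \<in> (\<lambda>i::int. x [^] i) ` {0..<int n}" for i :: int
  proof -
    have "x [^] (int n * (i div int n) + i mod int n) = (x [^] int n) [^] (i div int n) \<otimes> x [^] (i mod int n)"
      using assms(1) by (simp only: int_pow_mult int_pow_pow)
    then have "x [^] i = (x [^] int n) [^] (i div int n) \<otimes> x [^] (i mod int n)" by simp
    then have "x [^] i = x [^] (i mod int n)" using assms by (simp add: int_pow_int)
    moreover have "i mod int n \<in> {0..<int n}" using assms by simp
    ultimately show ?thesis by blast
  qed
  then have "cyc x \<subseteq> (\<lambda>i::int. x [^] i) ` {0..<int n}" unfolding cyc_def by blast
  then show ?thesis using finite_subset by blast
qed

end

context topgroup
begin

abbreviation cyclic_closure :: "'a \<Rightarrow> 'a set" where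
  "cyclic_closure x \<equiv> T closure_of cyc x"

lemma abelian_cyc: assumes "x \<in> carrier G" shows "abelian_subgroup (cyc x)"
  using cyc_subgroup[OF assms] assms
  by (auto simp: abelian_subgroup_def cyc_def simp flip: int_pow_mult) (simp add: add.commute)

lemma abelian_cyclic_closure: "x \<in> carrier G \<Longrightarrow> abelian_subgroup (cyclic_closure x)"
  using abelian_cyc abelian_subgroup_closure by blast

lemma in_cyclic_closure: "x \<in> carrier G \<Longrightarrow> x \<in> cyclic_closure x"
  using closure_of_subset[of "cyc x" T] subgroup.subset[OF cyc_subgroup[of x]] by auto

lemma cyclic_closure_minimal:
  "subgroup N G \<Longrightarrow> closedin T N \<Longrightarrow> x \<in> N \<Longrightarrow> cyclic_closure x \<subseteq> N"
  using cyc_subset by (intro closure_of_minimal)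

lemma closedin_finite: "finite S \<Longrightarrow> S \<subseteq> carrier G \<Longrightarrow> closedin T S"
  using closedin_Hausdorff_finite[OF Hausdorff] by simp

lemma closedin_cyc_finite_order:
  assumes "x \<in> carrier G" "0 < (n::nat)" "x [^] n = \<one>" shows "closedin T (cyc x)"
  using closedin_finite finite_cyc[OF assms] subgroup.subset[OF cyc_subgroup[OF assms(1)]] by blast

lemma compact_nest:
  assumes K: "compactin T K" and C: "\<And>n::nat. closedin T (C n)" "\<And>n. C n \<subseteq> K" "\<And>n. C n \<noteq> {}"
    and dec: "\<And>m n. m \<le> n \<Longrightarrow> C n \<subseteq> C m"
  shows "\<exists>z. \<forall>n. z \<in> C n"
proof -
  have "compact_space (subtopology T K)" using K by (simp add: compact_space_subtopology)
  moreover have "closedin (subtopology T K) (C n)" for n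
    using C closedin_subset_topspace by blast
  ultimately have "(\<Inter>n. C n) \<noteq> {}"
    using C(3) dec by (intro compact_space_imp_nest[of "subtopology T K"]) (auto simp: decseq_def)
  then show ?thesis by blast
qed

end

section \<open>Recurrence, compactness and torsion-freeness of monothetic subgroups\<close>

context hm_group
begin

text \<open>If the powers beyond \<open>M\<close> avoided \<open>U\<close>, then shrinking
  \<open>U\<close> to miss the finitely many remaining positive powers would make
  \<open>cyc x\<close> discrete, and two powers of \<open>x\<close> would coincide.\<close>

lemma recurrent:
  assumes x: "infinite_order x" and U: "nbhd_one U"
  shows "\<exists>k::nat>M. x [^] k \<in> U"
proof (rule ccontr)
  assume no: "\<not> ?thesis"
  have xc: "x \<in> carrier G" using x by (simp add: infinite_order_def)
  have "\<exists>V. nbhd_one V \<and> (\<forall>v\<in>V. \<forall>k\<in>{0<..M}. v \<noteq> x [^] (k::nat))"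
  proof (rule nbhd_one_ball)
    fix k :: nat assume "k \<in> {0<..M}"
    then have "x [^] k \<noteq> \<one>" using x by (simp add: infinite_order_def)
    then show "\<exists>V. nbhd_one V \<and> (\<forall>v\<in>V. v \<noteq> x [^] k)" using nbhd_one_sep[of "x [^] k"] xc by blast
  qed simp
  then obtain V where V: "nbhd_one V" "\<forall>k\<in>{0<..M}. x [^] k \<notin> V" by blast
  obtain W where W: "nbhd_one W" "W \<subseteq> U \<inter> V" "\<forall>v\<in>W. inv v \<in> W"
    using nbhd_one_div[OF nbhd_one_Int[OF U V(1)]] by blast
  have W0: "x [^] k \<notin> W" if "k > 0" for k :: nat
    using that no V W(2) by (cases "k > M") auto
  have disc: "cyc x \<inter> W \<subseteq> {\<one>}"
  proof
    fix z assume z: "z \<in> cyc x \<inter> W"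
    then obtain i :: int where i: "z = x [^] i" by (auto simp: cyc_def)
    show "z \<in> {\<one>}"
    proof (cases i rule: int_cases2)
      case (nonneg n)
      then have "z = x [^] n" using i by (simp add: int_pow_int)
      then show ?thesis using W0[of n] z by (cases "n = 0") auto
    next
      case (nonpos n)
      then have "x [^] n = inv z" using i xc by (simp add: int_pow_neg_int)
      then show ?thesis using W0[of n] W(3) z i nonpos by (cases n) auto
    qed
  qed
  obtain i j :: nat where ij: "i < j" "x [^] j = x [^] i"
    using discrete_sequence_repeats[OF abelian_cyc[OF xc] W(1) disc, of "\<lambda>n. x [^] n"]
      subgroup_nat_pow_closed[OF cyc_subgroup[OF xc] in_cyc[OF xc]] by blast
  have "x [^] j = x [^] (j - i) \<otimes> x [^] i" using ij xc by (simp add: nat_pow_mult)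
  then have "x [^] (j - i) \<otimes> x [^] i = \<one> \<otimes> x [^] i" using ij(2) xc by simp
  then have "x [^] (j - i) = \<one>" using xc by (simp del: l_one)
  then show False using ij(1) x by (simp add: infinite_order_def)
qed

text \<open>If \<open>x [^] k\<close> is near \<open>a\<close> and \<open>x [^] l\<close> is near
  the identity, then \<open>x [^] (l - k)\<close> is near the inverse of \<open>a\<close>.
  Recurrence supplies such an \<open>l\<close> beyond \<open>k\<close>, so that the exponent is
  positive.\<close>

lemma forward_orbit_dense:
  assumes x: "infinite_order x" and a: "a \<in> cyclic_closure x" and P: "nbhd_one P"
  shows "\<exists>i::nat>0. x [^] i \<otimes> a \<in> P"
proof -
  have xc: "x \<in> carrier G" using x by (simp add: infinite_order_def)
  have A: "subgroup (cyclic_closure x) G" using abelian_cyclic_closure[OF xc] by (simp add: abelian_subgroup_def)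
  have ac: "a \<in> carrier G" using a closure_in_carrier by blast
  obtain Q where Q: "nbhd_one Q" "\<forall>a\<in>Q. \<forall>b\<in>Q. a \<otimes> b \<in> P" "\<forall>v\<in>Q. inv v \<in> Q"
    using nbhd_one_div[OF P] by blast
  obtain s where s: "s \<in> cyc x" "inv a \<otimes> s \<in> Q"
    using a in_closure[OF subgroup.subset[OF cyc_subgroup[OF xc]]] Q(1) by blast
  then obtain k :: int where k: "s = x [^] k" by (auto simp: cyc_def)
  obtain l :: nat where l: "l > nat k" "x [^] l \<in> Q" using recurrent[OF x Q(1)] by blast
  have "x [^] l \<otimes> inv (inv a \<otimes> s) \<in> P" using Q l s by blast
  also have "x [^] l \<otimes> inv (inv a \<otimes> s) = x [^] l \<otimes> inv (x [^] k) \<otimes> a"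
    using ac xc k by (simp add: inv_mult_group m_assoc)
  also have "x [^] l \<otimes> inv (x [^] k) = x [^] (int l - k)"
    using xc by (simp add: int_pow_diff int_pow_int)
  also have "int l - k = int (nat (int l - k))" using l by simp
  finally have "x [^] nat (int l - k) \<otimes> a \<in> P" by (metis int_pow_int)
  then show ?thesis using l by (intro exI[of _ "nat (int l - k)"]) auto
qed

text \<open>The argument of Weil's lemma on monothetic groups: finitely many translates of a compact
  neighbourhood suffice since the forward and the backward orbit return to it.\<close>

lemma compact_cyclic_closure:
  assumes lc: "locally_compact_space T" and x: "infinite_order x"
  shows "compactin T (cyclic_closure x)"
proof -
  let ?A = "cyclic_closure x"
  have xc: "x \<in> carrier G" using x by (simp add: infinite_order_def)
  have A: "subgroup ?A G" using abelian_cyclic_closure[OF xc] by (simp add: abelian_subgroup_def)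
  have comm: "a \<otimes> x [^] (n::nat) = x [^] n \<otimes> a" if "a \<in> ?A" for a n
  proof -
    have "x [^] n \<in> ?A"
      using subgroup_nat_pow_closed[OF A in_cyclic_closure[OF xc]] .
    then show ?thesis using abelian_cyclic_closure[OF xc] that unfolding abelian_subgroup_def by blast
  qed
  obtain P0 C where P0: "openin T P0" "compactin T C" "\<one> \<in> P0" "P0 \<subseteq> C"
    using lc unfolding locally_compact_space_def by (metis one_closed topspace)
  have "nbhd_one P0" using P0 by (simp add: nbhd_one_def)
  from nbhd_one_div[OF this] obtain P where P: "nbhd_one P" "P \<subseteq> C" "\<forall>v\<in>P. inv v \<in> P"
    using P0(4) by auto
  let ?V = "\<lambda>i::nat. {y \<in> carrier G. x [^] i \<otimes> y \<in> P}"
  have "compactin T (?A \<inter> C)" using closed_Int_compactin[OF closedin_closure_of P0(2)] .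
  moreover have "openin T U" if U: "U \<in> ?V ` {0<..}" for U
  proof -
    obtain i where "U = ?V i" using U by blast
    then show ?thesis using openin_lmult[OF nat_pow_closed[OF xc] nbhd_oneD(1)[OF P(1)]] by simp
  qed
  moreover have "?A \<inter> C \<subseteq> \<Union>(?V ` {0<..})"
  proof
    fix a assume a: "a \<in> ?A \<inter> C"
    then obtain i :: nat where "i > 0" "x [^] i \<otimes> a \<in> P" using forward_orbit_dense[OF x _ P(1)] by blast
    then show "a \<in> \<Union>(?V ` {0<..})" using a closure_in_carrier by blast
  qed
  ultimately have "\<exists>\<F>. finite \<F> \<and> \<F> \<subseteq> ?V ` {0<..} \<and> ?A \<inter> C \<subseteq> \<Union>\<F>"
    by (rule compactinD)
  then obtain \<F> where \<F>: "finite \<F>" "\<F> \<subseteq> ?V ` {0<..}" "?A \<inter> C \<subseteq> \<Union>\<F>" by blast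
  then obtain I where I: "finite I" "I \<subseteq> {0<..}" "\<F> = ?V ` I" using finite_subset_image by meson
  obtain N where N: "\<forall>i\<in>I. i \<le> N" using I(1) finite_nat_set_iff_bounded_le by blast
  have step: "\<exists>i\<in>{0<..N}. x [^] i \<otimes> a \<in> P" if a: "a \<in> ?A" "a \<in> C" for a
  proof -
    obtain i where "i \<in> I" "x [^] i \<otimes> a \<in> P" using \<F>(3) I(3) a by blast
    then show ?thesis using I(2) N by (intro bexI[of _ i]) auto
  qed
  have "?A \<subseteq> (\<Union>n\<in>{..N}. (\<lambda>y. x [^] n \<otimes> y) ` C)"
  proof
    fix a assume a: "a \<in> ?A"
    then have ac: "a \<in> carrier G" using closure_in_carrier by blast
    have ia: "inv a \<in> ?A" using subgroup.m_inv_closed[OF A a] .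
    define R where "R = (\<lambda>n::nat. inv (x [^] n) \<otimes> a \<in> P)"
    have "\<exists>n. R n"
    proof -
      obtain i :: nat where i: "x [^] i \<otimes> inv a \<in> P" using forward_orbit_dense[OF x ia P(1)] by blast
      have "inv (x [^] i \<otimes> inv a) \<in> P" using i P by blast
      moreover have "inv (x [^] i \<otimes> inv a) = inv (x [^] i) \<otimes> a"
        using ac xc by (simp add: comm[OF ia, symmetric] inv_mult_group)
      ultimately have "inv (x [^] i) \<otimes> a \<in> P" by simp
      then show ?thesis unfolding R_def by blast
    qed
    \<comment> \<open>The translate \<open>x [^] (- n) a\<close> lies in \<open>C\<close>, so some
      exponent \<open>i\<close> between 1 and \<open>N\<close> brings it back into \<open>P\<close>.
      If \<open>n\<close> exceeded \<open>N\<close>, then \<open>n - i\<close> would be a smaller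
      choice.\<close>
    define n where "n = (LEAST n. R n)"
    have n: "R n" unfolding n_def using \<open>\<exists>n. R n\<close> by (rule LeastI_ex)
    let ?b = "inv (x [^] n) \<otimes> a"
    have b: "?b \<in> ?A" "?b \<in> C"
    proof -
      have "x [^] n \<in> ?A"
        using subgroup_nat_pow_closed[OF A in_cyclic_closure[OF xc]] .
      then show "?b \<in> ?A" using subgroup.m_closed[OF A _ a] subgroup.m_inv_closed[OF A] by blast
      show "?b \<in> C" using n P by (auto simp: R_def)
    qed
    obtain i where i: "i \<in> {0<..N}" "x [^] i \<otimes> ?b \<in> P" using step[OF b] by blast
    have "n \<le> N"
    proof (rule ccontr)
      assume "\<not> n \<le> N"
      then have "i \<le> n" using i by simp
      then have "x [^] n = x [^] (n - i) \<otimes> x [^] i" using xc by (simp add: nat_pow_mult)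
      then have "inv (x [^] n) = inv (x [^] i) \<otimes> inv (x [^] (n - i))" using xc by (simp add: inv_mult_group)
      then have "x [^] i \<otimes> ?b = inv (x [^] (n - i)) \<otimes> a" using xc ac by (simp add: m_assoc[symmetric])
      then have "R (n - i)" using i by (simp add: R_def)
      then have "n \<le> n - i" unfolding n_def by (rule Least_le)
      moreover have "0 < i" using i(1) by simp
      ultimately show False using \<open>i \<le> n\<close> by linarith
    qed
    moreover have "x [^] n \<otimes> ?b = a" using ac xc by (simp add: m_assoc[symmetric])
    ultimately show "a \<in> (\<Union>n\<in>{..N}. (\<lambda>y. x [^] n \<otimes> y) ` C)" using b by force
  qed
  moreover have "compactin T (\<Union>n\<in>{..N}. (\<lambda>y. x [^] n \<otimes> y) ` C)"
    using image_compactin[OF P0(2) cont_lmult[OF nat_pow_closed[OF xc]]] by (intro compactin_Union) auto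
  ultimately show ?thesis using closed_compactin closedin_closure_of by metis
qed

text \<open>A finite group \<open>cyc y\<close> is closed and meets \<open>cyc x\<close> trivially
  because \<open>x\<close> has infinite order; \<open>essential\<close> makes it trivial.\<close>

lemma infinite_order_cyclic_closure:
  assumes x: "infinite_order x" and y: "y \<in> cyclic_closure x" "y \<noteq> \<one>"
  shows "infinite_order y"
proof (rule ccontr)
  assume no: "\<not> infinite_order y"
  have xc: "x \<in> carrier G" using x by (simp add: infinite_order_def)
  have yc: "y \<in> carrier G" using y closure_in_carrier by blast
  obtain n :: nat where n: "n > 0" "y [^] n = \<one>" using no yc by (auto simp: infinite_order_def)
  have "cyc y = {\<one>}"
  proof (rule essential[OF abelian_cyc[OF xc]])
    show "subgroup (cyc y) G" using cyc_subgroup yc .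
    show "closedin T (cyc y)" using closedin_cyc_finite_order[OF yc n] .
    show "cyc y \<subseteq> cyclic_closure x"
      using cyc_subset y abelian_cyclic_closure[OF xc] by (simp add: abelian_subgroup_def)
    show "cyc y \<inter> cyc x \<subseteq> {\<one>}"
    proof
      fix z assume "z \<in> cyc y \<inter> cyc x"
      then obtain i j :: int where z: "z = y [^] i" "z = x [^] j" by (fastforce simp: cyc_def)
      have "x [^] (j * int n) = y [^] (int n * i)"
        using z xc yc by (metis int_pow_pow mult.commute)
      also have "\<dots> = (y [^] int n) [^] i" using yc by (simp add: int_pow_pow)
      also have "\<dots> = \<one>" using n by (simp add: int_pow_int)
      finally have "j * int n = 0" using int_pow_eq_one_infinite_order[OF x] by blast
      then have "j = 0" using n by simp
      then show "z \<in> {\<one>}" using z(2) by simp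
    qed
  qed
  then show False using y(2) in_cyc[OF yc] by simp
qed

lemma closed_subgroup_meets:
  assumes x: "infinite_order x" and N: "subgroup N G" "closedin T N" "N \<subseteq> cyclic_closure x" "N \<noteq> {\<one>}"
  shows "\<exists>n::nat>0. x [^] n \<in> N"
proof -
  have xc: "x \<in> carrier G" using x by (simp add: infinite_order_def)
  have "\<not> N \<inter> cyc x \<subseteq> {\<one>}" using essential[OF abelian_cyc[OF xc] N(1-3)] N(4) by blast
  then obtain i :: int where i: "x [^] i \<in> N" "x [^] i \<noteq> \<one>" by (auto simp: cyc_def)
  then have "x [^] nat \<bar>i\<bar> \<in> N"
  proof (cases i rule: int_cases2)
    case (nonpos n)
    then show ?thesis using subgroup.m_inv_closed[OF N(1) i(1)] xc by (simp add: int_pow_neg_int)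
  qed (simp add: int_pow_int)
  moreover have "i \<noteq> 0" using i by auto
  ultimately show ?thesis by (intro exI[of _ "nat \<bar>i\<bar>"]) auto
qed

end

section \<open>Subgroups of powers\<close>

context topgroup
begin

abbreviation powers :: "nat \<Rightarrow> 'a set \<Rightarrow> 'a set" where
  "powers n K \<equiv> (\<lambda>k. k [^] n) ` K"

lemma abelian_pow_mult:
  assumes "abelian_subgroup K" "a \<in> K" "b \<in> K"
  shows "(a \<otimes> b) [^] (n::nat) = a [^] n \<otimes> b [^] n"
  using assms subgroup.subset[of K G] unfolding abelian_subgroup_def by (intro pow_mult_distrib) auto

lemma subgroup_powers:
  assumes "abelian_subgroup K"
  shows "subgroup (powers n K) G"
proof -
  have K: "subgroup K G" using assms by (simp add: abelian_subgroup_def)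
  note KG = subgroup.mem_carrier[OF K]
  show ?thesis
  proof (rule subgroupI)
    show "powers n K \<subseteq> carrier G" using KG by auto
    show "powers n K \<noteq> {}" using subgroup.one_closed[OF K] by blast
    fix a assume "a \<in> powers n K"
    then obtain k where k: "k \<in> K" "a = k [^] n" by blast
    then show "inv a \<in> powers n K"
      using KG subgroup.m_inv_closed[OF K] by (auto simp: nat_pow_inv intro!: image_eqI[of _ _ "inv k"])
    fix b assume "b \<in> powers n K"
    then obtain l where l: "l \<in> K" "b = l [^] n" by blast
    then show "a \<otimes> b \<in> powers n K"
      using k abelian_pow_mult[OF assms] subgroup.m_closed[OF K] by (intro image_eqI[of _ _ "k \<otimes> l"]) auto
  qed
qed

lemma compactin_powers:
  assumes "compactin T K" shows "compactin T (powers n K)"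
proof -
  have "continuous_map T T (\<lambda>k. k [^] n)" by (rule cont_pow) auto
  from image_compactin[OF assms this] show ?thesis .
qed

lemma closedin_compactin: "compactin T K \<Longrightarrow> closedin T K"
  using compactin_imp_closedin[OF Hausdorff] .

text \<open>The claim holds on the powers of \<open>x\<close> and passes to the closure because
  taking powers is continuous and \<open>N\<close> is closed.\<close>

lemma powers_subset:
  assumes x: "x \<in> carrier G" and N: "subgroup N G" "closedin T N" "x [^] n \<in> N"
  shows "powers n (cyclic_closure x) \<subseteq> N"
proof -
  have "continuous_map T T (\<lambda>k. k [^] n)" by (rule cont_pow) auto
  from continuous_map_image_closure_subset[OF this, of "cyc x"]
  have "powers n (cyclic_closure x) \<subseteq> T closure_of (powers n (cyc x))" .
  also have "powers n (cyc x) \<subseteq> N"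
  proof
    fix z assume "z \<in> powers n (cyc x)"
    then obtain i :: int where "z = (x [^] i) [^] n" by (auto simp: cyc_def)
    then have "z = x [^] (i * int n)" using int_pow_pow[OF x, of i "int n"] int_pow_int[of G "x [^] i" n] by simp
    then have "z = (x [^] n) [^] i" using int_pow_pow[OF x, of "int n" i] int_pow_int[of G x n]
      by (simp add: mult.commute)
    then show "z \<in> N" using subgroup_int_pow_closed[OF N(1,3)] by simp
  qed
  then have "T closure_of (powers n (cyc x)) \<subseteq> N" using N(2) by (rule closure_of_minimal)
  finally show ?thesis .
qed

end

locale compact_monothetic = hm_group +
  fixes x
  assumes infinite_order: "infinite_order x" and compact: "compactin T (cyclic_closure x)"
begin

abbreviation K where "K \<equiv> cyclic_closure x"

lemma x_carrier: "x \<in> carrier G" using infinite_order by (simp add: infinite_order_def)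
lemma abelian_K: "abelian_subgroup K" using abelian_cyclic_closure[OF x_carrier] .
lemma subgroup_K: "subgroup K G" using abelian_K by (simp add: abelian_subgroup_def)
lemma comm_K: "a \<in> K \<Longrightarrow> b \<in> K \<Longrightarrow> a \<otimes> b = b \<otimes> a" using abelian_K by (simp add: abelian_subgroup_def)
lemma K_carrier: "a \<in> K \<Longrightarrow> a \<in> carrier G" using closure_in_carrier by blast
lemma closed_K: "closedin T K" by simp
lemma x_in_K: "x \<in> K" using in_cyclic_closure[OF x_carrier] .
lemmas K_one = subgroup.one_closed[OF subgroup_K]
lemmas K_mult = subgroup.m_closed[OF subgroup_K]
lemmas K_inv = subgroup.m_inv_closed[OF subgroup_K]
lemmas K_pow = subgroup_nat_pow_closed[OF subgroup_K]
lemmas K_pow_mult = abelian_pow_mult[OF abelian_K]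

lemma K_torsion_free: "a \<in> K \<Longrightarrow> a [^] n = \<one> \<Longrightarrow> 0 < (n::nat) \<Longrightarrow> a = \<one>"
  using infinite_order_cyclic_closure[OF infinite_order] unfolding infinite_order_def by blast

lemma K_pow_inj:
  assumes "a \<in> K" "b \<in> K" "a [^] n = b [^] n" "0 < (n::nat)"
  shows "a = b"
proof -
  note c = assms(1,2)[THEN K_carrier]
  have "(a \<otimes> inv b) [^] n = a [^] n \<otimes> inv b [^] n" using K_pow_mult K_inv assms by blast
  also have "\<dots> = \<one>" using assms(3) c by (simp add: nat_pow_inv)
  finally have "a \<otimes> inv b = \<one>" using K_torsion_free K_mult K_inv assms by blast
  then show ?thesis using c by (metis inv_equality inv_closed inv_inv)
qed

end

text \<open>The halving map \<open>h\<close> of a compact monothetic group without proper closed subgroups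
  contracts some neighbourhood of the identity uniformly, hence the whole group; but \<open>h\<close> is
  surjective.\<close>

locale compact_simple_divisible = compact_monothetic +
  assumes divisible: "powers 2 K = K"
    and simple: "subgroup N G \<Longrightarrow> closedin T N \<Longrightarrow> N \<subseteq> K \<Longrightarrow> N \<noteq> {\<one>} \<Longrightarrow> N = K"
begin

definition h where "h y = (SOME z. z \<in> K \<and> z [^] (2::nat) = y)"

lemma h: assumes "y \<in> K" shows "h y \<in> K" "h y [^] (2::nat) = y"
proof -
  have "y \<in> powers 2 K" using divisible assms by blast
  then have "\<exists>z. z \<in> K \<and> z [^] (2::nat) = y" by blast
  from someI_ex[OF this] show "h y \<in> K" "h y [^] (2::nat) = y" by (simp_all add: h_def)
qed

text \<open>Squaring is injective on the compact group \<open>K\<close>, so its inverse is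
  continuous: the squares of \<open>K - U\<close> form a closed set without the identity, and its
  complement is the required neighbourhood.\<close>

lemma h_cont:
  assumes U: "nbhd_one U" shows "\<exists>V. nbhd_one V \<and> (\<forall>y\<in>K \<inter> V. h y \<in> U)"
proof -
  let ?C = "powers 2 (K - U)"
  have "compactin T (K \<inter> (carrier G - U))"
    using closedin_diff[OF closedin_topspace nbhd_oneD(1)[OF U]] compact by (intro compact_Int_closedin) auto
  moreover have "K \<inter> (carrier G - U) = K - U" using K_carrier by blast
  ultimately have "closedin T ?C" using closedin_compactin compactin_powers by simp
  moreover have "\<one> \<notin> ?C"
  proof
    assume "\<one> \<in> ?C"
    then obtain k where "k \<in> K" "k \<notin> U" "k [^] (2::nat) = \<one>" by auto
    then show False using K_torsion_free[of k 2] nbhd_oneD[OF U] by simp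
  qed
  ultimately have "nbhd_one (carrier G - ?C)"
    using openin_diff[OF openin_topspace] unfolding nbhd_one_def by force
  moreover have "h y \<in> U" if "y \<in> K \<inter> (carrier G - ?C)" for y
  proof (rule ccontr)
    assume "h y \<notin> U"
    then have "h y [^] (2::nat) \<in> ?C" using h that by blast
    then show False using h that by simp
  qed
  ultimately show ?thesis by blast
qed

lemma hm: assumes "y \<in> K" shows "(h ^^ m) y \<in> K" "(h ^^ m) y [^] ((2::nat) ^ m) = y"
proof -
  have "(h ^^ m) y \<in> K \<and> (h ^^ m) y [^] ((2::nat) ^ m) = y"
  proof (induction m)
    case (Suc m)
    let ?z = "(h ^^ m) y"
    have z: "?z \<in> K" "?z [^] ((2::nat) ^ m) = y" using Suc by auto
    have "h ?z [^] ((2::nat) * 2 ^ m) = (h ?z [^] (2::nat)) [^] ((2::nat) ^ m)"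
      using h(1)[OF z(1)] K_carrier by (simp only: nat_pow_pow)
    then show ?case using h[OF z(1)] z(2) by simp
  qed (use assms K_carrier in auto)
  then show "(h ^^ m) y \<in> K" "(h ^^ m) y [^] ((2::nat) ^ m) = y" by auto
qed

lemma hm_add_pow:
  assumes "y \<in> K"
  shows "(h ^^ (m + i)) y [^] ((2::nat) ^ i * k) = (h ^^ m) y [^] k"
proof -
  let ?z = "(h ^^ m) y"
  have z: "?z \<in> K" using hm assms by blast
  have "(h ^^ (m + i)) y = (h ^^ i) ?z" by (simp add: funpow_add add.commute[of m i])
  moreover have "(h ^^ i) ?z [^] ((2::nat) ^ i * k) = ((h ^^ i) ?z [^] ((2::nat) ^ i)) [^] k"
    using hm(1)[OF z] K_carrier by (simp only: nat_pow_pow)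
  ultimately show ?thesis using hm(2)[OF z] by simp
qed

lemma hm_mult: "a \<in> K \<Longrightarrow> b \<in> K \<Longrightarrow> (h ^^ m) (a \<otimes> b) = (h ^^ m) a \<otimes> (h ^^ m) b"
  by (rule K_pow_inj[of _ _ "2 ^ m"]) (simp_all add: hm K_mult K_pow_mult)

lemma hm_inv: assumes "a \<in> K" shows "(h ^^ m) (inv a) = inv ((h ^^ m) a)"
proof (rule K_pow_inj[of _ _ "2 ^ m"])
  show "(h ^^ m) (inv a) \<in> K" "inv ((h ^^ m) a) \<in> K"
    using hm(1) K_inv assms by auto
  show "(h ^^ m) (inv a) [^] ((2::nat) ^ m) = inv ((h ^^ m) a) [^] ((2::nat) ^ m)"
    using hm[OF assms, of m] hm(2)[OF K_inv[OF assms], of m] K_carrier[OF hm(1)[OF assms, of m]]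
    by (simp add: nat_pow_inv)
qed simp

lemma hm_cont:
  "nbhd_one U \<Longrightarrow> \<exists>V. nbhd_one V \<and> (\<forall>y\<in>K \<inter> V. (h ^^ m) y \<in> U)"
proof (induction m arbitrary: U)
  case (Suc m)
  obtain W where W: "nbhd_one W" "\<forall>y\<in>K \<inter> W. h y \<in> U" using h_cont[OF Suc.prems] by blast
  obtain V where V: "nbhd_one V" "\<forall>y\<in>K \<inter> V. (h ^^ m) y \<in> W" using Suc.IH[OF W(1)] by blast
  have "(h ^^ Suc m) y \<in> U" if "y \<in> K \<inter> V" for y
    using W(2) V(2) hm(1)[of y m] that by simp
  then show ?case using V(1) by blast
qed auto

lemma hm_pow_cont:
  assumes U: "nbhd_one U"
  shows "\<exists>V. nbhd_one V \<and> (\<forall>y\<in>K \<inter> V. \<forall>m\<le>M. \<forall>q\<le>N. (h ^^ m) y [^] (q::nat) \<in> U)"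
proof -
  have "\<exists>V. nbhd_one V \<and> (\<forall>y\<in>V. \<forall>i\<in>{..M} \<times> {..N}. y \<in> K \<longrightarrow> (h ^^ fst i) y [^] snd i \<in> U)"
  proof (rule nbhd_one_ball)
    fix i :: "nat \<times> nat"
    obtain W where W: "nbhd_one W" "\<forall>v\<in>W. v [^] snd i \<in> U" using nbhd_one_pow[OF U] by blast
    show "\<exists>V. nbhd_one V \<and> (\<forall>y\<in>V. y \<in> K \<longrightarrow> (h ^^ fst i) y [^] snd i \<in> U)"
      using hm_cont[OF W(1), of "fst i"] W(2) by blast
  qed simp
  then show ?thesis by fastforce
qed

lemma x_neq_one: "x \<noteq> \<one>"
proof
  assume "x = \<one>"
  then have "x [^] (1::nat) = \<one>" by simp
  then show False using infinite_order unfolding infinite_order_def by auto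
qed

text \<open>A nontrivial \<open>y\<close> generates a dense subgroup of \<open>K\<close> by
  simplicity, so its positive powers come arbitrarily close to \<open>x\<close>, which is the
  inverse of \<open>inv x\<close>.\<close>

lemma no_small_orbit:
  assumes V: "openin T V" "x \<in> V" and y: "y \<in> K" "\<And>k. 0 < k \<Longrightarrow> y [^] (k::nat) \<notin> V"
  shows "y = \<one>"
proof (rule ccontr)
  assume y1: "y \<noteq> \<one>"
  have yc: "y \<in> carrier G" using K_carrier y(1) .
  have "infinite_order y" using infinite_order_cyclic_closure[OF infinite_order y(1) y1] .
  moreover have "subgroup (cyclic_closure y) G"
    using abelian_cyclic_closure[OF yc] by (simp add: abelian_subgroup_def)
  then have "cyclic_closure y = K"
    using cyclic_closure_minimal[OF subgroup_K closed_K y(1)] in_cyclic_closure[OF yc] y1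
    by (intro simple) auto
  moreover have P: "nbhd_one {z \<in> carrier G. z \<otimes> x \<in> V}"
  proof -
    have "continuous_map T T (\<lambda>z. z \<otimes> x)" using x_carrier by (intro cont_mult) auto
    from openin_continuous_map_preimage[OF this V(1)] show ?thesis
      using V(2) x_carrier by (simp add: nbhd_one_def)
  qed
  ultimately obtain i :: nat where "i > 0" "y [^] i \<otimes> inv x \<otimes> x \<in> V"
    using forward_orbit_dense[OF _ _ P, of y "inv x"] K_inv[OF x_in_K] by auto
  then show False using y(2) x_carrier yc by (simp add: m_assoc)
qed

text \<open>Uniform version of \<open>no_small_orbit\<close>. The elements outside \<open>Q\<close>
  whose first \<open>M\<close> powers avoid \<open>V\<close> form decreasing closed subsets of
  \<open>K\<close>; if none were empty, a common element would contradict that lemma.\<close>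

lemma small_orbit:
  assumes V: "openin T V" "x \<in> V" and Q: "nbhd_one Q"
  shows "\<exists>M. \<forall>y\<in>K. (\<forall>k. 0 < k \<and> k \<le> M \<longrightarrow> y [^] (k::nat) \<notin> V) \<longrightarrow> y \<in> Q"
proof (rule ccontr)
  assume no: "\<not> ?thesis"
  define C where "C M = K \<inter> (carrier G - Q) \<inter> (\<Inter>k\<in>{..M}. {y \<in> carrier G. 0 < k \<longrightarrow> y [^] (k::nat) \<in> carrier G - V})" for M
  have "\<exists>z. \<forall>n. z \<in> C n"
  proof (rule compact_nest[OF compact])
    fix n
    have "closedin T {y \<in> carrier G. 0 < k \<longrightarrow> y [^] k \<in> carrier G - V}" for k :: nat
    proof (cases "k = 0")
      case False
      have "continuous_map T T (\<lambda>y. y [^] k)" by (rule cont_pow) auto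
      from closedin_continuous_map_preimage[OF this, of "carrier G - V"] show ?thesis
        using False closedin_diff[OF closedin_topspace V(1)] by simp
    qed (use closedin_topspace[of T] in simp)
    then show "closedin T (C n)" unfolding C_def
      using closedin_diff[OF closedin_topspace nbhd_oneD(1)[OF Q]] by (intro closedin_Int closedin_INT) auto
    show "C n \<subseteq> K" by (auto simp: C_def)
    obtain y where "y \<in> K" "\<forall>k. 0 < k \<and> k \<le> n \<longrightarrow> y [^] k \<notin> V" "y \<notin> Q" using no by blast
    then have "y \<in> C n" using K_carrier by (auto simp: C_def)
    then show "C n \<noteq> {}" by blast
    show "C n \<subseteq> C m" if "m \<le> n" for m using that by (fastforce simp: C_def)
  qed
  then obtain z where z: "\<And>n. z \<in> C n" by blast
  have "z \<in> K" "z \<notin> Q" using z[of 0] by (auto simp: C_def)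
  moreover have "z [^] k \<notin> V" if "0 < k" for k :: nat using z[of k] that by (auto simp: C_def)
  ultimately have "z = \<one>" using no_small_orbit[OF V] by blast
  then show False using \<open>z \<notin> Q\<close> nbhd_oneD[OF Q] by simp
qed

text \<open>It suffices to keep all powers of \<open>(h ^^ m) y\<close> up to exponent
  \<open>2 ^ m\<close> inside \<open>U\<close>: by \<open>small\<close>, ever longer runs of powers
  in \<open>U\<close> force \<open>(h ^^ m) y\<close> towards the identity, uniformly in
  \<open>y\<close>.\<close>

lemma contraction:
  "\<exists>O'. nbhd_one O' \<and> (\<forall>Q. nbhd_one Q \<longrightarrow> (\<exists>m0. \<forall>m\<ge>m0. \<forall>y\<in>K \<inter> O'. (h ^^ m) y \<in> Q))"
proof -
  obtain U Vx where UV: "openin T U" "openin T Vx" "\<one> \<in> U" "x \<in> Vx" "disjnt U Vx"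
    using Hausdorff x_neq_one x_carrier unfolding Hausdorff_space_def by (metis one_closed topspace)
  have U: "nbhd_one U" using UV by (simp add: nbhd_one_def)
  have small: "\<exists>M. \<forall>y\<in>K. (\<forall>k. 0 < k \<and> k \<le> M \<longrightarrow> y [^] (k::nat) \<in> U) \<longrightarrow> y \<in> Q" if Q: "nbhd_one Q" for Q
  proof -
    obtain M where M: "\<forall>y\<in>K. (\<forall>k. 0 < k \<and> k \<le> M \<longrightarrow> y [^] (k::nat) \<notin> Vx) \<longrightarrow> y \<in> Q"
      using small_orbit[OF UV(2,4) Q] by blast
    show ?thesis
    proof (intro exI[of _ M] ballI impI)
      fix y assume "y \<in> K" and U: "\<forall>k. 0 < k \<and> k \<le> M \<longrightarrow> y [^] (k::nat) \<in> U"
      have "y [^] k \<notin> Vx" if "0 < k \<and> k \<le> M" for k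
        using U[rule_format, OF that] UV(5) by (simp add: disjnt_iff)
      then show "y \<in> Q" using M \<open>y \<in> K\<close> by simp
    qed
  qed
  \<comment> \<open>The induction must not lose ground: doubling the exponent range weakens
    \<open>V\<close> to \<open>U\<close>, and a decomposition of the exponent into two factors in
    \<open>W\<close> recovers \<open>V\<close>.\<close>
  obtain V where V: "nbhd_one V" "V \<subseteq> U" "\<forall>a\<in>V. \<forall>b\<in>V. a \<otimes> b \<in> U" using nbhd_one_div[OF U] by blast
  obtain W where W: "nbhd_one W" "W \<subseteq> V" "\<forall>a\<in>W. \<forall>b\<in>W. a \<otimes> b \<in> V" using nbhd_one_div[OF V(1)] by blast
  obtain M where M: "\<forall>y\<in>K. (\<forall>k. 0 < k \<and> k \<le> M \<longrightarrow> y [^] (k::nat) \<in> U) \<longrightarrow> y \<in> W"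
    using small[OF W(1)] by blast
  obtain V' where V': "nbhd_one V'" "\<forall>y\<in>K \<inter> V'. h y \<in> V" using h_cont[OF V(1)] by blast
  obtain M' where M': "\<forall>y\<in>K. (\<forall>k. 0 < k \<and> k \<le> M' \<longrightarrow> y [^] (k::nat) \<in> U) \<longrightarrow> y \<in> V'"
    using small[OF V'(1)] by blast
  \<comment> \<open>Runs of length \<open>2 ^ j\<close> are long enough for both applications of
    \<open>small\<close>; the set \<open>O'\<close> below settles the first \<open>j\<close>
    halvings by continuity.\<close>
  define j where "j = max M M'"
  have j: "M \<le> 2 ^ j" "M' \<le> 2 ^ j" unfolding j_def
    by (meson less_exp less_imp_le max.cobounded1 max.cobounded2 order_trans)+
  obtain O' where O: "nbhd_one O'" "\<forall>y\<in>K \<inter> O'. \<forall>m\<le>j. \<forall>q\<le>2 ^ j. (h ^^ m) y [^] (q::nat) \<in> W"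
    using hm_pow_cont[OF W(1)] by blast
  have small_V: "\<forall>k\<le>2 ^ m. (h ^^ m) y [^] (k::nat) \<in> V" if y: "y \<in> K \<inter> O'" for y m
  proof (induction m)
    case 0
    show ?case
    proof (intro allI impI)
      fix k :: nat assume "k \<le> 2 ^ 0"
      then have "k \<le> 2 ^ j" by (metis le_trans one_le_numeral one_le_power power_0)
      then show "(h ^^ 0) y [^] k \<in> V" using O(2) W(2) y by blast
    qed
  next
    case (Suc m)
    let ?z = "(h ^^ Suc m) y" and ?y = "(h ^^ m) y"
    have yK: "?y \<in> K" "?z \<in> K" using hm(1) y by blast+
    note c = yK[THEN K_carrier]
    have z2: "?z [^] (2 * i) = ?y [^] i" for i :: nat
      using hm_add_pow[of y m 1 i] y by simp
    show ?case
    proof (cases "Suc m \<le> j")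
      case True
      show ?thesis
      proof (intro allI impI)
        fix k :: nat assume "k \<le> 2 ^ Suc m"
        then have "k \<le> 2 ^ j" using True power_increasing[of "Suc m" j "2::nat"] by linarith
        then show "?z [^] k \<in> V" using O(2) W(2) y True by blast
      qed
    next
      case False
      then have jm: "j \<le> m" by simp
      \<comment> \<open>The induction hypothesis gives a run of at least \<open>M'\<close> powers of
        \<open>?y\<close> in \<open>U\<close>, so \<open>?y\<close> lies in \<open>V'\<close> and
        its half \<open>?z\<close> in \<open>V\<close>.\<close>
      then have "2 ^ j \<le> (2::nat) ^ m" by (simp add: power_increasing)
      then have "?y [^] k \<in> U" if "k \<le> M'" for k :: nat
        using Suc V(2) j that by (meson order_trans subsetD)
      then have "?y \<in> V'" using M' yK by blast
      then have zV: "?z \<in> V" using V' yK by simp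
      \<comment> \<open>Even powers of \<open>?z\<close> are powers of \<open>?y\<close>; an odd
        power has one extra factor \<open>?z\<close>, which costs the passage from \<open>V\<close>
        to \<open>U\<close>.\<close>
      have zU: "?z [^] k \<in> U" if k: "k \<le> 2 ^ Suc m" for k :: nat
      proof (cases "even k")
        case True
        then obtain i where "k = 2 * i" by blast
        then show ?thesis using z2[of i] Suc k V(2) by auto
      next
        case False
        then obtain i where i: "k = 2 * i + 1" using oddE by blast
        then have "?z [^] k = ?y [^] i \<otimes> ?z" using z2[of i] by simp
        moreover have "i \<le> 2 ^ m" using i k by simp
        ultimately show ?thesis using Suc V(3) zV by auto
      qed
      show ?thesis
      proof (intro allI impI)
        fix k :: nat assume k: "k \<le> 2 ^ Suc m"
        \<comment> \<open>The power \<open>?z [^] d\<close> is \<open>(h ^^ j) y\<close>, whose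
          powers up to \<open>2 ^ j\<close> lie in \<open>W\<close> by the choice of
          \<open>O'\<close>. This handles the quotient of \<open>k\<close> by
          \<open>d\<close>.\<close>
        define d where "d = (2::nat) ^ (Suc m - j)"
        have d: "2 ^ j * d = 2 ^ Suc m" "d > 0" unfolding d_def using jm by (simp_all flip: power_add)
        have q: "k div d \<le> 2 ^ j" using k d by (metis div_le_mono nonzero_mult_div_cancel_right not_gr0)
        have "(h ^^ (j + (Suc m - j))) y [^] (d * (k div d)) = (h ^^ j) y [^] (k div d)"
          unfolding d_def using y by (intro hm_add_pow) auto
        then have 1: "?z [^] (d * (k div d)) \<in> W" using O(2) y q jm by simp
        \<comment> \<open>The remainder is less than \<open>d\<close>, so even its multiples by
          factors up to \<open>2 ^ j\<close> stay in the range of \<open>zU\<close>;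
          \<open>M\<close> consecutive powers in \<open>U\<close> then yield
          \<open>W\<close>.\<close>
        have 2: "?z [^] (k mod d) \<in> W"
        proof -
          have "(?z [^] (k mod d)) [^] i \<in> U" if "i \<le> M" for i :: nat
          proof -
            have "k mod d * i \<le> d * 2 ^ j" using d(2) j(1) that by (intro mult_le_mono) auto
            then have "?z [^] (k mod d * i) \<in> U" using zU d(1) by (simp add: mult.commute)
            then show ?thesis using c by (simp add: nat_pow_pow)
          qed
          then show ?thesis using M K_pow[OF yK(2)] by blast
        qed
        have "?z [^] k = ?z [^] (d * (k div d)) \<otimes> ?z [^] (k mod d)"
          using c by (simp add: nat_pow_mult)
        then show "?z [^] k \<in> V" using 1 2 W(3) by simp
      qed
    qed
  qed
  have "\<exists>m0. \<forall>m\<ge>m0. \<forall>y\<in>K \<inter> O'. (h ^^ m) y \<in> Q" if Q: "nbhd_one Q" for Q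
  proof -
    obtain N where N: "\<forall>y\<in>K. (\<forall>k. 0 < k \<and> k \<le> N \<longrightarrow> y [^] (k::nat) \<in> U) \<longrightarrow> y \<in> Q"
      using small[OF Q] by blast
    have "(h ^^ m) y \<in> Q" if my: "m \<ge> N" "y \<in> K \<inter> O'" for m y
    proof -
      have "N \<le> 2 ^ m" using my(1) less_exp[of m] by linarith
      then have "(h ^^ m) y [^] k \<in> U" if "k \<le> N" for k :: nat
        using small_V[OF my(2), of m] V(2) that by (meson order_trans subsetD)
      then show ?thesis using N hm(1) my(2) by blast
    qed
    then show ?thesis by blast
  qed
  then show ?thesis using O(1) by blast
qed

text \<open>The contracted elements form a subgroup \<open>R\<close> containing a neighbourhood of
  the identity in \<open>K\<close>. So \<open>R\<close> is closed, and it is nontrivial by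
  recurrence; hence it is \<open>K\<close>. Compactness makes the contraction uniform on
  \<open>K\<close>, against surjectivity of the iterates of \<open>h\<close>.\<close>

lemma contradiction: False
proof -
  obtain O' where O: "nbhd_one O'"
    "\<And>Q. nbhd_one Q \<Longrightarrow> \<exists>m0. \<forall>m\<ge>m0. \<forall>y\<in>K \<inter> O'. (h ^^ m) y \<in> Q"
    using contraction by blast
  define R where "R = {y \<in> K. \<forall>Q. nbhd_one Q \<longrightarrow> (\<exists>m0. \<forall>m\<ge>m0. (h ^^ m) y \<in> Q)}"
  have OR: "K \<inter> O' \<subseteq> R" unfolding R_def using O(2) by blast
  have R: "subgroup R G"
  proof (rule subgroupI)
    show "R \<subseteq> carrier G" using K_carrier by (auto simp: R_def)
    show "R \<noteq> {}" using OR K_one nbhd_oneD[OF O(1)] by blast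
    fix a assume a: "a \<in> R"
    have aK: "a \<in> K" using a by (simp add: R_def)
    show "inv a \<in> R"
      unfolding R_def
    proof (intro CollectI conjI allI impI)
      show "inv a \<in> K" using K_inv aK .
      fix Q assume "nbhd_one Q"
      then obtain V where V: "nbhd_one V" "V \<subseteq> Q" "\<forall>v\<in>V. inv v \<in> V" using nbhd_one_div by blast
      then obtain m0 where "\<forall>m\<ge>m0. (h ^^ m) a \<in> V" using a unfolding R_def by blast
      then show "\<exists>m0. \<forall>m\<ge>m0. (h ^^ m) (inv a) \<in> Q" using V hm_inv[OF aK] by auto
    qed
    fix b assume b: "b \<in> R"
    have bK: "b \<in> K" using b by (simp add: R_def)
    show "a \<otimes> b \<in> R"
      unfolding R_def
    proof (intro CollectI conjI allI impI)
      show "a \<otimes> b \<in> K" using K_mult aK bK .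
      fix Q assume "nbhd_one Q"
      then obtain V where V: "nbhd_one V" "\<forall>a\<in>V. \<forall>b\<in>V. a \<otimes> b \<in> Q" using nbhd_one_div by blast
      obtain m1 where m1: "\<forall>m\<ge>m1. (h ^^ m) a \<in> V" using a V(1) unfolding R_def by blast
      obtain m2 where m2: "\<forall>m\<ge>m2. (h ^^ m) b \<in> V" using b V(1) unfolding R_def by blast
      have "\<forall>m\<ge>max m1 m2. (h ^^ m) (a \<otimes> b) \<in> Q" using V(2) m1 m2 hm_mult[OF aK bK] by simp
      then show "\<exists>m0. \<forall>m\<ge>m0. (h ^^ m) (a \<otimes> b) \<in> Q" by blast
    qed
  qed
  have RK: "R \<subseteq> K" by (auto simp: R_def)
  \<comment> \<open>An open subgroup of \<open>K\<close> is closed: a limit point differs from an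
    element of \<open>R\<close> by an element of \<open>K\<close> in \<open>O'\<close>, hence of
    \<open>R\<close>.\<close>
  have "T closure_of R \<subseteq> R"
  proof
    fix y assume y: "y \<in> T closure_of R"
    have yK: "y \<in> K" using y closure_of_minimal[OF RK closed_K] by blast
    obtain r where r: "r \<in> R" "inv y \<otimes> r \<in> O'" using y in_closure[OF subgroup.subset[OF R]] O(1) by blast
    have "inv y \<otimes> r \<in> K" using K_mult[OF K_inv[OF yK]] RK r(1) by blast
    then have "inv y \<otimes> r \<in> R" using OR r by blast
    then have "r \<otimes> inv (inv y \<otimes> r) \<in> R"
      using subgroup.m_closed[OF R r(1)] subgroup.m_inv_closed[OF R] by blast
    also have "r \<otimes> inv (inv y \<otimes> r) = y"
      using K_carrier[OF yK] subgroup.mem_carrier[OF R r(1)] by (simp add: inv_mult_group flip: m_assoc)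
    finally show "y \<in> R" .
  qed
  then have "closedin T R" using closure_of_subset_eq[of R T] subgroup.subset[OF R] by auto
  moreover have "R \<noteq> {\<one>}"
  proof -
    obtain k :: nat where k: "k > 0" "x [^] k \<in> O'" using recurrent[OF infinite_order O(1), of 0] by blast
    then have "x [^] k \<in> R" using OR K_pow[OF x_in_K] by blast
    then show ?thesis using k(1) infinite_order by (auto simp: infinite_order_def)
  qed
  ultimately have RK: "R = K" using simple R RK by blast
  obtain U where U: "nbhd_one U" "x \<notin> U" using nbhd_one_sep[OF x_carrier x_neq_one] by blast
  obtain Q where Q: "nbhd_one Q" "\<forall>a\<in>Q. \<forall>b\<in>Q. a \<otimes> b \<in> U" using nbhd_one_div[OF U(1)] by blast
  let ?V = "\<lambda>f. {y \<in> carrier G. inv f \<otimes> y \<in> O'}"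
  have "\<exists>\<F>. finite \<F> \<and> \<F> \<subseteq> ?V ` K \<and> K \<subseteq> \<Union>\<F>"
  proof (rule compactinD[OF compact])
    show "openin T W" if "W \<in> ?V ` K" for W
      using that openin_lmult[OF _ nbhd_oneD(1)[OF O(1)]] K_carrier by auto
    show "K \<subseteq> \<Union>(?V ` K)"
    proof
      fix y assume "y \<in> K"
      then have "y \<in> ?V y" using K_carrier nbhd_oneD[OF O(1)] by simp
      then show "y \<in> \<Union>(?V ` K)" using \<open>y \<in> K\<close> by blast
    qed
  qed
  then obtain \<F> where \<F>: "finite \<F>" "\<F> \<subseteq> ?V ` K" "K \<subseteq> \<Union>\<F>" by blast
  obtain F where "F \<subseteq> K" "finite F" "\<F> = ?V ` F" using finite_subset_image[OF \<F>(1,2)] by blast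
  then have F: "finite F" "F \<subseteq> K" "K \<subseteq> (\<Union>f\<in>F. ?V f)" using \<F>(3) by auto
  have "\<exists>m0. \<forall>m\<ge>m0. \<forall>f\<in>F. (h ^^ m) f \<in> Q" using F(1,2)
  proof (induction F)
    case (insert f F)
    then obtain m1 where m1: "\<forall>m\<ge>m1. \<forall>f\<in>F. (h ^^ m) f \<in> Q" by blast
    have "f \<in> R" using insert.prems RK by blast
    then obtain m2 where m2: "\<forall>m\<ge>m2. (h ^^ m) f \<in> Q" using Q(1) unfolding R_def by blast
    have "\<forall>m\<ge>max m1 m2. \<forall>f\<in>insert f F. (h ^^ m) f \<in> Q" using m1 m2 by simp
    then show ?case by blast
  qed simp
  then obtain m1 where m1: "\<forall>m\<ge>m1. \<forall>f\<in>F. (h ^^ m) f \<in> Q" by blast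
  obtain m2 where m2: "\<forall>m\<ge>m2. \<forall>y\<in>K \<inter> O'. (h ^^ m) y \<in> Q" using O(2)[OF Q(1)] by blast
  define m where "m = max m1 m2"
  \<comment> \<open>Write \<open>y\<close> as a representative \<open>f\<close> times an element of
    \<open>O'\<close>. Both factors are in \<open>Q\<close> after \<open>m\<close> halvings, the
    former by pointwise and the latter by uniform contraction.\<close>
  have "(h ^^ m) y \<in> U" if y: "y \<in> K" for y
  proof -
    obtain f where f: "f \<in> F" "inv f \<otimes> y \<in> O'" using F(3) y by blast
    have fK: "f \<in> K" using f F by blast
    have iK: "inv f \<otimes> y \<in> K" using K_mult[OF K_inv[OF fK] y] .
    have "y = f \<otimes> (inv f \<otimes> y)" using K_carrier[OF fK] K_carrier[OF y] by (simp flip: m_assoc)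
    then have "(h ^^ m) y = (h ^^ m) f \<otimes> (h ^^ m) (inv f \<otimes> y)" using hm_mult[OF fK iK] by simp
    moreover have "(h ^^ m) f \<in> Q" using m1 f unfolding m_def by simp
    moreover have "(h ^^ m) (inv f \<otimes> y) \<in> Q" using m2 f iK unfolding m_def by simp
    ultimately show ?thesis using Q(2) by simp
  qed
  then have "(h ^^ m) (x [^] ((2::nat) ^ m)) \<in> U" using K_pow[OF x_in_K] by blast
  moreover have "(h ^^ m) (x [^] ((2::nat) ^ m)) = x"
    by (rule K_pow_inj[OF hm(1)[OF K_pow[OF x_in_K]] x_in_K hm(2)[OF K_pow[OF x_in_K]]]) simp
  ultimately show False using U(2) by simp
qed

end

section \<open>Independent elements\<close>

lemma (in group) int_pow_commute:
  assumes a: "a \<in> carrier G" and b: "b \<in> carrier G" and ab: "a \<otimes> b = b \<otimes> a"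
  shows "a [^] (i::int) \<otimes> b = b \<otimes> a [^] i"
proof -
  have n: "a [^] n \<otimes> b = b \<otimes> a [^] n" for n :: nat
  proof (induction n)
    case (Suc n)
    have "a [^] Suc n \<otimes> b = a [^] n \<otimes> b \<otimes> a" using a b ab by (simp add: m_assoc)
    then show ?case using a b Suc by (simp add: m_assoc)
  qed (use b in simp)
  show ?thesis
  proof (cases i rule: int_cases2)
    case (nonneg m)
    then show ?thesis using n by (simp add: int_pow_int)
  next
    case (nonpos m)
    let ?c = "a [^] m"
    have c: "?c \<in> carrier G" using a by simp
    have "inv ?c \<otimes> b = inv ?c \<otimes> (b \<otimes> ?c) \<otimes> inv ?c" using b c by (simp add: m_assoc)
    also have "\<dots> = inv ?c \<otimes> (?c \<otimes> b) \<otimes> inv ?c" using n by simp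
    also have "\<dots> = b \<otimes> inv ?c" using b c by (simp flip: m_assoc)
    finally show ?thesis using nonpos a by (simp add: int_pow_neg_int)
  qed
qed

lemma (in group) subgroup_adjoin:
  fixes c
  assumes A: "subgroup A G" "\<And>a b. a \<in> A \<Longrightarrow> b \<in> A \<Longrightarrow> a \<otimes> b = b \<otimes> a"
    and c: "c \<in> carrier G" "\<And>a. a \<in> A \<Longrightarrow> c \<otimes> a = a \<otimes> c"
  defines "B \<equiv> {a \<otimes> c [^] (i::int) | a i. a \<in> A}"
  shows "subgroup B G" "\<forall>u\<in>B. \<forall>v\<in>B. u \<otimes> v = v \<otimes> u" "A \<subseteq> B" "c \<in> B"
proof -
  note AG = subgroup.mem_carrier[OF A(1)]
  have BI: "a \<otimes> c [^] i \<in> B" if "a \<in> A" for a and i :: int using that unfolding B_def by blast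
  have BE: "\<exists>a i. u = a \<otimes> c [^] (i::int) \<and> a \<in> A" if "u \<in> B" for u using that unfolding B_def by blast
  have mult: "(a \<otimes> c [^] i) \<otimes> (b \<otimes> c [^] j) = (a \<otimes> b) \<otimes> c [^] (i + j)"
    if ab: "a \<in> A" "b \<in> A" for a b and i j :: int
  proof -
    have "a \<otimes> (c [^] i \<otimes> b) \<otimes> c [^] j = a \<otimes> (b \<otimes> c [^] i) \<otimes> c [^] j"
      using int_pow_commute[OF c(1) AG[OF ab(2)] c(2)[OF ab(2)]] by simp
    then show ?thesis using AG[OF ab(1)] AG[OF ab(2)] c(1) by (simp add: m_assoc int_pow_mult)
  qed
  show "\<forall>u\<in>B. \<forall>v\<in>B. u \<otimes> v = v \<otimes> u"
  proof (intro ballI)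
    fix u v assume "u \<in> B" "v \<in> B"
    then obtain a i b j where "u = a \<otimes> c [^] (i::int)" "a \<in> A" "v = b \<otimes> c [^] (j::int)" "b \<in> A"
      using BE by meson
    then show "u \<otimes> v = v \<otimes> u" using A(2) by (simp add: mult add.commute)
  qed
  show "subgroup B G"
  proof (rule subgroupI)
    show "B \<subseteq> carrier G" using AG c(1) by (auto simp: B_def)
    show "B \<noteq> {}" using BI[OF subgroup.one_closed[OF A(1)]] by blast
    fix u assume "u \<in> B"
    then obtain a i where u: "u = a \<otimes> c [^] (i::int)" "a \<in> A" using BE by blast
    have ia: "inv a \<in> A" using subgroup.m_inv_closed[OF A(1) u(2)] .
    have "inv u = inv a \<otimes> c [^] (- i)"
    proof (rule inv_equality)
      show "inv a \<otimes> c [^] (- i) \<otimes> u = \<one>" using u(2) ia AG by (simp add: u(1) mult)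
    qed (use u AG c(1) in auto)
    then show "inv u \<in> B" using BI[OF ia] by simp
    fix v assume "v \<in> B"
    then obtain b j where v: "v = b \<otimes> c [^] (j::int)" "b \<in> A" using BE by blast
    show "u \<otimes> v \<in> B" unfolding u v(1) mult[OF u(2) v(2)] by (rule BI[OF subgroup.m_closed[OF A(1) u(2) v(2)]])
  qed
  show "A \<subseteq> B"
  proof
    fix a assume "a \<in> A"
    then show "a \<in> B" using BI[of a 0] AG by simp
  qed
  show "c \<in> B" using BI[OF subgroup.one_closed[OF A(1)], of 1] c(1) by simp
qed

context topgroup
begin

lemma closedin_lmult: "a \<in> carrier G \<Longrightarrow> closedin T N \<Longrightarrow> closedin T {y \<in> carrier G. a \<otimes> y \<in> N}"
  using closedin_continuous_map_preimage[OF cont_lmult] by fastforce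

text \<open>By Baire's theorem a countable locally compact Hausdorff space cannot be a union of
  points with empty interior; an isolated point is then translated to the identity.\<close>

lemma countable_closed_subgroup_discrete:
  assumes C: "subgroup C G" "closedin T C" "countable C"
    and lc: "locally_compact_space (subtopology T C)"
  shows "\<exists>V. nbhd_one V \<and> C \<inter> V \<subseteq> {\<one>}"
proof -
  let ?X = "subtopology T C"
  have top: "topspace ?X = C" using subgroup.subset[OF C(1)] by auto
  have "Hausdorff_space ?X" using Hausdorff by (rule Hausdorff_space_subtopology)
  then have reg: "regular_space ?X" using lc locally_compact_Hausdorff_imp_regular_space by blast
  have "\<exists>c\<in>C. ?X interior_of {c} \<noteq> {}"
  proof (rule ccontr)
    assume no: "\<not> ?thesis"
    have "?X interior_of \<Union>((\<lambda>c. {c}) ` C) = {}"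
    proof (rule Baire_category_alt)
      show "completely_metrizable_space ?X \<or> locally_compact_space ?X \<and> regular_space ?X"
        using lc reg by simp
      show "countable ((\<lambda>c. {c}) ` C)" using C by simp
      fix S assume "S \<in> (\<lambda>c. {c}) ` C"
      then obtain c where c: "c \<in> C" "S = {c}" by blast
      then show "closedin ?X S \<and> ?X interior_of S = {}"
        using no closedin_Hausdorff_singleton[OF \<open>Hausdorff_space ?X\<close>, of c] top by auto
    qed
    moreover have "\<Union>((\<lambda>c. {c}) ` C) = C" by blast
    moreover have "?X interior_of C = C" using interior_of_topspace[of ?X] top by simp
    ultimately show False using subgroup.one_closed[OF C(1)] by auto
  qed
  then obtain c where c: "c \<in> C" "?X interior_of {c} \<noteq> {}" by blast
  then have "?X interior_of {c} = {c}" using interior_of_subset[of ?X "{c}"] by blast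
  then have "openin ?X {c}" using openin_interior_of[of ?X "{c}"] by simp
  then obtain W where W: "openin T W" "{c} = W \<inter> C" by (auto simp: openin_subtopology)
  have cc: "c \<in> carrier G" using subgroup.mem_carrier[OF C(1) c(1)] .
  have "nbhd_one {y \<in> carrier G. c \<otimes> y \<in> W}"
    using openin_lmult[OF cc W(1)] W(2) cc by (auto simp: nbhd_one_def)
  moreover have "y = \<one>" if y: "y \<in> C" "c \<otimes> y \<in> W" for y
  proof -
    have "c \<otimes> y \<in> C" using subgroup.m_closed[OF C(1) c(1) y(1)] .
    then have "c \<otimes> y = c" using W(2) y(2) by blast
    then show ?thesis using cc subgroup.mem_carrier[OF C(1) y(1)] by simp
  qed
  ultimately show ?thesis by blast
qed

end

section \<open>Indivisibility, independent elements and intersections with other monothetic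
  groups\<close>

context compact_monothetic
begin

text \<open>Divisibility by all primes gives divisibility by all positive integers. A nontrivial
  closed subgroup contains some \<open>x [^] n\<close>, hence all \<open>n\<close>-th powers of
  \<open>K\<close>, hence \<open>K\<close>; thus the contraction argument for simple
  \<open>K\<close> applies.\<close>

lemma exists_prime_not_divisible: "\<exists>p. prime p \<and> powers p K \<noteq> K"
proof (rule ccontr)
  assume no: "\<not> ?thesis"
  have all: "n > 0 \<Longrightarrow> powers n K = K" for n
  proof (induction n rule: less_induct)
    case (less n)
    show ?case
    proof (cases "n = 1")
      case True
      have "powers n K = id ` K" using K_carrier by (intro image_cong) (auto simp: True)
      then show ?thesis by simp
    next
      case False
      then obtain p m where p: "prime p" "n = p * m" using prime_factor_nat[of n] by auto
      have "m < n" "m > 0" using p less.prems prime_gt_1_nat[OF p(1)] by auto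
      then have m: "powers m K = K" using less.IH by blast
      have "powers n K = powers m (powers p K)"
        unfolding image_image p(2) using K_carrier by (intro image_cong) (auto simp: nat_pow_pow)
      then show ?thesis using no p(1) m by simp
    qed
  qed
  interpret compact_simple_divisible G T x
  proof unfold_locales
    show "powers 2 K = K" using all by simp
    fix N assume N: "subgroup N G" "closedin T N" "N \<subseteq> K" "N \<noteq> {\<one>}"
    obtain n :: nat where n: "n > 0" "x [^] n \<in> N"
      using closed_subgroup_meets[OF infinite_order N] by blast
    have "powers n K \<subseteq> N" using powers_subset[OF x_carrier N(1,2) n(2)] .
    then show "N = K" using all[OF n(1)] N(3) by simp
  qed
  show False by (rule contradiction)
qed

lemma uncountable_K: "uncountable K"
proof
  assume "countable K"
  moreover have "locally_compact_space (subtopology T K)"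
    using compact by (intro compact_imp_locally_compact_space) (simp add: compact_space_subtopology)
  ultimately obtain V where V: "nbhd_one V" "K \<inter> V \<subseteq> {\<one>}"
    using countable_closed_subgroup_discrete[OF subgroup_K closed_K] by blast
  obtain k :: nat where "k > 0" "x [^] k \<in> V" using recurrent[OF infinite_order V(1), of 0] by blast
  then show False using V(2) K_pow[OF x_in_K] infinite_order unfolding infinite_order_def by blast
qed

lemma countable_cyc: "countable (cyc y)"
  unfolding cyc_def by (rule countable_image) simp

text \<open>For fixed \<open>n\<close>, taking \<open>n\<close>-th powers is injective on
  \<open>K\<close>, so only countably many elements have their \<open>n\<close>-th power in the
  countable group \<open>cyc x\<close>. The union over positive \<open>n\<close> cannot exhaust the
  uncountable \<open>K\<close>.\<close>

lemma independent_element: "\<exists>a\<in>K. \<forall>j::int. j \<noteq> 0 \<longrightarrow> a [^] j \<notin> cyc x"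
proof (rule ccontr)
  assume no: "\<not> ?thesis"
  let ?S = "\<lambda>n. {a \<in> K. a [^] (n::nat) \<in> cyc x}"
  have "K \<subseteq> (\<Union>n\<in>{0<..}. ?S n)"
  proof
    fix a assume a: "a \<in> K"
    then obtain j :: int where j: "j \<noteq> 0" "a [^] j \<in> cyc x" using no by blast
    have "a [^] nat \<bar>j\<bar> \<in> cyc x"
    proof (cases j rule: int_cases2)
      case (nonneg n)
      then show ?thesis using j by (simp add: int_pow_int)
    next
      case (nonpos n)
      then show ?thesis
        using subgroup.m_inv_closed[OF cyc_subgroup[OF x_carrier] j(2)] K_carrier[OF a]
        by (simp add: int_pow_neg_int)
    qed
    then show "a \<in> (\<Union>n\<in>{0<..}. ?S n)" using a j(1) by (intro UN_I[of "nat \<bar>j\<bar>"]) auto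
  qed
  moreover have "countable (?S n)" if n: "n > 0" for n
  proof (rule countable_image_inj_on)
    show "inj_on (\<lambda>a. a [^] n) (?S n)" by (rule inj_onI) (use K_pow_inj n in auto)
    show "countable ((\<lambda>a. a [^] n) ` ?S n)"
      by (rule countable_subset[OF _ countable_cyc[of x]]) auto
  qed
  then have "countable (\<Union>n\<in>{0<..}. ?S n)" by (intro countable_UN) auto
  ultimately show False using uncountable_K countable_subset by blast
qed

lemma commuting_meets:
  assumes g: "g \<in> carrier G" "g \<otimes> x = x \<otimes> g" and int: "K \<inter> cyclic_closure g \<subseteq> {\<one>}"
  shows "g = \<one>"
proof -
  let ?L = "cyclic_closure g"
  have abL: "abelian_subgroup ?L" using abelian_cyclic_closure[OF g(1)] .
  have L: "subgroup ?L G" using abL by (simp add: abelian_subgroup_def)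
  obtain a where a: "a \<in> K" "\<And>j::int. j \<noteq> 0 \<Longrightarrow> a [^] j \<notin> cyc x" using independent_element by blast
  have ac: "a \<in> carrier G" using K_carrier a(1) .
  have ax: "a \<otimes> x = x \<otimes> a" using comm_K a(1) x_in_K by blast
  have gxi: "x [^] (i::int) \<otimes> g = g \<otimes> x [^] i" for i
    using int_pow_commute[OF x_carrier g(1) g(2)[symmetric]] .
  have ga: "a \<otimes> g = g \<otimes> a"
    by (rule closure_commute[OF _ g(1) _ a(1)])
      (use gxi subgroup.subset[OF cyc_subgroup[OF x_carrier]] in \<open>auto simp: cyc_def\<close>)
  let ?b = "a \<otimes> g"
  have bc: "?b \<in> carrier G" using ac g by simp
  have bx: "?b \<otimes> x = x \<otimes> ?b"
    using ac g x_carrier ax by (metis m_assoc)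
  define H where "H = {a \<otimes> ?b [^] (i::int) | a i. a \<in> cyc x}"
  have comm_cyc: "s \<otimes> t = t \<otimes> s" if "s \<in> cyc x" "t \<in> cyc x" for s t
    using abelian_cyc[OF x_carrier] that unfolding abelian_subgroup_def by blast
  have b_cyc: "?b \<otimes> s = s \<otimes> ?b" if "s \<in> cyc x" for s
    using that int_pow_commute[OF x_carrier bc bx[symmetric]] by (auto simp: cyc_def)
  note adj = subgroup_adjoin[OF cyc_subgroup[OF x_carrier] comm_cyc bc b_cyc, folded H_def]
  have H: "subgroup H G" and abH: "abelian_subgroup H" and xH: "x \<in> H" and bH: "?b \<in> H"
    using adj in_cyc[OF x_carrier] unfolding abelian_subgroup_def by blast+
  have clH: "subgroup (T closure_of H) G" using subgroup_closure[OF H] .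
  have sub: "H \<subseteq> T closure_of H" using closure_of_subset[of H T] subgroup.subset[OF H] by simp
  \<comment> \<open>Although \<open>g\<close> itself is not a generator of \<open>H\<close>, it is
    recovered in the closure as the product of \<open>inv a\<close> and
    \<open>a \<otimes> g\<close>.\<close>
  have "K \<subseteq> T closure_of H" using cyclic_closure_minimal[OF clH _ subsetD[OF sub xH]] by simp
  then have "inv a \<otimes> ?b \<in> T closure_of H"
    using subgroup.m_closed[OF clH subgroup.m_inv_closed[OF clH]] a(1) bH sub by blast
  then have "g \<in> T closure_of H" using ac g by (simp flip: m_assoc)
  then have LH: "?L \<subseteq> T closure_of H" using cyclic_closure_minimal[OF clH] by simp
  \<comment> \<open>Cancelling the power of \<open>g\<close> from such an element leaves an element
    of \<open>K\<close> and of \<open>?L\<close>, hence the identity. Independence of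
    \<open>a\<close> then kills both exponents.\<close>
  have "?L \<inter> H \<subseteq> {\<one>}"
  proof
    fix z assume z: "z \<in> ?L \<inter> H"
    then obtain i j where ij: "z = x [^] (i::int) \<otimes> ?b [^] (j::int)" by (auto simp: H_def cyc_def)
    have "?b [^] j = a [^] j \<otimes> g [^] j" using int_pow_mult_distrib[OF ga ac g(1)] .
    then have zz: "z = (x [^] i \<otimes> a [^] j) \<otimes> g [^] j" using ij x_carrier ac g by (simp add: m_assoc)
    have gL: "g [^] j \<in> ?L" using subgroup_int_pow_closed[OF L in_cyclic_closure[OF g(1)]] .
    have k: "x [^] i \<otimes> a [^] j \<in> K"
      using K_mult subgroup_int_pow_closed[OF subgroup_K] x_in_K a(1) by blast
    have "z \<otimes> inv (g [^] j) \<in> ?L"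
      using subgroup.m_closed[OF L] subgroup.m_inv_closed[OF L gL] z by blast
    also have "z \<otimes> inv (g [^] j) = x [^] i \<otimes> a [^] j"
      unfolding zz using x_carrier ac g by (simp add: m_assoc)
    finally have "x [^] i \<otimes> a [^] j = \<one>" using k int by blast
    then have "a [^] j = x [^] (- i)" using x_carrier ac
      by (metis int_pow_closed int_pow_neg inv_equality inv_inv inv_closed)
    then have "a [^] j \<in> cyc x" by (auto simp: cyc_def)
    then have "j = 0" using a(2) by blast
    moreover from this have "i = 0"
      using \<open>x [^] i \<otimes> a [^] j = \<one>\<close> int_pow_eq_one_infinite_order[OF infinite_order] x_carrier by simp
    ultimately show "z \<in> {\<one>}" using ij by simp
  qed
  then have "?L = {\<one>}" using essential[OF abH L _ LH] by simp
  then show ?thesis using in_cyclic_closure[OF g(1)] by simp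
qed

end

section \<open>The p-adic structure of compact monothetic subgroups\<close>

lemma padic_integers_mod:
  assumes "a \<in> carrier (padic_integers p)" "m \<le> n"
  shows "a n mod int p ^ m = a m"
  using assms(2)
proof (induction n rule: dec_induct)
  case base
  show ?case using assms(1) by (simp add: padic_integers_def)
next
  case (step n)
  have "a n mod int p ^ m = a (Suc n) mod int p ^ n mod int p ^ m"
    using assms(1) by (simp add: padic_integers_def)
  also have "\<dots> = a (Suc n) mod int p ^ m"
    using step(1) by (simp add: mod_mod_cancel le_imp_power_dvd)
  finally show ?case using step by simp
qed

lemma (in group) int_pow_nat_pow:
  "x \<in> carrier G \<Longrightarrow> (x [^] (i::int)) [^] (n::nat) = x [^] (i * int n)"
  by (metis int_pow_int int_pow_pow)

locale padic_monothetic = compact_monothetic +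
  fixes p :: nat
  assumes prime_p: "prime p" and not_divisible: "powers p K \<noteq> K"
begin

abbreviation KK :: "nat \<Rightarrow> 'a set" where "KK n \<equiv> powers (p ^ n) K"

lemma p_pos: "0 < p ^ n" "0 < p" using prime_p prime_gt_0_nat by auto

lemma subgroup_powers_K: "subgroup (powers m K) G" using subgroup_powers[OF abelian_K] .
lemma closed_powers_K: "closedin T (powers m K)" using closedin_compactin compactin_powers compact by blast
lemma powers_K_subset: "powers m K \<subseteq> K" using K_pow by blast

lemma KK_mult: "KK (m + n) = powers (p ^ m) (KK n)"
  unfolding image_image using K_carrier
  by (intro image_cong) (auto simp: nat_pow_pow power_add mult.commute)

lemma KK_antimono: "m \<le> n \<Longrightarrow> KK n \<subseteq> KK m"
  using KK_mult[of m "n - m"] image_mono[OF powers_K_subset[of "p ^ (n - m)"]] by simp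

lemma x_notin: "x \<notin> powers p K"
  using cyclic_closure_minimal[OF subgroup_powers_K closed_powers_K] powers_K_subset not_divisible by blast

lemma x_pow_in_powers: "int p dvd i" if i: "x [^] (i::int) \<in> powers p K"
proof (rule ccontr)
  assume "\<not> int p dvd i"
  then have "coprime (int p) i" using prime_p prime_imp_coprime[of "int p" i] by simp
  moreover have "x [^] int p \<in> powers p K" using x_in_K by (auto simp: int_pow_int)
  ultimately show False using coprime_int_pow_mem[OF subgroup_powers_K x_carrier _ i] x_notin by blast
qed

text \<open>One factor \<open>p\<close> is cancelled at a time: the exponent is divisible by
  \<open>p\<close>, and \<open>p\<close>-th roots in \<open>K\<close> are unique because
  \<open>K\<close> is torsion-free.\<close>

lemma x_pow_in_KK: "x [^] (i::int) \<in> KK n \<Longrightarrow> int p ^ n dvd i"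
proof (induction n arbitrary: i)
  case (Suc n)
  have "x [^] i \<in> powers p K" using Suc.prems KK_antimono[of 1 "Suc n"] by auto
  then have "int p dvd i" using x_pow_in_powers[of i] by simp
  then obtain j where j: "i = int p * j" by blast
  obtain k where k: "k \<in> K" "x [^] i = k [^] (p ^ Suc n)" using Suc.prems by blast
  have c: "k \<in> carrier G" using K_carrier k(1) .
  have "(x [^] j) [^] p = (x [^] j) [^] int p" by (simp add: int_pow_int)
  also have "\<dots> = x [^] i" using x_carrier j by (simp add: int_pow_pow mult.commute)
  also have "\<dots> = (k [^] (p ^ n)) [^] p" using k(2) c by (simp add: nat_pow_pow mult.commute)
  finally have "x [^] j = k [^] (p ^ n)"
    using K_pow_inj[OF subgroup_int_pow_closed[OF subgroup_K x_in_K] K_pow[OF k(1)]] p_pos by blast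
  then have "int p ^ n dvd j" using Suc.IH k(1) by blast
  then show ?case using j by simp
qed simp

text \<open>A power of \<open>x\<close> in the intersection has an exponent divisible by every power
  of \<open>p\<close>, hence 0. So the closed intersection meets \<open>cyc x\<close> trivially and
  \<open>essential\<close> applies.\<close>

lemma Inter_KK: "(\<Inter>n. KK n) = {\<one>}"
proof (rule essential[OF abelian_cyc[OF x_carrier]])
  show "subgroup (\<Inter>n. KK n) G" using subgroup_powers_K by (intro subgroups_Inter) auto
  show "closedin T (\<Inter>n. KK n)" using closed_powers_K by (intro closedin_INT) auto
  show "(\<Inter>n. KK n) \<subseteq> K" using powers_K_subset by blast
  show "(\<Inter>n. KK n) \<inter> cyc x \<subseteq> {\<one>}"
  proof
    fix z assume z: "z \<in> (\<Inter>n. KK n) \<inter> cyc x"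
    then obtain i :: int where i: "z = x [^] i" by (auto simp: cyc_def)
    have "int p ^ n dvd i" for n using z i x_pow_in_KK by blast
    \<comment> \<open>Using the absolute value of \<open>i\<close> as exponent produces a power of
      \<open>p\<close> exceeding that absolute value.\<close>
    then have dv: "int p ^ nat \<bar>i\<bar> dvd i" .
    have "i = 0"
    proof (rule ccontr)
      assume "i \<noteq> 0"
      then have "int p ^ nat \<bar>i\<bar> \<le> \<bar>i\<bar>" using dv dvd_imp_le_int[of i "int p ^ nat \<bar>i\<bar>"] by simp
      moreover have "nat \<bar>i\<bar> < p ^ nat \<bar>i\<bar>" by (rule power_gt_expt) (use prime_gt_1_nat[OF prime_p] in simp)
      ultimately show False by (metis abs_ge_zero int_nat_eq not_le of_nat_less_iff of_nat_power)
    qed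
    then show "z \<in> {\<one>}" using i by simp
  qed
qed

text \<open>Compactness turns the trivial intersection of the decreasing closed groups
  \<open>KK n\<close> into convergence to the identity.\<close>

lemma KK_small:
  assumes U: "nbhd_one U" shows "\<exists>n. KK n \<subseteq> U"
proof (rule ccontr)
  assume no: "\<not> ?thesis"
  have "\<exists>z. \<forall>n. z \<in> KK n \<inter> (carrier G - U)"
  proof (rule compact_nest[OF compact])
    fix n
    show "closedin T (KK n \<inter> (carrier G - U))"
      using closed_powers_K closedin_diff[OF closedin_topspace nbhd_oneD(1)[OF U]] by (intro closedin_Int) auto
    show "KK n \<inter> (carrier G - U) \<subseteq> K" using powers_K_subset by blast
    obtain z where "z \<in> KK n" "z \<notin> U" using no by blast
    moreover from this have "z \<in> carrier G" using powers_K_subset K_carrier by blast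
    ultimately show "KK n \<inter> (carrier G - U) \<noteq> {}" by blast
    show "KK n \<inter> (carrier G - U) \<subseteq> KK m \<inter> (carrier G - U)" if "m \<le> n" for m
      using KK_antimono[OF that] by blast
  qed
  then obtain z where "\<forall>n. z \<in> KK n \<inter> (carrier G - U)" ..
  then have "z \<in> (\<Inter>n. KK n)" "z \<notin> U" by auto
  then show False unfolding Inter_KK using nbhd_oneD[OF U] by simp
qed

definition coset :: "nat \<Rightarrow> int \<Rightarrow> 'a set" where
  "coset n i = {y \<in> K. inv (x [^] i) \<otimes> y \<in> KK n}"

lemma closed_coset: "closedin T (coset n i)"
proof -
  have "closedin T {y \<in> carrier G. inv (x [^] i) \<otimes> y \<in> KK n}"
    using closedin_lmult[OF _ closed_powers_K] x_carrier by simp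
  then have "closedin T (K \<inter> {y \<in> carrier G. inv (x [^] i) \<otimes> y \<in> KK n})" by (intro closedin_Int) auto
  moreover have "K \<inter> {y \<in> carrier G. inv (x [^] i) \<otimes> y \<in> KK n} = coset n i"
    using K_carrier by (auto simp: coset_def)
  ultimately show ?thesis by simp
qed

lemma x_pow_in_K: "x [^] (i::int) \<in> K" using subgroup_int_pow_closed[OF subgroup_K x_in_K] .

lemma coset_coset_dvd:
  assumes "y \<in> coset n i" "y \<in> coset n j" shows "int p ^ n dvd i - j"
proof -
  have yc: "y \<in> carrier G" using assms K_carrier by (simp add: coset_def)
  have "(inv (x [^] j) \<otimes> y) \<otimes> inv (inv (x [^] i) \<otimes> y) \<in> KK n"
    using assms unfolding coset_def
    by (simp only: mem_Collect_eq subgroup.m_closed[OF subgroup_powers_K] subgroup.m_inv_closed[OF subgroup_powers_K])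
  also have "(inv (x [^] j) \<otimes> y) \<otimes> inv (inv (x [^] i) \<otimes> y) = inv (x [^] j) \<otimes> x [^] i"
    using yc x_carrier by (simp add: inv_mult_group m_assoc) (simp flip: m_assoc)
  also have "\<dots> = x [^] (- j + i)" using x_carrier by (simp only: int_pow_mult int_pow_neg)
  finally have "int p ^ n dvd - j + i" by (rule x_pow_in_KK)
  then show ?thesis by simp
qed

lemma coset_cong:
  assumes y: "y \<in> coset n i" and ij: "int p ^ n dvd i - j" shows "y \<in> coset n j"
proof -
  have yc: "y \<in> carrier G" and yK: "y \<in> K" using y K_carrier by (auto simp: coset_def)
  obtain q where q: "i - j = int p ^ n * q" using ij by blast
  have "(x [^] q) [^] (p ^ n) = x [^] (- j + i)"
    using q by (simp add: int_pow_nat_pow[OF x_carrier] mult.commute)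
  then have "x [^] (- j + i) \<in> KK n" using x_pow_in_K by (metis imageI)
  moreover have "x [^] (- j + i) \<otimes> (inv (x [^] i) \<otimes> y) = inv (x [^] j) \<otimes> y"
  proof -
    have "x [^] (- j + i) = inv (x [^] j) \<otimes> x [^] i" using x_carrier by (simp only: int_pow_mult int_pow_neg)
    then show ?thesis using x_carrier yc by (simp add: m_assoc) (simp flip: m_assoc)
  qed
  ultimately have "inv (x [^] j) \<otimes> y \<in> KK n"
    using y subgroup.m_closed[OF subgroup_powers_K, of "x [^] (- j + i)" _ "inv (x [^] i) \<otimes> y"]
    unfolding coset_def by auto
  then show ?thesis using yK by (simp add: coset_def)
qed

lemma x_pow_in_coset: "x [^] i \<in> coset n i"
  using x_pow_in_K x_carrier subgroup.one_closed[OF subgroup_powers_K] by (simp add: coset_def)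

text \<open>The finite union of closed cosets contains \<open>cyc x\<close>, and therefore its
  closure \<open>K\<close>.\<close>

lemma in_some_coset: "y \<in> K \<Longrightarrow> \<exists>i\<in>{0..<int p ^ n}. y \<in> coset n i"
proof -
  have "cyc x \<subseteq> (\<Union>i\<in>{0..<int p ^ n}. coset n i)"
  proof
    fix z assume "z \<in> cyc x"
    then obtain j :: int where "z = x [^] j" by (auto simp: cyc_def)
    then have "z \<in> coset n (j mod int p ^ n)"
      using coset_cong[OF x_pow_in_coset[of j n], of "j mod int p ^ n"] by (simp add: minus_mod_eq_mult_div)
    moreover have "j mod int p ^ n \<in> {0..<int p ^ n}" using p_pos by simp
    ultimately show "z \<in> (\<Union>i\<in>{0..<int p ^ n}. coset n i)" by blast
  qed
  moreover have "closedin T (\<Union>i\<in>{0..<int p ^ n}. coset n i)"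
    using closed_coset by (intro closedin_Union) auto
  ultimately have "K \<subseteq> (\<Union>i\<in>{0..<int p ^ n}. coset n i)" by (rule closure_of_minimal)
  then show "y \<in> K \<Longrightarrow> \<exists>i\<in>{0..<int p ^ n}. y \<in> coset n i" by blast
qed

text \<open>The value at \<open>n\<close> is the residue modulo \<open>p ^ n\<close> of the p-adic
  logarithm of \<open>y\<close> to the base \<open>x\<close>, not a single digit of its
  expansion.\<close>

definition digits :: "'a \<Rightarrow> nat \<Rightarrow> int" where
  "digits y n = (SOME i. i \<in> {0..<int p ^ n} \<and> y \<in> coset n i)"

lemma digits: assumes "y \<in> K" shows "digits y n \<in> {0..<int p ^ n}" "y \<in> coset n (digits y n)"
  using someI_ex[of "\<lambda>i. i \<in> {0..<int p ^ n} \<and> y \<in> coset n i"] in_some_coset[OF assms, of n]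
  unfolding digits_def by blast+

lemma digits_eq: assumes "y \<in> coset n j" shows "digits y n = j mod int p ^ n"
proof -
  have y: "y \<in> K" using assms by (simp add: coset_def)
  have "digits y n mod int p ^ n = j mod int p ^ n"
    using coset_coset_dvd[OF digits(2)[OF y] assms] by (simp add: mod_eq_dvd_iff)
  then show ?thesis using digits(1)[OF y, of n] by simp
qed

lemma digits_in_carrier: assumes "y \<in> K" shows "digits y \<in> carrier (padic_integers p)"
proof -
  have "digits y (Suc n) mod int p ^ n = digits y n" for n
  proof -
    have "y \<in> coset n (digits y (Suc n))"
      using digits(2)[OF assms, of "Suc n"] KK_antimono[of n "Suc n"] by (auto simp: coset_def)
    then show ?thesis using digits_eq by simp
  qed
  then show ?thesis using digits(1)[OF assms] by (simp add: padic_integers_def)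
qed

lemma digits_mult:
  assumes "y \<in> K" "z \<in> K"
  shows "digits (y \<otimes> z) n = (digits y n + digits z n) mod int p ^ n"
proof (rule digits_eq)
  let ?i = "digits y n" and ?j = "digits z n"
  note c = assms[THEN K_carrier]
  have "(inv (x [^] ?i) \<otimes> y) \<otimes> (inv (x [^] ?j) \<otimes> z) \<in> KK n"
    using digits(2)[of y n] digits(2)[of z n] assms unfolding coset_def
    by (simp only: mem_Collect_eq subgroup.m_closed[OF subgroup_powers_K])
  also have "(inv (x [^] ?i) \<otimes> y) \<otimes> (inv (x [^] ?j) \<otimes> z) = inv (x [^] ?i) \<otimes> (y \<otimes> inv (x [^] ?j)) \<otimes> z"
    using c x_carrier by (simp add: m_assoc)
  also have "\<dots> = inv (x [^] ?i) \<otimes> (inv (x [^] ?j) \<otimes> y) \<otimes> z"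
    using comm_K[OF assms(1) K_inv[OF x_pow_in_K]] by simp
  also have "\<dots> = inv (x [^] ?j \<otimes> x [^] ?i) \<otimes> (y \<otimes> z)"
    using c x_carrier by (simp add: inv_mult_group m_assoc)
  also have "x [^] ?j \<otimes> x [^] ?i = x [^] (?i + ?j)" using x_carrier by (simp add: int_pow_mult[symmetric] add.commute)
  finally show "y \<otimes> z \<in> coset n (?i + ?j)" using K_mult assms by (simp add: coset_def)
qed

lemma digits_inj:
  assumes yz: "y \<in> K" "z \<in> K" and eq: "digits y = digits z"
  shows "y = z"
proof -
  note c = yz[THEN K_carrier]
  have "inv z \<otimes> y \<in> KK n" for n
  proof -
    let ?i = "digits y n"
    have "inv (x [^] ?i) \<otimes> y \<in> KK n" "inv (x [^] ?i) \<otimes> z \<in> KK n"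
      using digits(2)[of y n] digits(2)[of z n] yz eq by (auto simp: coset_def)
    then have "inv (inv (x [^] ?i) \<otimes> z) \<otimes> (inv (x [^] ?i) \<otimes> y) \<in> KK n"
      by (simp only: subgroup.m_closed[OF subgroup_powers_K] subgroup.m_inv_closed[OF subgroup_powers_K])
    also have "inv (inv (x [^] ?i) \<otimes> z) \<otimes> (inv (x [^] ?i) \<otimes> y) = inv z \<otimes> y"
      using c x_carrier by (simp add: inv_mult_group m_assoc) (simp flip: m_assoc)
    finally show ?thesis .
  qed
  then have "inv z \<otimes> y \<in> (\<Inter>n. KK n)" by blast
  then have "inv z \<otimes> y = \<one>" unfolding Inter_KK by simp
  then show ?thesis using c by (metis inv_equality inv_inv inv_closed)
qed

text \<open>Compatible residues describe decreasing nonempty closed cosets of \<open>K\<close>; a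
  common point, which exists by compactness, has these residues.\<close>

lemma digits_surj:
  assumes a: "a \<in> carrier (padic_integers p)"
  shows "\<exists>y\<in>K. digits y = a"
proof -
  have "\<exists>y. \<forall>n. y \<in> coset n (a n)"
  proof (rule compact_nest[OF compact])
    show "closedin T (coset n (a n))" for n by (rule closed_coset)
    show "coset n (a n) \<subseteq> K" for n by (auto simp: coset_def)
    show "coset n (a n) \<noteq> {}" for n using x_pow_in_coset by blast
    show "coset n (a n) \<subseteq> coset m (a m)" if mn: "m \<le> n" for m n
    proof
      fix y assume "y \<in> coset n (a n)"
      then have "y \<in> coset m (a n)" using KK_antimono[OF mn] by (auto simp: coset_def)
      moreover have "int p ^ m dvd a n - a m"
        using padic_integers_mod[OF a mn] by (metis dvd_minus_mod)
      ultimately show "y \<in> coset m (a m)" by (rule coset_cong)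
    qed
  qed
  then obtain y where y: "\<And>n. y \<in> coset n (a n)" by blast
  have "digits y n = a n" for n
    using digits_eq[OF y[of n]] padic_integers_mod[OF a order_refl] by simp
  then show ?thesis using y[of 0] by (intro bexI[of _ y]) (auto simp: coset_def)
qed

lemma digits_continuous: "continuous_map (subtopology T K) (padic_topology p) digits"
  unfolding continuous_map_def
proof (intro conjI allI impI)
  have top: "topspace (subtopology T K) = K" using K_carrier by auto
  have ptop: "topspace (padic_topology p) = carrier (padic_integers p)" by (simp add: padic_topology_def)
  show "digits \<in> topspace (subtopology T K) \<rightarrow> topspace (padic_topology p)"
    using digits_in_carrier top ptop by auto
  fix U assume U: "openin (padic_topology p) U"
  show "openin (subtopology T K) {y \<in> topspace (subtopology T K). digits y \<in> U}"
    unfolding top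
  proof (subst openin_subopen, intro ballI)
    fix y assume y: "y \<in> {y \<in> K. digits y \<in> U}"
    then obtain n where n: "{a \<in> carrier (padic_integers p). a n = digits y n} \<subseteq> U"
      using U unfolding openin_padic_topology by blast
    \<comment> \<open>Each coset is open in \<open>K\<close> because the finitely many other cosets
      form a closed set.\<close>
    let ?C = "\<Union>i\<in>{0..<int p ^ n} - {digits y n}. coset n i"
    have "closedin T ?C" using closed_coset by (intro closedin_Union) auto
    from openin_diff[OF openin_topspace this] have "openin T (carrier G - ?C)" by (simp only: topspace)
    then have "openin (subtopology T K) ((carrier G - ?C) \<inter> K)" by (auto simp: openin_subtopology)
    moreover have "y \<in> (carrier G - ?C) \<inter> K"
    proof -
      have "y \<notin> coset n i" if "i \<in> {0..<int p ^ n} - {digits y n}" for i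
        using digits_eq[of y n i] that by auto
      then show ?thesis using y K_carrier by auto
    qed
    moreover have "z \<in> {y \<in> K. digits y \<in> U}" if z: "z \<in> (carrier G - ?C) \<inter> K" for z
    proof -
      have "digits z n = digits y n" using digits[of z n] z by blast
      then show ?thesis using n digits_in_carrier z by blast
    qed
    ultimately show "\<exists>W. openin (subtopology T K) W \<and> y \<in> W \<and> W \<subseteq> {y \<in> K. digits y \<in> U}" by blast
  qed
qed

lemma isomorphic_padic_integers:
  assumes "K = carrier G"
  shows "topological_group_isomorphic G T (padic_integers p) (padic_topology p)"
proof -
  have T: "subtopology T K = T" using assms subtopology_topspace[of T] by simp
  have "digits \<in> hom G (padic_integers p)"
    using digits_in_carrier digits_mult assms by (intro homI) (auto simp: padic_integers_def)
  moreover have bij: "bij_betw digits (carrier G) (carrier (padic_integers p))"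
    unfolding bij_betw_def
  proof (intro conjI inj_onI)
    show "digits ` carrier G = carrier (padic_integers p)"
      using digits_in_carrier digits_surj unfolding assms by blast
  qed (use digits_inj assms in auto)
  ultimately have "digits \<in> iso G (padic_integers p)" by (rule isoI)
  moreover have "homeomorphic_map T (padic_topology p) digits"
  proof (rule continuous_imp_homeomorphic_map)
    show "continuous_map T (padic_topology p) digits" using digits_continuous T by simp
    show "compact_space T" using compact assms by (simp add: compact_space_def)
    show "Hausdorff_space (padic_topology p)"
      unfolding padic_topology_def
      by (intro Hausdorff_space_subtopology) (simp add: Hausdorff_space_product_topology)
    show "digits ` topspace T = topspace (padic_topology p)" "inj_on digits (topspace T)"
      using bij by (auto simp: bij_betw_def padic_topology_def)
  qed
  ultimately show ?thesis unfolding topological_group_isomorphic_def by blast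
qed

text \<open>Modulo every \<open>p ^ n\<close> the exponent \<open>q\<close> is invertible, so the
  \<open>q\<close>-th powers are dense in \<open>K\<close>; they are also closed.\<close>

lemma powers_coprime: assumes q: "coprime q p" shows "powers q K = K"
proof
  show "K \<subseteq> powers q K"
  proof
    fix k assume k: "k \<in> K"
    have kc: "k \<in> carrier G" using K_carrier k .
    have "k \<in> T closure_of (powers q K)"
      unfolding in_closure[OF subgroup.subset[OF subgroup_powers_K]]
    proof (intro conjI allI impI)
      fix U assume "nbhd_one U"
      then obtain n where n: "KK n \<subseteq> U" using KK_small by blast
      have "coprime (int q) (int (p ^ n))" using q by simp
      then obtain u v where uv: "u * int q + v * int (p ^ n) = 1"
        using bezout_int[of "int q" "int (p ^ n)"] by auto
      have kp: "(k [^] i) [^] m = k [^] (i * int m)" for i :: int and m :: nat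
        using int_pow_pow[OF kc, of i "int m"] by (simp add: int_pow_int)
      have kK: "k [^] (i::int) \<in> K" for i using subgroup_int_pow_closed[OF subgroup_K k] .
      have "k [^] (- 1 + u * int q) = inv k \<otimes> (k [^] u) [^] q"
        unfolding kp int_pow_mult[OF kc] using kc by (simp add: int_pow_neg)
      moreover have "- 1 + u * int q = (- v) * int (p ^ n)" using uv by simp
      then have "k [^] (- 1 + u * int q) = (k [^] (- v)) [^] (p ^ n)" unfolding kp by simp
      ultimately have "inv k \<otimes> (k [^] u) [^] q \<in> U" using n kK by auto
      then show "\<exists>s\<in>powers q K. inv k \<otimes> s \<in> U" using kK by blast
    qed (rule kc)
    then show "k \<in> powers q K" using closure_of_closedin[OF closed_powers_K] by simp
  qed
qed (rule powers_K_subset)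

text \<open>An argument as in Nakayama's lemma: \<open>y\<close> generates \<open>K\<close> modulo
  the \<open>p\<close>-th powers, and substituting this decomposition into itself shows that it
  generates \<open>K\<close> modulo \<open>KK n\<close> for all \<open>n\<close>. Thus its closed
  subgroup is dense in \<open>K\<close>.\<close>

lemma generator:
  assumes y: "y \<in> K" "y \<notin> powers p K"
  shows "K \<subseteq> cyclic_closure y"
proof -
  have yc: "y \<in> carrier G" using K_carrier y(1) .
  let ?N = "cyclic_closure y"
  have N: "subgroup ?N G" using abelian_cyclic_closure[OF yc] by (simp add: abelian_subgroup_def)
  have NK: "?N \<subseteq> K" using cyclic_closure_minimal[OF subgroup_K closed_K y(1)] .
  have yN: "y \<in> ?N" using in_cyclic_closure[OF yc] .
  obtain i where i: "i \<in> {0..<int p ^ 1}" "y \<in> coset 1 i" using in_some_coset[OF y(1)] by blast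
  obtain k where k: "k \<in> K" "inv (x [^] i) \<otimes> y = k [^] p" using i(2) by (auto simp: coset_def)
  have kc: "k \<in> carrier G" using K_carrier k(1) .
  have xi: "x [^] i \<otimes> k [^] p = y" unfolding k(2)[symmetric] using x_carrier yc by (simp flip: m_assoc)
  \<comment> \<open>The residue of \<open>y\<close> modulo \<open>p\<close> is a unit, since
    otherwise \<open>y\<close> would be a \<open>p\<close>-th power. Bezout then recovers
    \<open>x\<close> from \<open>x [^] i\<close> and \<open>x [^] p\<close>.\<close>
  have "i \<noteq> 0" using xi y(2) k(1) kc by auto
  then have "\<not> int p dvd i" using i(1) zdvd_not_zless[of i "int p"] by auto
  then have "coprime i (int p)"
    using prime_imp_coprime[of "int p" i] prime_p by (simp add: coprime_commute)
  define M where "M = (\<Union>s\<in>?N. \<Union>t\<in>powers p K. {s \<otimes> t})"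
  have M: "subgroup M G"
    using incl_subgroup[OF subgroup_K comm_group.mult_subgroups[OF comm_group_abelian[OF abelian_K]
        subgroup_incl[OF N subgroup_K NK] subgroup_incl[OF subgroup_powers_K subgroup_K powers_K_subset]]]
    by (simp add: set_mult_def M_def)
  have MI: "s \<otimes> t \<in> M" if "s \<in> ?N" "t \<in> powers p K" for s t unfolding M_def using that by blast
  have NM: "s \<in> M" if "s \<in> ?N" for s
    using MI[OF that subgroup.one_closed[OF subgroup_powers_K]] subgroup.mem_carrier[OF N that] by simp
  have PM: "t \<in> M" if "t \<in> powers p K" for t
    using MI[OF subgroup.one_closed[OF N] that] subgroup.mem_carrier[OF subgroup_powers_K that] by simp
  have "y \<otimes> inv (k [^] p) \<in> M"
    using subgroup.m_closed[OF M NM[OF yN] PM] subgroup.m_inv_closed[OF subgroup_powers_K imageI[OF k(1)]] .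
  then have "x [^] i \<in> M" unfolding xi[symmetric] using x_carrier kc by (simp add: m_assoc)
  moreover have "x [^] int p \<in> M" using PM[OF imageI[OF x_in_K]] by (simp add: int_pow_int)
  ultimately have xM: "x \<in> M" using coprime_int_pow_mem[OF M x_carrier _ _ \<open>coprime i (int p)\<close>] by simp
  have step1: "\<exists>s\<in>?N. \<exists>l\<in>K. z = s \<otimes> l [^] p" if z: "z \<in> K" for z
  proof -
    obtain j where "z \<in> coset 1 j" using in_some_coset[OF z] by blast
    then have m: "inv (x [^] j) \<otimes> z \<in> powers p K" by (simp add: coset_def)
    have "x [^] j \<otimes> (inv (x [^] j) \<otimes> z) \<in> M"
      using subgroup.m_closed[OF M subgroup_int_pow_closed[OF M xM] PM[OF m]] .
    then have "z \<in> M" using x_carrier K_carrier[OF z] by (simp flip: m_assoc)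
    then show ?thesis unfolding M_def by blast
  qed
  have step: "\<exists>s\<in>?N. \<exists>m\<in>K. z = s \<otimes> m [^] (p ^ n)" if "z \<in> K" for n z
    using that
  proof (induction n arbitrary: z)
    case 0
    then show ?case using subgroup.one_closed[OF N] K_carrier by (intro bexI[of _ \<one>] bexI[of _ z]) auto
  next
    case (Suc n)
    obtain s l where s: "s \<in> ?N" "l \<in> K" "z = s \<otimes> l [^] p" using step1[OF Suc.prems] by blast
    obtain t m where t: "t \<in> ?N" "m \<in> K" "l = t \<otimes> m [^] (p ^ n)" using Suc.IH[OF s(2)] by blast
    have tK: "t \<in> K" using t(1) NK by blast
    have "l [^] p = t [^] p \<otimes> (m [^] (p ^ n)) [^] p" unfolding t(3) using K_pow_mult[OF tK K_pow[OF t(2)]] .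
    also have "(m [^] (p ^ n)) [^] p = m [^] (p ^ Suc n)" using K_carrier[OF t(2)] by (simp add: nat_pow_pow mult.commute)
    finally have "z = (s \<otimes> t [^] p) \<otimes> m [^] (p ^ Suc n)"
      using s K_carrier tK t(2) NK by (simp add: m_assoc subset_iff)
    moreover have "s \<otimes> t [^] p \<in> ?N" using subgroup.m_closed[OF N s(1) subgroup_nat_pow_closed[OF N t(1)]] .
    ultimately show ?case using t(2) by blast
  qed
  show ?thesis
  proof
    fix z assume z: "z \<in> K"
    have zc: "z \<in> carrier G" using K_carrier z .
    have "z \<in> T closure_of ?N"
      unfolding in_closure[OF subgroup.subset[OF N]]
    proof (intro conjI allI impI)
      fix U assume "nbhd_one U"
      then obtain n where n: "KK n \<subseteq> U" using KK_small by blast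
      obtain s m where s: "s \<in> ?N" "m \<in> K" "z = s \<otimes> m [^] (p ^ n)" using step[OF z] by blast
      have sc: "s \<in> carrier G" using NK s(1) K_carrier by blast
      have "inv z \<otimes> s = inv (m [^] (p ^ n))"
        unfolding s(3) using sc K_carrier[OF s(2)] by (simp add: inv_mult_group m_assoc)
      also have "\<dots> \<in> KK n" using subgroup.m_inv_closed[OF subgroup_powers_K] s(2) by blast
      finally show "\<exists>s\<in>?N. inv z \<otimes> s \<in> U" using n s(1) by blast
    qed (rule zc)
    then show "z \<in> ?N" by simp
  qed
qed

end

section \<open>Hypercentral groups\<close>

lemma center_modulo_commute:
  fixes G (structure)
  assumes "N \<lhd> G" and x: "x \<in> center_modulo G N" and y: "y \<in> carrier G"
  shows "x \<in> carrier G" "y \<otimes> x \<otimes> inv (x \<otimes> y) \<in> N"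
proof -
  interpret normal N G by fact
  show xc: "x \<in> carrier G" using x by (simp add: center_modulo_def)
  have "(N #> y) <#> (N #> x) = (N #> x) <#> (N #> y)"
    using x y unfolding center_modulo_def group_center_def FactGroup_def RCOSETS_def by auto
  then have "N #> (y \<otimes> x) = N #> (x \<otimes> y)" using xc y by (simp add: rcos_sum)
  moreover have "y \<otimes> x \<in> N #> (y \<otimes> x)" using xc y by (intro rcos_self subgroup_axioms) auto
  ultimately have "y \<otimes> x \<in> N #> (x \<otimes> y)" by simp
  then obtain n where n: "n \<in> N" "y \<otimes> x = n \<otimes> (x \<otimes> y)" by (auto simp: r_coset_def)
  have "n \<in> carrier G" using n(1) subset by blast
  then have "y \<otimes> x \<otimes> inv (x \<otimes> y) = n" unfolding n(2) using xc y by (simp add: m_assoc)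
  then show "y \<otimes> x \<otimes> inv (x \<otimes> y) \<in> N" using n(1) by simp
qed

text \<open>Take the first term of the upper central series that meets \<open>C\<close> outside
  \<open>A\<close>; its index is a successor. Commutators of such an element \<open>c\<close> lie in
  \<open>C\<close> by normality and in the preceding term, hence in \<open>A\<close>.\<close>

lemma hypercentral_relative_center:
  fixes G (structure)
  assumes hyp: "hypercentral G" and A: "subgroup A G" and C: "C \<lhd> G" "\<not> C \<subseteq> A"
  shows "\<exists>c\<in>C - A. \<forall>g\<in>carrier G. g \<otimes> c \<otimes> inv (c \<otimes> g) \<in> A"
proof -
  interpret C: normal C G by fact
  obtain r :: "'a set rel" and \<alpha> where r: "Well_order r" "\<alpha> \<in> Field r"
    "upper_central_series G r \<alpha> = carrier G" using hyp unfolding hypercentral_def by blast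
  interpret wo: wo_rel r using r by (simp add: wo_rel_def)
  let ?Z = "upper_central_series G r"
  let ?S = "{\<beta> \<in> Field r. \<not> ?Z \<beta> \<inter> C \<subseteq> A}"
  define \<mu> where "\<mu> = wo.minim ?S"
  have "\<not> ?Z \<alpha> \<inter> C \<subseteq> A" using C(2) C.subset r(3) by auto
  then have ne: "?S \<noteq> {}" "?S \<subseteq> Field r" using r(2) by auto
  then have \<mu>: "\<mu> \<in> ?S" unfolding \<mu>_def using wo.minim_in by blast
  have below: "?Z \<beta> \<inter> C \<subseteq> A" if b: "\<beta> \<in> underS r \<mu>" for \<beta>
  proof (rule ccontr)
    assume "\<not> ?Z \<beta> \<inter> C \<subseteq> A"
    then have "\<beta> \<in> ?S" using b by (auto simp: underS_def Field_def)
    then have "(\<mu>, \<beta>) \<in> r" unfolding \<mu>_def using wo.minim_least[OF ne(2)] by blast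
    then show False using b wo.ANTISYM by (auto simp: underS_def antisym_def)
  qed
  obtain c where c: "c \<in> ?Z \<mu>" "c \<in> C" "c \<notin> A" using \<mu> by blast
  consider "underS r \<mu> = {}"
    | \<beta> where "\<beta> \<in> underS r \<mu>" "underS r \<mu> = under r \<beta>"
    | "underS r \<mu> \<noteq> {}" "\<And>\<beta>. \<beta> \<in> underS r \<mu> \<Longrightarrow> underS r \<mu> \<noteq> under r \<beta>"
    by blast
  then show ?thesis
  proof cases
    case 1
    then show ?thesis
      using upper_central_series_zero[OF r(1) 1, of G] c subgroup.one_closed[OF A] by simp
  next
    case (2 \<beta>)
    have "\<beta> \<in> Field r" using 2(1) by (auto simp: underS_def Field_def)
    then have norm: "?Z \<beta> \<lhd> G"
      using upper_central_series_normal_mono[OF C.is_group r(1)] by blast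
    have cm: "c \<in> center_modulo G (?Z \<beta>)" using upper_central_series_succ[OF r(1) 2, of G] c(1) by simp
    have "g \<otimes> c \<otimes> inv (c \<otimes> g) \<in> A" if g: "g \<in> carrier G" for g
    proof -
      have cc: "c \<in> carrier G" using c(2) C.subset by blast
      have "g \<otimes> c \<otimes> inv (c \<otimes> g) = (g \<otimes> c \<otimes> inv g) \<otimes> inv c"
        using g cc by (simp add: C.inv_mult_group C.m_assoc)
      moreover have "g \<otimes> c \<otimes> inv g \<in> C" using C.inv_op_closed2[OF g c(2)] .
      ultimately have "g \<otimes> c \<otimes> inv (c \<otimes> g) \<in> C" using c(2) by simp
      then show ?thesis using center_modulo_commute(2)[OF norm cm g] below[OF 2(1)] by blast
    qed
    then show ?thesis using c by blast
  next
    case 3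
    have "?Z \<mu> = (\<Union>\<beta>\<in>underS r \<mu>. ?Z \<beta>)" using 3 by (rule upper_central_series_limit[OF r(1)])
    then have "c \<in> (\<Union>\<beta>\<in>underS r \<mu>. ?Z \<beta>)" using c(1) by simp
    then obtain \<beta> where "\<beta> \<in> underS r \<mu>" "c \<in> ?Z \<beta>" by (rule UN_E)
    then have "c \<in> A" using below[of \<beta>] c(2) by blast
    then show ?thesis using c(3) by contradiction
  qed
qed

context group
begin

lemma inv_commute:
  "a \<in> carrier G \<Longrightarrow> b \<in> carrier G \<Longrightarrow> a \<otimes> b = b \<otimes> a \<Longrightarrow> inv a \<otimes> b = b \<otimes> inv a"
  using int_pow_commute[of a b "-1"] by (simp add: int_pow_neg)

lemma centralizer_normal:
  assumes "A \<lhd> G"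
  shows "{c \<in> carrier G. \<forall>a\<in>A. c \<otimes> a = a \<otimes> c} \<lhd> G"
proof -
  interpret A: normal A G by fact
  have AG: "a \<in> carrier G" if "a \<in> A" for a using that A.subset by blast
  let ?C = "{c \<in> carrier G. \<forall>a\<in>A. c \<otimes> a = a \<otimes> c}"
  have sg: "subgroup ?C G"
  proof (rule subgroupI)
    show "?C \<noteq> {}" using AG by (auto intro!: exI[of _ \<one>])
    fix c assume c: "c \<in> ?C"
    have "inv c \<otimes> a = a \<otimes> inv c" if a: "a \<in> A" for a
      using c a AG[OF a] by (intro inv_commute) auto
    then show "inv c \<in> ?C" using c by simp
    fix d assume d: "d \<in> ?C"
    have "c \<otimes> d \<otimes> a = a \<otimes> (c \<otimes> d)" if a: "a \<in> A" for a
    proof -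
      have "c \<otimes> d \<otimes> a = c \<otimes> (a \<otimes> d)" using c d a AG[OF a] by (simp add: m_assoc)
      also have "\<dots> = (c \<otimes> a) \<otimes> d" using c d AG[OF a] by (simp add: m_assoc)
      also have "\<dots> = (a \<otimes> c) \<otimes> d" using c a by simp
      finally show ?thesis using c d AG[OF a] by (simp add: m_assoc)
    qed
    then show "c \<otimes> d \<in> ?C" using c d by simp
  qed auto
  have conj: "g \<otimes> c \<otimes> inv g \<in> ?C" if g: "g \<in> carrier G" and c: "c \<in> ?C" for g c
  proof -
    have "g \<otimes> c \<otimes> inv g \<otimes> a = a \<otimes> (g \<otimes> c \<otimes> inv g)" if a: "a \<in> A" for a
    proof -
      let ?b = "inv g \<otimes> a \<otimes> g"
      have b: "?b \<in> A" using A.inv_op_closed1[OF g a] .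
      have "g \<otimes> c \<otimes> inv g \<otimes> a = g \<otimes> (c \<otimes> ?b) \<otimes> inv g" using g c AG[OF a] by (simp add: m_assoc)
      also have "c \<otimes> ?b = ?b \<otimes> c" using b c by blast
      also have "g \<otimes> (?b \<otimes> c) \<otimes> inv g = a \<otimes> (g \<otimes> c \<otimes> inv g)"
        using g c AG[OF a] by (simp add: m_assoc) (simp flip: m_assoc)
      finally show ?thesis .
    qed
    then show ?thesis using g c by simp
  qed
  show "?C \<lhd> G" by (intro iffD2[OF normal_inv_iff] conjI ballI sg conj)
qed

lemma group_center_normal: "group_center G \<lhd> G"
proof -
  have "group_center G = {c \<in> carrier G. \<forall>a\<in>carrier G. c \<otimes> a = a \<otimes> c}"
    by (auto simp: group_center_def)
  then show ?thesis using centralizer_normal[OF normal_self] by simp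
qed

lemma hypercentral_center_nontrivial:
  assumes "hypercentral G" "carrier G \<noteq> {\<one>}"
  shows "\<exists>c\<in>group_center G. c \<noteq> \<one>"
proof -
  have "\<not> carrier G \<subseteq> {\<one>}" using assms(2) by auto
  then obtain c where c: "c \<in> carrier G - {\<one>}" "\<forall>g\<in>carrier G. g \<otimes> c \<otimes> inv (c \<otimes> g) \<in> {\<one>}"
    using hypercentral_relative_center[OF assms(1) triv_subgroup normal_self] by blast
  have "g \<otimes> c = c \<otimes> g" if g: "g \<in> carrier G" for g
  proof -
    have "g \<otimes> c \<otimes> inv (c \<otimes> g) = \<one>" using c g by blast
    then show ?thesis using c(1) g by (metis DiffD1 inv_equality inv_inv m_closed inv_closed)
  qed
  then show ?thesis using c by (auto simp: group_center_def)
qed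

text \<open>Otherwise some noncentral \<open>c\<close> has only central commutators. For such a
  commutator \<open>z\<close>, moving \<open>g\<close> past \<open>c [^] n\<close> produces
  \<open>z [^] n\<close>. Since a positive power of \<open>c\<close> is central, \<open>z\<close> is
  torsion, hence trivial, and \<open>c\<close> is central after all.\<close>

lemma hypercentral_abelian:
  assumes hyp: "hypercentral G"
    and tf: "\<And>g. g \<in> carrier G \<Longrightarrow> g \<noteq> \<one> \<Longrightarrow> infinite_order g"
    and pow: "\<And>g. g \<in> carrier G \<Longrightarrow> \<exists>m::nat>0. g [^] m \<in> group_center G"
  shows "carrier G \<subseteq> group_center G"
proof (rule ccontr)
  assume no: "\<not> carrier G \<subseteq> group_center G"
  have "subgroup (group_center G) G" using group_center_normal by (simp add: normal_def)
  from hypercentral_relative_center[OF hyp this normal_self no]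
  obtain c where c: "c \<in> carrier G" "c \<notin> group_center G"
    "\<forall>g\<in>carrier G. g \<otimes> c \<otimes> inv (c \<otimes> g) \<in> group_center G" by blast
  obtain m :: nat where m: "m > 0" "c [^] m \<in> group_center G" using pow c(1) by blast
  have "g \<otimes> c = c \<otimes> g" if g: "g \<in> carrier G" for g
  proof -
    define z where "z = g \<otimes> c \<otimes> inv (c \<otimes> g)"
    have z: "z \<in> carrier G" "\<And>y. y \<in> carrier G \<Longrightarrow> y \<otimes> z = z \<otimes> y"
      using c(3) g unfolding z_def by (auto simp: group_center_def)
    have gc: "g \<otimes> c = z \<otimes> c \<otimes> g" unfolding z_def using g c(1) by (simp add: m_assoc)
    have "g \<otimes> c [^] n = z [^] n \<otimes> c [^] n \<otimes> g" for n :: nat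
    proof (induction n)
      case (Suc n)
      have "g \<otimes> c [^] Suc n = (g \<otimes> c [^] n) \<otimes> c" using g c(1) by (simp add: m_assoc)
      also have "\<dots> = z [^] n \<otimes> c [^] n \<otimes> (g \<otimes> c)" unfolding Suc using g c(1) z(1) by (simp add: m_assoc)
      also have "\<dots> = z [^] n \<otimes> (c [^] n \<otimes> z) \<otimes> c \<otimes> g" unfolding gc using g c(1) z(1) by (simp add: m_assoc)
      also have "\<dots> = z [^] n \<otimes> (z \<otimes> c [^] n) \<otimes> c \<otimes> g" using z(2)[of "c [^] n"] c(1) by simp
      finally show ?case using g c(1) z(1) by (simp add: m_assoc)
    qed (use g in simp)
    then have "g \<otimes> c [^] m = z [^] m \<otimes> c [^] m \<otimes> g" .
    moreover have "g \<otimes> c [^] m = c [^] m \<otimes> g" using m(2) g by (simp add: group_center_def)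
    ultimately have "z [^] m \<otimes> (c [^] m \<otimes> g) = c [^] m \<otimes> g" using g c(1) z(1) by (simp add: m_assoc)
    then have "z [^] m = \<one>" using g c(1) z(1) by simp
    then have "z = \<one>" using tf[OF z(1)] m(1) by (auto simp: infinite_order_def)
    then show ?thesis using gc g c(1) by simp
  qed
  then show False using c(1,2) by (simp add: group_center_def)
qed

text \<open>Zorn's lemma gives a maximal abelian normal \<open>A\<close>. If its centralizer were
  larger, it would contain some \<open>c\<close> outside \<open>A\<close> with all commutators in
  \<open>A\<close>; adjoining \<open>c\<close> would keep the subgroup abelian and normal.\<close>

lemma maximal_abelian_normal:
  assumes hyp: "hypercentral G"
  shows "\<exists>A. A \<lhd> G \<and> (\<forall>a\<in>A. \<forall>b\<in>A. a \<otimes> b = b \<otimes> a) \<and>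
    (\<forall>c\<in>carrier G. (\<forall>a\<in>A. c \<otimes> a = a \<otimes> c) \<longrightarrow> c \<in> A)"
proof -
  let ?S = "{A. A \<lhd> G \<and> (\<forall>a\<in>A. \<forall>b\<in>A. a \<otimes> b = b \<otimes> a)}"
  have "\<exists>M\<in>?S. \<forall>X\<in>?S. M \<subseteq> X \<longrightarrow> X = M"
  proof (rule subset_Zorn_nonempty)
    have "{\<one>} \<in> ?S" using one_is_normal by simp
    then show "?S \<noteq> {}" by blast
    fix \<C> assume C: "\<C> \<noteq> {}" "subset.chain ?S \<C>"
    have norm: "A \<lhd> G" if "A \<in> \<C>" for A using C(2) that unfolding subset_chain_def by blast
    have sg: "subgroup A G" if "A \<in> \<C>" for A using norm[OF that] by (simp add: normal_def)
    have comm: "a \<otimes> b = b \<otimes> a" if "A \<in> \<C>" "a \<in> A" "b \<in> A" for A a b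
      using C(2) that unfolding subset_chain_def by blast
    have two: "\<exists>A\<in>\<C>. a \<in> A \<and> b \<in> A" if ab: "a \<in> \<Union>\<C>" "b \<in> \<Union>\<C>" for a b
    proof -
      obtain A B where AB: "A \<in> \<C>" "a \<in> A" "B \<in> \<C>" "b \<in> B" using ab by blast
      then have "A \<subseteq> B \<or> B \<subseteq> A" using C(2) unfolding subset_chain_def by blast
      then show ?thesis using AB by blast
    qed
    have "subgroup (\<Union>\<C>) G"
    proof (rule subgroupI)
      show "\<Union>\<C> \<subseteq> carrier G" using sg subgroup.subset by blast
      obtain A where "A \<in> \<C>" using C(1) by blast
      then show "\<Union>\<C> \<noteq> {}" using subgroup.one_closed[OF sg] by blast
      show "inv a \<in> \<Union>\<C>" if "a \<in> \<Union>\<C>" for a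
        using that subgroup.m_inv_closed[OF sg] by (meson UnionE UnionI)
      show "a \<otimes> b \<in> \<Union>\<C>" if ab: "a \<in> \<Union>\<C>" "b \<in> \<Union>\<C>" for a b
        using two[OF ab] subgroup.m_closed[OF sg] by (meson UnionI)
    qed
    moreover have "g \<otimes> a \<otimes> inv g \<in> \<Union>\<C>" if "g \<in> carrier G" "a \<in> \<Union>\<C>" for g a
      using that normal.inv_op_closed2[OF norm] by (meson UnionE UnionI)
    ultimately have "\<Union>\<C> \<lhd> G" by (intro iffD2[OF normal_inv_iff] conjI ballI)
    moreover have "\<forall>a\<in>\<Union>\<C>. \<forall>b\<in>\<Union>\<C>. a \<otimes> b = b \<otimes> a" using two comm by metis
    ultimately show "\<Union>\<C> \<in> ?S" by blast
  qed
  then obtain A where A: "A \<lhd> G" "\<And>a b. a \<in> A \<Longrightarrow> b \<in> A \<Longrightarrow> a \<otimes> b = b \<otimes> a"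
    and max: "\<forall>X\<in>?S. A \<subseteq> X \<longrightarrow> X = A" by blast
  interpret A: normal A G by (rule A(1))
  have AG: "a \<in> carrier G" if "a \<in> A" for a using that A.subset by blast
  let ?C = "{c \<in> carrier G. \<forall>a\<in>A. c \<otimes> a = a \<otimes> c}"
  have "?C \<subseteq> A"
  proof (rule ccontr)
    assume no: "\<not> ?C \<subseteq> A"
    from hypercentral_relative_center[OF hyp A.subgroup_axioms centralizer_normal[OF A(1)] no]
    obtain c where c: "c \<in> carrier G" "\<And>a. a \<in> A \<Longrightarrow> c \<otimes> a = a \<otimes> c" "c \<notin> A"
      "\<And>g. g \<in> carrier G \<Longrightarrow> g \<otimes> c \<otimes> inv (c \<otimes> g) \<in> A" by blast
    let ?B = "{a \<otimes> c [^] (i::int) | a i. a \<in> A}"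
    have BI: "a \<otimes> c [^] (i::int) \<in> ?B" if "a \<in> A" for a i using that by blast
    have BE: "\<exists>a i. u = a \<otimes> c [^] (i::int) \<and> a \<in> A" if "u \<in> ?B" for u using that by blast
    note adj = subgroup_adjoin[OF A.subgroup_axioms A(2) c(1,2)]
    have conjB: "g \<otimes> u \<otimes> inv g \<in> ?B" if g: "g \<in> carrier G" and u: "u \<in> ?B" for g u
    proof -
      obtain a i where u: "u = a \<otimes> c [^] (i::int)" "a \<in> A" using BE[OF u] by blast
      \<comment> \<open>Conjugation by \<open>g\<close> sends \<open>c\<close> to
        \<open>d \<otimes> c\<close>. As \<open>d\<close> lies in \<open>A\<close> and commutes with
        \<open>c\<close>, powers of \<open>c\<close> remain in the enlarged subgroup.\<close>
      define d where "d = g \<otimes> c \<otimes> inv (c \<otimes> g)"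
      have d: "d \<in> A" using c(4)[OF g] by (simp add: d_def)
      have conj: "g \<otimes> c \<otimes> inv g = d \<otimes> c" unfolding d_def using g c(1) by (simp add: inv_mult_group m_assoc)
      have "(\<lambda>y. g \<otimes> y \<otimes> inv g) \<in> hom G G"
        using g by (intro homI) (auto simp: m_assoc inv_solve_left)
      then have "g \<otimes> c [^] i \<otimes> inv g = (d \<otimes> c) [^] i"
        using hom_int_pow[of "\<lambda>y. g \<otimes> y \<otimes> inv g" G G c i] c(1) conj is_group by simp
      also have "\<dots> = d [^] i \<otimes> c [^] i"
        using c(2)[OF d] AG[OF d] c(1) by (intro int_pow_mult_distrib) auto
      finally have ci: "g \<otimes> c [^] i \<otimes> inv g = d [^] i \<otimes> c [^] i" .
      have "g \<otimes> u \<otimes> inv g = (g \<otimes> a \<otimes> inv g) \<otimes> (g \<otimes> c [^] i \<otimes> inv g)"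
        unfolding u(1) using g AG[OF u(2)] c(1) by (simp add: m_assoc) (simp flip: m_assoc)
      also have "\<dots> = (g \<otimes> a \<otimes> inv g \<otimes> d [^] i) \<otimes> c [^] i"
        unfolding ci using g AG[OF u(2)] AG[OF d] c(1) by (simp add: m_assoc)
      finally show ?thesis
        using BI[of "g \<otimes> a \<otimes> inv g \<otimes> d [^] i" i] A.inv_op_closed2[OF g u(2)]
          subgroup_int_pow_closed[OF A.subgroup_axioms d] by simp
    qed
    have "?B \<lhd> G" by (intro iffD2[OF normal_inv_iff] conjI ballI adj(1) conjB)
    then have "?B \<in> ?S" using adj(2) by (intro CollectI conjI)
    then have "?B = A" using max[THEN bspec, of ?B] adj(3) by simp
    then show False using adj(4) c(3) by simp
  qed
  then show ?thesis using A by blast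
qed

text \<open>Conjugation gives a map from the group to the finite set of self-maps of
  \<open>A\<close>. Two elements with equal images differ by an element centralizing
  \<open>A\<close>, hence by an element of \<open>A\<close>, so the fibres are finite too.\<close>

lemma finite_of_finite_self_centralizing:
  assumes A: "A \<lhd> G" "finite A"
    and self: "\<forall>c\<in>carrier G. (\<forall>a\<in>A. c \<otimes> a = a \<otimes> c) \<longrightarrow> c \<in> A"
  shows "finite (carrier G)"
proof -
  interpret A: normal A G by (rule A(1))
  have AG: "a \<in> carrier G" if "a \<in> A" for a using that A.subset by blast
  define f where "f g = restrict (\<lambda>a. g \<otimes> a \<otimes> inv g) A" for g
  have "f ` carrier G \<subseteq> A \<rightarrow>\<^sub>E A" using A.inv_op_closed2 by (auto simp: f_def)
  then have fin: "finite (f ` carrier G)" using finite_PiE[OF A(2), of "\<lambda>_. A"] A(2) finite_subset by blast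
  have fib: "finite {g \<in> carrier G. f g = f h}" if h: "h \<in> carrier G" for h
  proof (rule finite_subset)
    show "finite ((\<lambda>a. h \<otimes> a) ` A)" using A(2) by simp
    show "{g \<in> carrier G. f g = f h} \<subseteq> (\<lambda>a. h \<otimes> a) ` A"
    proof
      fix g assume g: "g \<in> {g \<in> carrier G. f g = f h}"
      have "inv h \<otimes> g \<otimes> a = a \<otimes> (inv h \<otimes> g)" if a: "a \<in> A" for a
      proof -
        have "f g a = f h a" using g by simp
        then have "g \<otimes> a \<otimes> inv g = h \<otimes> a \<otimes> inv h" using a by (simp add: f_def)
        then have "inv h \<otimes> (g \<otimes> a \<otimes> inv g) \<otimes> g = inv h \<otimes> (h \<otimes> a \<otimes> inv h) \<otimes> g" by simp
        then show ?thesis using g h AG[OF a] by (simp add: m_assoc) (simp flip: m_assoc)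
      qed
      then have "inv h \<otimes> g \<in> A" using self g h by simp
      moreover have "g = h \<otimes> (inv h \<otimes> g)" using g h by (simp flip: m_assoc)
      ultimately show "g \<in> (\<lambda>a. h \<otimes> a) ` A" by blast
    qed
  qed
  have "carrier G = (\<Union>\<phi>\<in>f ` carrier G. {g \<in> carrier G. f g = \<phi>})" by blast
  moreover have "finite (\<Union>\<phi>\<in>f ` carrier G. {g \<in> carrier G. f g = \<phi>})" using fin fib by blast
  ultimately show ?thesis by simp
qed

lemma countable_generate:
  assumes "countable S" "S \<subseteq> carrier G"
  shows "countable (generate G S)"
proof -
  let ?S = "S \<union> (\<lambda>x. inv x) ` S"
  define w where "w xs = foldr (\<otimes>) xs \<one>" for xs
  have w_closed: "w xs \<in> carrier G" if "xs \<in> lists ?S" for xs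
    using that by induction (use assms in \<open>auto simp: w_def\<close>)
  have w_app: "w (xs @ ys) = w xs \<otimes> w ys" if "xs \<in> lists ?S" "ys \<in> lists ?S" for xs ys
    using that(1)
  proof induction
    case Nil
    then show ?case using w_closed[OF that(2)] by (simp add: w_def)
  next
    case (Cons a xs)
    then show ?case using w_closed[OF Cons(2)] w_closed[OF that(2)] assms(2)
      by (auto simp: w_def m_assoc)
  qed
  have "generate G S \<subseteq> w ` lists ?S"
  proof
    fix g assume "g \<in> generate G S"
    then show "g \<in> w ` lists ?S"
    proof induction
      case one
      show ?case by (rule image_eqI[of _ _ "[]"]) (auto simp: w_def)
    next
      case (incl h)
      then show ?case using assms by (intro image_eqI[of _ _ "[h]"]) (auto simp: w_def)
    next
      case (inv h)
      then show ?case using assms by (intro image_eqI[of _ _ "[inv h]"]) (auto simp: w_def)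
    next
      case (eng h1 h2)
      then obtain xs ys where "h1 = w xs" "xs \<in> lists ?S" "h2 = w ys" "ys \<in> lists ?S" by blast
      then show ?case using w_app by (intro image_eqI[of _ _ "xs @ ys"]) auto
    qed
  qed
  moreover have "countable (w ` lists ?S)" using assms(1) by (intro countable_image countable_lists) auto
  ultimately show ?thesis using countable_subset by blast
qed

end

section \<open>Locally compact hereditarily minimal groups\<close>

lemma countable_fibers:
  assumes "countable B" "f ` A \<subseteq> B" "\<And>b. b \<in> B \<Longrightarrow> countable {a \<in> A. f a = b}"
  shows "countable A"
proof -
  have "countable (\<Union>b\<in>B. {a \<in> A. f a = b})" by (rule countable_UN[OF assms(1,3)])
  moreover have "A \<subseteq> (\<Union>b\<in>B. {a \<in> A. f a = b})" using assms(2) by blast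
  ultimately show ?thesis by (rule countable_subset[rotated])
qed

text \<open>The pigeonhole hypothesis excludes infinitely many cosets of \<open>N\<close>; the order
  of the finite quotient is the required exponent.\<close>

lemma (in group) uniform_exponent_mod:
  assumes norm: "N \<lhd> G"
    and pigeonhole: "\<And>a. (\<And>n::nat. a n \<in> carrier G) \<Longrightarrow> \<exists>i j. i < j \<and> a j \<otimes> inv (a i) \<in> N"
  shows "\<exists>o'::nat>0. \<forall>g\<in>carrier G. g [^] o' \<in> N"
proof -
  interpret N: normal N G by (rule norm)
  interpret Q: group "G Mod N" by (rule N.factorgroup_is_group)
  have "finite (rcosets N)"
  proof (rule ccontr)
    assume "infinite (rcosets N)"
    then obtain f :: "nat \<Rightarrow> 'a set" where f: "inj f" "range f \<subseteq> rcosets N"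
      using infinite_countable_subset by blast
    have "\<exists>a. a \<in> carrier G \<and> f n = N #> a" for n using f(2) unfolding RCOSETS_def by blast
    then obtain a where a: "\<And>n. a n \<in> carrier G" "\<And>n. f n = N #> a n" by metis
    obtain i j where ij: "i < j" "a j \<otimes> inv (a i) \<in> N"
      using pigeonhole[of a, OF a(1)] by (elim exE conjE)
    have eq: "a j = a j \<otimes> inv (a i) \<otimes> a i" using a(1) by (simp add: m_assoc)
    have "a j \<in> N #> a i"
      unfolding r_coset_def by (rule UN_I[OF ij(2)], rule singleton_iff[THEN iffD2], rule eq)
    then have "f i = f j" unfolding a(2) by (rule repr_independence[OF _ a(1) N.subgroup_axioms])
    then show False using f(1) ij(1) by (metis injD less_irrefl)
  qed
  then have o: "Coset.order (G Mod N) > 0" using Q.order_gt_0_iff_finite by (simp add: FactGroup_def)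
  have "g [^] Coset.order (G Mod N) \<in> N" if g: "g \<in> carrier G" for g
  proof -
    have "N #> g \<in> carrier (G Mod N)" using g by (auto simp: FactGroup_def RCOSETS_def)
    from Q.pow_order_eq_1[OF this] have "N #> (g [^] Coset.order (G Mod N)) = N"
      unfolding N.FactGroup_pow[OF g] by simp
    then show ?thesis using rcos_self[OF nat_pow_closed[OF g] N.subgroup_axioms] by metis
  qed
  then show ?thesis using o by blast
qed

context padic_monothetic
begin

lemma KK_open: "\<exists>U. nbhd_one U \<and> K \<inter> U \<subseteq> KK n"
proof -
  let ?C = "\<Union>i\<in>{0..<int p ^ n} - {0}. coset n i"
  have "closedin T ?C" using closed_coset by (intro closedin_Union) auto
  from openin_diff[OF openin_topspace this] have "openin T (carrier G - ?C)" by (simp only: topspace)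
  moreover have "\<one> \<notin> coset n i" if i: "i \<in> {0..<int p ^ n} - {0}" for i
  proof
    assume "\<one> \<in> coset n i"
    moreover have "\<one> \<in> coset n 0" using x_pow_in_coset[of 0 n] by simp
    ultimately have "int p ^ n dvd i - 0" by (rule coset_coset_dvd)
    then show False using i zdvd_not_zless[of i "int p ^ n"] by auto
  qed
  ultimately have "nbhd_one (carrier G - ?C)" unfolding nbhd_one_def by blast
  moreover have "y \<in> KK n" if y: "y \<in> K \<inter> (carrier G - ?C)" for y
  proof -
    have "y \<in> coset n 0" using digits[of y n] y by (metis Diff_iff IntD1 IntD2 UN_I empty_iff insert_iff)
    then show ?thesis using K_carrier y by (auto simp: coset_def)
  qed
  ultimately show ?thesis by blast
qed

end

section \<open>Comparing elements with a given element of infinite order\<close>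

locale locally_compact_hm_group = hm_group +
  assumes locally_compact: "locally_compact_space T"
begin

lemma padic_monotheticE:
  assumes "infinite_order x"
  obtains p where "padic_monothetic G T x p"
proof -
  interpret compact_monothetic G T x
    using assms compact_cyclic_closure[OF locally_compact assms] by unfold_locales
  obtain p where "prime p" "powers p K \<noteq> K" using exists_prime_not_divisible by blast
  then have "padic_monothetic G T x p" by unfold_locales
  then show thesis by (rule that)
qed

text \<open>A finite \<open>cyc g\<close> is closed and meets the torsion-free \<open>K\<close>
  trivially, so \<open>commuting_meets\<close> would force \<open>g\<close> to be the
  identity.\<close>

lemma commuting_infinite_order:
  assumes x: "infinite_order x" and g: "g \<in> carrier G" "g \<noteq> \<one>" "g \<otimes> x = x \<otimes> g"
  shows "infinite_order g"
proof (rule ccontr)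
  assume no: "\<not> infinite_order g"
  interpret compact_monothetic G T x
    using x compact_cyclic_closure[OF locally_compact x] by unfold_locales
  obtain n :: nat where n: "n > 0" "g [^] n = \<one>" using no g(1) by (auto simp: infinite_order_def)
  have cl: "cyclic_closure g = cyc g"
    using closure_of_closedin[OF closedin_cyc_finite_order[OF g(1) n]] .
  have "K \<inter> cyclic_closure g \<subseteq> {\<one>}"
  proof
    fix z assume z: "z \<in> K \<inter> cyclic_closure g"
    then obtain i :: int where i: "z = g [^] i" unfolding cl by (auto simp: cyc_def)
    have "z [^] n = (g [^] int n) [^] i"
      unfolding i using g(1) by (simp add: int_pow_nat_pow int_pow_pow mult.commute)
    then have "z [^] n = \<one>" using n(2) by (simp add: int_pow_int)
    then have "z = \<one>" using K_torsion_free n(1) z by blast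
    then show "z \<in> {\<one>}" by simp
  qed
  then show False using commuting_meets g by blast
qed

text \<open>The intersection of the two monothetic closures is a nontrivial closed subgroup of the
  closure belonging to \<open>g\<close>, so it contains a positive power of
  \<open>g\<close>.\<close>

lemma commuting_power_in:
  assumes x: "infinite_order x" and g: "g \<in> carrier G" "g \<otimes> x = x \<otimes> g"
  shows "\<exists>m::nat>0. g [^] m \<in> cyclic_closure x"
proof (cases "g = \<one>")
  case True
  have "x \<in> carrier G" using x by (simp add: infinite_order_def)
  then have "\<one> \<in> cyclic_closure x"
    using abelian_cyclic_closure[of x] subgroup.one_closed[of "cyclic_closure x" G]
    by (simp add: abelian_subgroup_def)
  then show ?thesis using True by (intro exI[of _ 1]) simp
next
  case False
  interpret compact_monothetic G T x
    using x compact_cyclic_closure[OF locally_compact x] by unfold_locales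
  have ig: "infinite_order g" using commuting_infinite_order[OF x g(1) False g(2)] .
  let ?L = "cyclic_closure g"
  have L: "subgroup ?L G" using abelian_cyclic_closure[OF g(1)] by (simp add: abelian_subgroup_def)
  have "\<not> K \<inter> ?L \<subseteq> {\<one>}" using commuting_meets[OF g] False by blast
  then have "K \<inter> ?L \<noteq> {\<one>}" by blast
  moreover have "subgroup (K \<inter> ?L) G" using subgroups_Inter_pair[OF subgroup_K L] .
  moreover have "closedin T (K \<inter> ?L)" by (intro closedin_Int) auto
  ultimately obtain n :: nat where "n > 0" "g [^] n \<in> K \<inter> ?L"
    using closed_subgroup_meets[OF ig, of "K \<inter> ?L"] by blast
  then show ?thesis by blast
qed

lemma subgroup_pow_preimage:
  assumes comm: "\<And>g h. g \<in> carrier G \<Longrightarrow> h \<in> carrier G \<Longrightarrow> g \<otimes> h = h \<otimes> g" and N: "subgroup N G"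
  shows "subgroup {g \<in> carrier G. g [^] (m::nat) \<in> N} G"
proof (rule subgroupI)
  show "{g \<in> carrier G. g [^] m \<in> N} \<noteq> {}"
    using subgroup.one_closed[OF N] by (auto intro!: exI[of _ \<one>])
qed (use subgroup.m_inv_closed[OF N] subgroup.m_closed[OF N] comm in \<open>simp_all add: nat_pow_inv pow_mult_distrib subset_iff\<close>)

text \<open>The group is a countable union of the closed subgroups of elements with
  \<open>m\<close>-th power in \<open>K\<close>. One has an interior point, which translates to the
  identity.\<close>

lemma Baire_open_power_subgroup:
  assumes comm: "\<And>g h. g \<in> carrier G \<Longrightarrow> h \<in> carrier G \<Longrightarrow> g \<otimes> h = h \<otimes> g"
    and K: "subgroup K G" "closedin T K" and pow: "\<And>g. g \<in> carrier G \<Longrightarrow> \<exists>m::nat>0. g [^] m \<in> K"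
  shows "\<exists>m::nat>0. subgroup {g \<in> carrier G. g [^] m \<in> K} G \<and>
    (\<exists>V. nbhd_one V \<and> V \<subseteq> {g \<in> carrier G. g [^] m \<in> K})"
proof -
  let ?R = "\<lambda>m::nat. {g \<in> carrier G. g [^] m \<in> K}"
  have R: "subgroup (?R m) G" for m using comm K(1) by (rule subgroup_pow_preimage)
  have closed: "closedin T (?R m)" for m
  proof -
    have "continuous_map T T (\<lambda>k. k [^] m)" by (rule cont_pow) auto
    from closedin_continuous_map_preimage[OF this K(2)] show ?thesis by simp
  qed
  have reg: "regular_space T" using locally_compact_Hausdorff_imp_regular_space locally_compact Hausdorff by blast
  have "\<exists>m>0. T interior_of ?R m \<noteq> {}"
  proof (rule ccontr)
    assume no: "\<not> ?thesis"
    have "T interior_of \<Union>(?R ` {0<..}) = {}"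
    proof (rule Baire_category_alt)
      fix S assume "S \<in> ?R ` {0<..}"
      then obtain m where "m > 0" "S = ?R m" by blast
      then show "closedin T S \<and> T interior_of S = {}" using closed[of m] no by blast
    qed (use locally_compact reg in auto)
    moreover have "\<Union>(?R ` {0<..}) = carrier G" using pow by blast
    moreover have "T interior_of (carrier G) = carrier G" using interior_of_topspace[of T] by simp
    ultimately show False by auto
  qed
  then obtain m c where m: "m > 0" "c \<in> T interior_of ?R m" by blast
  let ?W = "T interior_of ?R m"
  have c: "c \<in> ?R m" using m(2) interior_of_subset[of T "?R m"] by blast
  have "nbhd_one {y \<in> carrier G. c \<otimes> y \<in> ?W}"
    using openin_lmult[OF _ openin_interior_of, of c "?R m"] m(2) c by (simp add: nbhd_one_def)
  moreover have "y \<in> ?R m" if y: "y \<in> carrier G" "c \<otimes> y \<in> ?W" for y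
  proof -
    have "c \<otimes> y \<in> ?R m" using y(2) interior_of_subset[of T "?R m"] by blast
    then have "inv c \<otimes> (c \<otimes> y) \<in> ?R m" using subgroup.m_closed[OF R subgroup.m_inv_closed[OF R c]] by blast
    moreover have "inv c \<otimes> (c \<otimes> y) = y" using c y(1) by (simp flip: m_assoc)
    ultimately show ?thesis by simp
  qed
  ultimately show ?thesis using m(1) R by blast
qed

text \<open>Baire's theorem yields an open subgroup \<open>?R\<close> on which one exponent works;
  total boundedness makes its index finite. The product of that exponent and the order of the
  quotient works everywhere.\<close>

lemma uniform_power_in:
  assumes x: "infinite_order x"
    and comm: "\<And>g h. g \<in> carrier G \<Longrightarrow> h \<in> carrier G \<Longrightarrow> g \<otimes> h = h \<otimes> g"
  shows "\<exists>M::nat>0. \<forall>g\<in>carrier G. g [^] M \<in> cyclic_closure x"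
proof -
  obtain p where "padic_monothetic G T x p" using padic_monotheticE[OF x] .
  then interpret padic_monothetic G T x p .
  have pow: "\<exists>m::nat>0. g [^] m \<in> K" if "g \<in> carrier G" for g
    using commuting_power_in[OF x that] comm that x_carrier by blast
  have "\<exists>m::nat>0. subgroup {g \<in> carrier G. g [^] m \<in> K} G \<and>
      (\<exists>V. nbhd_one V \<and> V \<subseteq> {g \<in> carrier G. g [^] m \<in> K})"
    using comm subgroup_K closed_K pow by (rule Baire_open_power_subgroup)
  then obtain m :: nat and V where m: "m > 0" and R: "subgroup {g \<in> carrier G. g [^] m \<in> K} G"
    and V: "nbhd_one V" "V \<subseteq> {g \<in> carrier G. g [^] m \<in> K}" by blast
  let ?R = "{g \<in> carrier G. g [^] m \<in> K}"
  have abG: "abelian_subgroup (carrier G)"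
    using comm subgroup_self by (simp add: abelian_subgroup_def)
  have tb: "\<exists>i j. i < j \<and> a j \<otimes> inv (a i) \<in> ?R" if a: "\<And>n::nat. a n \<in> carrier G" for a
  proof -
    have "\<exists>i j. i < j \<and> a j \<otimes> inv (a i) \<in> V"
    proof (rule totally_bounded[OF abG _ a V(1)])
      fix h assume h: "h \<in> carrier G" "h \<noteq> \<one>"
      have "infinite_order h" using commuting_infinite_order[OF x h comm[OF h(1) x_carrier]] .
      \<comment> \<open>Residual discreteness is pulled back from \<open>K\<close>: some
        \<open>KK n\<close> misses \<open>h [^] m\<close>, and its preimage under the
        \<open>m\<close>-th power map is an open subgroup missing \<open>h\<close>.\<close>
      then have "h [^] m \<noteq> \<one>" using m by (simp add: infinite_order_def)
      then have "h [^] m \<notin> (\<Inter>n. KK n)" unfolding Inter_KK by simp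
      then obtain n where n: "h [^] m \<notin> KK n" by blast
      let ?N = "{g \<in> carrier G. g [^] m \<in> KK n}"
      have "subgroup ?N G" using comm subgroup_powers_K by (rule subgroup_pow_preimage)
      moreover obtain U where U: "nbhd_one U" "K \<inter> U \<subseteq> KK n" using KK_open by blast
      obtain W where W: "nbhd_one W" "\<forall>w\<in>W. w [^] m \<in> U" using nbhd_one_pow[OF U(1)] by blast
      have "carrier G \<inter> (V \<inter> W) \<subseteq> ?N" using U(2) W(2) V(2) by blast
      moreover have "nbhd_one (V \<inter> W)" using nbhd_one_Int[OF V(1) W(1)] .
      ultimately show "\<exists>N V. subgroup N G \<and> N \<subseteq> carrier G \<and> nbhd_one V \<and> carrier G \<inter> V \<subseteq> N \<and> h \<notin> N"
        using n by (intro exI[of _ ?N] exI[of _ "V \<inter> W"]) auto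
    qed
    then show ?thesis using V(2) by blast
  qed
  have norm: "?R \<lhd> G"
  proof (intro iffD2[OF normal_inv_iff] conjI ballI)
    fix g h assume g: "g \<in> carrier G" and h: "h \<in> ?R"
    have "g \<otimes> h \<otimes> inv g = h" using g h comm[OF g, of h] by (simp add: m_assoc)
    then show "g \<otimes> h \<otimes> inv g \<in> ?R" using h by simp
  qed (rule R)
  from uniform_exponent_mod[OF norm tb]
  obtain o' :: nat where o: "o' > 0" "\<And>g. g \<in> carrier G \<Longrightarrow> g [^] o' \<in> ?R" by blast
  have "g [^] (o' * m) \<in> K" if g: "g \<in> carrier G" for g
    using o(2)[OF g] g by (simp add: nat_pow_pow)
  then show ?thesis using o(1) m by (intro exI[of _ "o' * m"]) simp
qed

text \<open>Among all pairs of a generator \<open>y\<close> and a uniform exponent \<open>M\<close>,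
  take one with \<open>M\<close> least. An element outside \<open>K\<close> leads to a
  \<open>p\<close>-th root \<open>h\<close> of a generator of \<open>K\<close>, with which
  \<open>M\<close> could be replaced by \<open>M\<close> divided by \<open>p\<close>.\<close>

lemma abelian_monothetic:
  assumes x: "infinite_order x"
    and comm: "\<And>g h. g \<in> carrier G \<Longrightarrow> h \<in> carrier G \<Longrightarrow> g \<otimes> h = h \<otimes> g"
  shows "\<exists>y. infinite_order y \<and> cyclic_closure y = carrier G"
proof -
  define P where "P M y \<longleftrightarrow> infinite_order y \<and> M > 0 \<and> (\<forall>g\<in>carrier G. g [^] M \<in> cyclic_closure y)"
    for M :: nat and y
  have inf: "infinite_order g" if "g \<in> carrier G" "g \<noteq> \<one>" for g
    using commuting_infinite_order[OF x that comm[OF that(1)]] x by (simp add: infinite_order_def)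
  have ex: "\<exists>M y. P M y" unfolding P_def using uniform_power_in[OF x comm] x by blast
  define M where "M = (LEAST M. \<exists>y. P M y)"
  obtain y where y: "P M y" using LeastI_ex[OF ex] unfolding M_def by blast
  have least: "M \<le> M'" if "P M' z" for M' z unfolding M_def using that by (intro Least_le) blast
  have iy: "infinite_order y" and M: "M > 0" "\<And>g. g \<in> carrier G \<Longrightarrow> g [^] M \<in> cyclic_closure y"
    using y by (auto simp: P_def)
  obtain p where "padic_monothetic G T y p" using padic_monotheticE[OF iy] .
  then interpret padic_monothetic G T y p .
  have "carrier G \<subseteq> K"
  proof (rule ccontr)
    assume "\<not> carrier G \<subseteq> K"
    then obtain h0 where h0: "h0 \<in> carrier G" "h0 \<notin> K" by blast
    define m where "m = (LEAST m::nat. m > 0 \<and> h0 [^] m \<in> K)"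
    have m: "m > 0" "h0 [^] m \<in> K"
      using LeastI[of "\<lambda>m. m > 0 \<and> h0 [^] m \<in> K" M] M h0(1) unfolding m_def by auto
    have "m \<noteq> 1" using m(2) h0 by auto
    \<comment> \<open>Lowering the order of \<open>h0\<close> modulo \<open>K\<close> to a prime
      \<open>q\<close> gives \<open>h\<close> outside \<open>K\<close> with its \<open>q\<close>-th
      power inside.\<close>
    then obtain q m' where q: "prime q" "m = q * m'" using prime_factor_nat[of m] by auto
    define h where "h = h0 [^] m'"
    have hc: "h \<in> carrier G" using h0 by (simp add: h_def)
    have "m' > 0" "m' < m" using q m(1) prime_gt_1_nat[OF q(1)] by auto
    then have hK: "h \<notin> K" unfolding h_def using not_less_Least[of m' "\<lambda>m. m > 0 \<and> h0 [^] m \<in> K"]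
      by (simp add: m_def)
    have hq: "h [^] q \<in> K" using m(2) q(2) h0(1) by (simp add: h_def nat_pow_pow mult.commute)
    have root: "a \<in> L" if "subgroup L G" "a \<in> carrier G" "a [^] n \<in> powers n L" "0 < n" for a n L
    proof -
      obtain l where l: "l \<in> L" "a [^] n = l [^] n" using \<open>a [^] n \<in> powers n L\<close> by blast
      have lc: "l \<in> carrier G" using subgroup.mem_carrier[OF that(1) l(1)] .
      have "(a \<otimes> inv l) [^] n = a [^] n \<otimes> inv l [^] n"
        using that(2) lc comm by (intro pow_mult_distrib) auto
      then have "(a \<otimes> inv l) [^] n = \<one>" using l(2) lc by (simp add: nat_pow_inv)
      then have "a \<otimes> inv l = \<one>" using inf[of "a \<otimes> inv l"] that(2,4) lc unfolding infinite_order_def by auto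
      then have "a = l" using that(2) lc by (metis inv_equality inv_inv inv_closed)
      then show ?thesis using l(1) by simp
    qed
    \<comment> \<open>Roots are unique in the torsion-free group, so a \<open>q\<close>-th root of
      \<open>h [^] q\<close> in \<open>K\<close> would be \<open>h\<close>. Only
      \<open>q = p\<close> admits elements of \<open>K\<close> without such a root.\<close>
    have nq: "h [^] q \<notin> powers q K" using root[OF subgroup_K hc, of q] hK prime_gt_0_nat[OF q(1)] by blast
    have "q = p"
    proof (rule ccontr)
      assume "q \<noteq> p"
      then have "coprime q p" using q(1) prime_p by (simp add: primes_coprime)
      then show False using powers_coprime nq hq by simp
    qed
    then have sub: "K \<subseteq> cyclic_closure (h [^] p)" using generator hq nq by simp
    have "h \<noteq> \<one>" using hK K_one by blast
    then have ih: "infinite_order h" using inf hc by blast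
    let ?L = "cyclic_closure h"
    have abL: "abelian_subgroup ?L" using abelian_cyclic_closure[OF hc] .
    have L: "subgroup ?L G" using abL by (simp add: abelian_subgroup_def)
    have cL: "compactin T ?L" using compact_cyclic_closure[OF locally_compact ih] .
    have "cyclic_closure (h [^] p) \<subseteq> powers p ?L"
      using subgroup_powers[OF abL] closedin_compactin[OF compactin_powers[OF cL]] in_cyclic_closure[OF hc]
      by (intro cyclic_closure_minimal) auto
    then have KL: "K \<subseteq> powers p ?L" using sub by blast
    \<comment> \<open>Both \<open>h [^] p\<close> and \<open>h [^] M\<close> lie in
      \<open>K\<close>; coprime exponents would put \<open>h\<close> there.\<close>
    have "p dvd M"
    proof (rule ccontr)
      assume "\<not> p dvd M"
      then have "coprime (int p) (int M)" using prime_p prime_imp_coprime[of p M] by simp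
      then have "h \<in> K"
        using coprime_int_pow_mem[OF subgroup_K hc, of "int p" "int M"] hq M(2)[OF hc] \<open>q = p\<close>
        by (simp add: int_pow_int)
      then show False using hK by contradiction
    qed
    then obtain M' where M': "M = p * M'" by blast
    have "M' > 0" "M' < M" using M' M(1) prime_gt_1_nat[OF prime_p] by auto
    moreover have "g [^] M' \<in> ?L" if g: "g \<in> carrier G" for g
    proof (rule root[OF L _ _ p_pos(2)])
      show "(g [^] M') [^] p \<in> powers p ?L"
        using M(2)[OF g] KL g by (simp add: M' nat_pow_pow mult.commute subset_iff)
    qed (use g in simp)
    \<comment> \<open>The power \<open>g [^] M\<close> lies in \<open>K\<close> and hence is a
      \<open>p\<close>-th power from \<open>?L\<close>; cancelling the root gives
      \<open>g [^] M'\<close> in \<open>?L\<close>.\<close>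
    ultimately have "P M' h" unfolding P_def using ih by blast
    then have "M \<le> M'" by (rule least)
    then show False using \<open>M' < M\<close> by simp
  qed
  then show ?thesis using iy closure_in_carrier by blast
qed

text \<open>The closure \<open>?C\<close> of a countably infinite subgroup \<open>H\<close> stays
  countable: by \<open>essential\<close> its elements of prime order already lie in
  \<open>H\<close>, and fibres of prime power maps carry this to all torsion. Countability makes
  \<open>?C\<close> discrete, while total boundedness makes discrete abelian subgroups
  finite.\<close>

lemma infinite_abelian_not_torsion:
  assumes A: "abelian_subgroup A" "infinite A"
    and tors: "\<And>g. g \<in> carrier G \<Longrightarrow> \<not> infinite_order g"
  shows False
proof -
  have sA: "subgroup A G" using A(1) by (simp add: abelian_subgroup_def)
  obtain f :: "nat \<Rightarrow> 'a" where f: "inj f" "range f \<subseteq> A" using infinite_countable_subset[OF A(2)] by blast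
  define H where "H = generate G (range f)"
  have fG: "range f \<subseteq> carrier G" using f(2) subgroup.subset[OF sA] by blast
  have cH: "countable H" unfolding H_def using countable_generate[OF _ fG] by simp
  have sH: "subgroup H G" unfolding H_def using generate_is_subgroup[OF fG] .
  have "H \<subseteq> A" unfolding H_def using generate_subgroup_incl[OF f(2) sA] .
  then have H: "abelian_subgroup H" using A(1) sH unfolding abelian_subgroup_def by blast
  have fH: "f n \<in> H" for n unfolding H_def by (rule generate.incl) simp
  let ?C = "T closure_of H"
  have abC: "abelian_subgroup ?C" using abelian_subgroup_closure[OF H] .
  have C: "subgroup ?C G" using abC by (simp add: abelian_subgroup_def)
  have CG: "y \<in> carrier G" if "y \<in> ?C" for y using closure_in_carrier that by blast
  have prime_order: "y \<in> H" if y: "y \<in> ?C" "y [^] q = \<one>" "prime q" for y and q :: nat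
  proof (rule ccontr)
    assume no: "y \<notin> H"
    have yc: "y \<in> carrier G" using CG y(1) .
    have "cyc y = {\<one>}"
    proof (rule essential[OF H cyc_subgroup[OF yc]])
      show "closedin T (cyc y)" using closedin_cyc_finite_order[OF yc prime_gt_0_nat[OF y(3)] y(2)] .
      show "cyc y \<subseteq> ?C" using cyc_subset[OF C y(1)] .
      show "cyc y \<inter> H \<subseteq> {\<one>}"
      proof
        fix z assume z: "z \<in> cyc y \<inter> H"
        then obtain i :: int where i: "z = y [^] i" by (auto simp: cyc_def)
        have "int q dvd i"
        proof (rule ccontr)
          assume "\<not> int q dvd i"
          then have "coprime (int q) i" using y(3) prime_imp_coprime[of "int q" i] by simp
          then have "y \<in> H"
            using coprime_int_pow_mem[OF sH yc, of "int q" i] y(2) z i subgroup.one_closed[OF sH]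
            by (simp add: int_pow_int)
          then show False using no by contradiction
        qed
        then obtain j where "i = int q * j" by blast
        then have "z = (y [^] int q) [^] j" using i yc by (simp add: int_pow_pow)
        then show "z \<in> {\<one>}" using y(2) by (simp add: int_pow_int)
      qed
    qed
    then show False using no in_cyc[OF yc] subgroup.one_closed[OF sH] by simp
  qed
  have countable_torsion: "countable {y \<in> ?C. y [^] n = \<one>}" if "n > 0" for n :: nat
    using that
  proof (induction n rule: less_induct)
    case (less n)
    show ?case
    proof (cases "n = 1")
      case True
      have "{y \<in> ?C. y [^] n = \<one>} \<subseteq> {\<one>}" using True CG by auto
      then show ?thesis by (rule countable_subset) simp
    next
      case False
      then obtain q m where q: "prime q" "n = q * m" using prime_factor_nat[of n] by auto
      have m: "m < n" "m > 0" using q less.prems prime_gt_1_nat[OF q(1)] by auto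
      show ?thesis
      proof (rule countable_fibers[OF less.IH[OF m], of "\<lambda>y. y [^] q"])
        show "(\<lambda>y. y [^] q) ` {y \<in> ?C. y [^] n = \<one>} \<subseteq> {y \<in> ?C. y [^] m = \<one>}"
          using subgroup_nat_pow_closed[OF C] CG q(2) by (auto simp: nat_pow_pow)
        fix b
        show "countable {y \<in> {y \<in> ?C. y [^] n = \<one>}. y [^] q = b}" (is "countable ?F")
        proof (cases "?F = {}")
          case True
          show ?thesis unfolding True by simp
        next
          case False
          then obtain y0 where y0: "y0 \<in> ?C" "y0 [^] q = b" by blast
          \<comment> \<open>Two points of one fibre differ by an element whose \<open>q\<close>-th
            power is the identity, which lies in the countable \<open>H\<close>.\<close>
          have "?F \<subseteq> (\<lambda>h. y0 \<otimes> h) ` H"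
          proof
            fix y assume y: "y \<in> ?F"
            have c: "y0 \<in> carrier G" "y \<in> carrier G" using CG y y0 by auto
            have i: "inv y0 \<in> ?C" using subgroup.m_inv_closed[OF C y0(1)] .
            have "(inv y0 \<otimes> y) [^] q = inv y0 [^] q \<otimes> y [^] q"
              using abelian_pow_mult[OF abC i] y by blast
            also have "\<dots> = \<one>" using y y0 c nat_pow_closed[OF c(1)] by (auto simp: nat_pow_inv)
            finally have "inv y0 \<otimes> y \<in> H" using prime_order[OF _ _ q(1)] subgroup.m_closed[OF C i] y by blast
            moreover have "y = y0 \<otimes> (inv y0 \<otimes> y)" using c by (simp flip: m_assoc)
            ultimately show "y \<in> (\<lambda>h. y0 \<otimes> h) ` H" by blast
          qed
          then show ?thesis by (rule countable_subset) (rule countable_image[OF cH])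
        qed
      qed
    qed
  qed
  have "?C \<subseteq> (\<Union>n\<in>{0<..}. {y \<in> ?C. y [^] (n::nat) = \<one>})"
  proof
    fix y assume y: "y \<in> ?C"
    then obtain n :: nat where "n > 0" "y [^] n = \<one>"
      using tors[of y] CG[of y] unfolding infinite_order_def by blast
    then show "y \<in> (\<Union>n\<in>{0<..}. {y \<in> ?C. y [^] (n::nat) = \<one>})" using y by blast
  qed
  moreover have "countable (\<Union>n\<in>{0<..}. {y \<in> ?C. y [^] (n::nat) = \<one>})"
    by (rule countable_UN) (use countable_torsion in auto)
  ultimately have "countable ?C" by (rule countable_subset)
  moreover have "locally_compact_space (subtopology T ?C)"
    by (rule locally_compact_space_closed_subset[OF locally_compact closedin_closure_of])
  ultimately obtain V where V: "nbhd_one V" "?C \<inter> V \<subseteq> {\<one>}"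
    using countable_closed_subgroup_discrete[OF C closedin_closure_of] by blast
  have HC: "H \<subseteq> ?C" using closure_of_subset[of H T] subgroup.subset[OF sH] by simp
  then have "H \<inter> V \<subseteq> {\<one>}" using V(2) by blast
  then obtain i j where ij: "i < j" "f j = f i"
    using discrete_sequence_repeats[OF H V(1) _ fH] by blast
  then show False using f(1) by (metis injD less_irrefl)
qed

end

theorem corollary4p3:
  fixes G :: "('a, 'm) monoid_scheme" and T :: "'a topology"
  assumes "topological_group G T"
    and "infinite (carrier G)"
    and "hereditarily_minimal G T"
    and "locally_compact_space T"
    and "hypercentral G"
  shows "\<exists>p :: nat. prime p \<and>
    topological_group_isomorphic G T (padic_integers p) (padic_topology p)"
proof -
  interpret locally_compact_hm_group G T
    using assms by (simp add: locally_compact_hm_group_def hm_group_def topgroup_def topgroup_axioms_def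
        hm_group_axioms_def locally_compact_hm_group_axioms_def topological_group_def)
  have "carrier G \<noteq> {\<one>\<^bsub>G\<^esub>}" using assms(2) by (metis finite.emptyI finite_insert)
  then obtain c where c: "c \<in> group_center G" "c \<noteq> \<one>\<^bsub>G\<^esub>"
    using hypercentral_center_nontrivial[OF assms(5)] by blast
  have cc: "c \<in> carrier G" "\<And>g. g \<in> carrier G \<Longrightarrow> g \<otimes>\<^bsub>G\<^esub> c = c \<otimes>\<^bsub>G\<^esub> g"
    using c(1) by (auto simp: group_center_def)
  have "infinite_order c"
  proof (rule ccontr)
    assume no: "\<not> infinite_order c"
    \<comment> \<open>The nontrivial central \<open>c\<close> commutes with every \<open>g\<close>,
      so an element of infinite order would force infinite order on \<open>c\<close>.\<close>
    have tors: "\<not> infinite_order g" if "g \<in> carrier G" for g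
      using commuting_infinite_order[OF _ cc(1) c(2), of g] cc(2)[OF that] no by metis
    obtain A where A: "A \<lhd> G" "\<forall>a\<in>A. \<forall>b\<in>A. a \<otimes>\<^bsub>G\<^esub> b = b \<otimes>\<^bsub>G\<^esub> a"
      "\<forall>c\<in>carrier G. (\<forall>a\<in>A. c \<otimes>\<^bsub>G\<^esub> a = a \<otimes>\<^bsub>G\<^esub> c) \<longrightarrow> c \<in> A"
      using maximal_abelian_normal[OF assms(5)] by blast
    have "infinite A" using finite_of_finite_self_centralizing[OF A(1) _ A(3)] assms(2) by blast
    moreover have "abelian_subgroup A" using A(1,2) by (simp add: abelian_subgroup_def normal_def)
    ultimately show False using infinite_abelian_not_torsion tors by blast
  qed
  note ic = this
  have "carrier G \<subseteq> group_center G"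
  proof (rule hypercentral_abelian[OF assms(5)])
    show "infinite_order g" if "g \<in> carrier G" "g \<noteq> \<one>\<^bsub>G\<^esub>" for g
      using commuting_infinite_order[OF ic that cc(2)[OF that(1)]] .
    fix g assume g: "g \<in> carrier G"
    obtain m :: nat where m: "m > 0" "g [^]\<^bsub>G\<^esub> m \<in> cyclic_closure c"
      using commuting_power_in[OF ic g cc(2)[OF g]] by blast
    have gm: "g [^]\<^bsub>G\<^esub> m \<in> carrier G" using g by simp
    \<comment> \<open>A positive power of \<open>g\<close> lies in the closure of the powers of
      \<open>c\<close>, and closures of central subgroups are central.\<close>
    have "h \<otimes>\<^bsub>G\<^esub> g [^]\<^bsub>G\<^esub> m = g [^]\<^bsub>G\<^esub> m \<otimes>\<^bsub>G\<^esub> h" if h: "h \<in> carrier G" for h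
    proof (rule closure_commute[OF _ h _ m(2), symmetric])
      show "cyc c \<subseteq> carrier G" using subgroup.subset[OF cyc_subgroup[OF cc(1)]] .
      show "s \<otimes>\<^bsub>G\<^esub> h = h \<otimes>\<^bsub>G\<^esub> s" if "s \<in> cyc c" for s
        using that int_pow_commute[OF cc(1) h cc(2)[OF h, symmetric]] by (auto simp: cyc_def)
    qed
    then have "g [^]\<^bsub>G\<^esub> m \<in> group_center G" using gm by (simp add: group_center_def)
    then show "\<exists>m::nat>0. g [^]\<^bsub>G\<^esub> m \<in> group_center G" using m(1) by blast
  qed
  then have "g \<otimes>\<^bsub>G\<^esub> h = h \<otimes>\<^bsub>G\<^esub> g" if "g \<in> carrier G" "h \<in> carrier G" for g h
    using that by (auto simp: group_center_def)
  from abelian_monothetic[OF ic this]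
  obtain y where y: "infinite_order y" "cyclic_closure y = carrier G" by blast
  obtain p where p: "padic_monothetic G T y p" using padic_monotheticE[OF y(1)] .
  then interpret padic_monothetic G T y p .
  show ?thesis using prime_p isomorphic_padic_integers[OF y(2)] by blast
qed

end
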